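(* Let $\Lambda$ be the QID random measure with data $(\nu_0,\nu_1,G_\cdot,M_\cdot)$ described in the context, with control measure $\lambda$, densities $a,\sigma^2$, kernel $\rho$ and measures $\tilde F^{+},\tilde F^{-}$ as defined there. Let $f:S\to\mathbb{R}$ be $\sigma(\mathcal{S})$-measurable. For $u\in\mathbb{R}$, $s\in S$ put $$U(u,s)=u\,a(s)+\int_{\mathbb{R}}\big(\tau(xu)-u\tau(x)\big)\rho(s,dx),\qquad V_0(u,s)=\int_{\mathbb{R}}(1\wedge|xu|^2)\,|\rho|(s,dx).$$ Then $f$ is $\Lambda$-integrable if the following three conditions hold: (i) $\int_S|U(f(s),s)|\,\lambda(ds)<\infty$; (ii) $\int_S|f(s)|^2\sigma^2(s)\,\lambda(ds)<\infty$; (iii) $\int_S V_0(f(s),s)\,\lambda(ds)<\infty$. Further, in that case the characteristic function of $\int_S f\,d\Lambda$ can be written, for $\theta\in\mathbb{R}$, as $$\mathbb{E}\Big[e^{i\theta\int_S f d\Lambda}\Big]=\exp\Big(i\theta a_f-\tfrac12\theta^2\sigma_f^2+\int_{\mathbb{R}}\big(e^{i\theta x}-1-i\theta\tau(x)\big)F_f(dx)\Big),$$ where $a_f=\int_S U(f(s),s)\lambda(ds)$, $\sigma_f^2=\int_S|f(s)|^2\sigma^2(s)\lambda(ds)$, and $F_f$ is the unique quasi-Lévy measure determined by the difference of the Lévy measures $\tilde F_f^{+}$ and $\tilde F_f^{-}$ (i.e. $F_f(B)=\tilde F_f^+(B)-\tilde F_f^-(B)$ for every Borel $B$ with $0\notin\overline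 B$), where for $B\in\mathcal{B}(\mathbb{R})$ $$\tilde F_f^{\pm}(B)=\tilde F^{\pm}\big(\{(s,x)\in S\times\mathbb{R}: f(s)x\in B\setminus\{0\}\}\big).$$
   Context: $\mathcal{B}_0(\mathbb{R})$ is the class of Borel sets $B\subset\mathbb{R}$ with $0\notin\overline B$. $\tau(x)=x$ if $|x|\le1$, $\tau(x)=x/|x|$ if $|x|>1$. A quasi-Lévy type measure is a function $\nu:\mathcal{B}_0(\mathbb{R})\to\mathbb{R}$ whose restriction to $\mathcal{B}_r(\mathbb{R})=\{B\text{ Borel}: B\cap(-r,r)=\emptyset\}$ is a finite signed measure for each $r>0$ and with $\int_{\mathbb{R}}(1\wedge x^2)|\nu|(dx)<\infty$; here $\nu^+,\nu^-,|\nu|$ are the unique measures on $\mathcal{B}(\mathbb{R})$ with no mass at $0$ which coincide on each $\mathcal{B}_r(\mathbb{R})$ with the positive part, negative part and total variation of the restriction. For $g$ $|\nu|$-integrable, $\int g\,d\nu:=\int g\,d\nu^+-\int g\,d\nu^-$. A distribution on $\mathbb{R}$ is quasi-infinitely divisible (QID) with characteristic triplet $(\gamma,a,\nu)$ if its characteristic function is $\exp(i\theta\gamma-\frac{\theta^2}{2}a+\int(e^{i\theta x}-1-i\theta\tau(x))\nu(dx))$ with $\gamma,a\in\mathbb{R}$ and $\nu$ a quasi-Lévy type measure; then $\nu$ is called a quasi-Lévy measure. It is ID when $\nu$ is a Lévy measure. $S$ is a non-empty set and $\mathcal{S}$ a $\delta$-ring of subsets of $S$ containing an increasing sequence $S_1\subset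 S_2\subset\dots$ with $\bigcup_nS_n=S$. An independently scattered random measure is a real process $\{\Lambda(A):A\in\mathcal{S}\}$ such that for disjoint $A_n\in\mathcal{S}$ the $\Lambda(A_n)$ are independent and, if $\bigcup_nA_n\in\mathcal{S}$, $\Lambda(\bigcup_nA_n)=\sum_n\Lambda(A_n)$ a.s. It is a QID (ID) random measure if each $\Lambda(A)$ is QID (ID). Setting. $\nu_0:\mathcal{S}\to\mathbb{R}$ is a signed measure, $\nu_1:\mathcal{S}\to[0,\infty)$ a measure; for every $A\in\mathcal{S}$, $G_A$ and $M_A$ are Lévy measures on $\mathbb{R}$, and for every $B\in\mathcal{B}_0(\mathbb{R})$, $A\mapsto G_A(B)$ and $A\mapsto M_A(B)$ are finite measures on $\mathcal{S}$. $F_A$ is the quasi-Lévy type measure $F_A(B)=G_A(B)-M_A(B)$, $B\in\mathcal{B}_0(\mathbb{R})$, and $(\nu_0(A),\nu_1(A),F_A)$ is assumed to be the characteristic triplet of a QID random variable for every $A\in\mathcal{S}$. $\Lambda$ is the (unique in finite-dimensional distributions) QID random measure such that $\Lambda(A)$ has triplet $(\nu_0(A),\nu_1(A),F_A)$ for all $A\in\mathcal{S}$. Control measure: $\lambda(A)=|\nu_0|(A)+\nu_1(A)+\int(1\wedge x^2)G_A(dx)+\int(1\wedge x^2)M_A(dx)$ for $A\in\mathcal{S}$, extended to a $\sigma$-finite measure on $\sigma(\mathcal{S})$. $a=d\nu_0/d\lambda$, $\sigma^2=d\nu_1/d\lambda$. There are $\rho_G,\rho_M:S\times\mathcal{B}(\mathbb{R})\to[0,\infty]$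 with $\rho_G(s,\cdot),\rho_M(s,\cdot)$ Lévy measures for every $s$, measurable in $s$, and $G_A(B)=\int_A\rho_G(s,B)\lambda(ds)$, $M_A(B)=\int_A\rho_M(s,B)\lambda(ds)$ for $A\in\mathcal{S}$, $B\in\mathcal{B}(\mathbb{R})$. $\rho(s,\cdot)$ is the quasi-Lévy type measure $\rho(s,B)=\rho_G(s,B)-\rho_M(s,B)$, $B\in\mathcal{B}_0(\mathbb{R})$, with positive part $\rho^+(s,\cdot)$, negative part $\rho^-(s,\cdot)$ and total variation $|\rho|(s,\cdot)$. $\tilde F^{\pm}(C)=\int_S\int_{\mathbb{R}}\mathbf{1}_C(s,x)\rho^{\pm}(s,dx)\lambda(ds)$ for $C\in\sigma(\mathcal{S})\otimes\mathcal{B}(\mathbb{R})$. Integral: for a simple function $f=\sum_{j=1}^nx_j\mathbf{1}_{A_j}$ with disjoint $A_j\in\mathcal{S}$ and $A\in\sigma(\mathcal{S})$, $\int_Af\,d\Lambda=\sum_jx_j\Lambda(A\cap A_j)$. A $\sigma(\mathcal{S})$-measurable $f$ is $\Lambda$-integrable if there are simple $f_n\to f$ $\lambda$-a.e. such that for every $A\in\sigma(\mathcal{S})$ the sequence $\int_Af_n\,d\Lambda$ converges in probability; $\int_Af\,d\Lambda$ is the limit in probability (it does not depend on the sequence). *)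

theory Defs
  imports "HOL-Probability.Probability"
begin

section \<open>Signed measures and their variations\<close>

text \<open>
  A real-valued, countably additive function on a family of sets (a \<open>\<sigma>\<close>-algebra or a
  \<open>\<delta>\<close>-ring).  Values outside the family are irrelevant.
\<close>

definition signed_measure_on :: "'a set set \<Rightarrow> ('a set \<Rightarrow> real) \<Rightarrow> bool" where
  "signed_measure_on \<F> m \<longleftrightarrow> m {} = 0 \<and>
     (\<forall>A :: nat \<Rightarrow> 'a set. range A \<subseteq> \<F> \<longrightarrow> disjoint_family A \<longrightarrow> (\<Union>n. A n) \<in> \<F> \<longrightarrow>
        (\<lambda>n. m (A n)) sums m (\<Union>n. A n))"

text \<open>
  For a signed measure \<open>m\<close> the Jordan decomposition is given by
  \<open>m\<^sup>+ A = sup {m B | B \<subseteq> A}\<close>, \<open>m\<^sup>- = (- m)\<^sup>+\<close> and \<open>\<bar>m\<bar> = m\<^sup>+ + m\<^sup>-\<close>; since \<open>m {} = 0\<close>, the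
  truncation of negative values by \<open>ennreal\<close> does not affect the supremum.
\<close>

definition pos_variation :: "'a set set \<Rightarrow> ('a set \<Rightarrow> real) \<Rightarrow> 'a set \<Rightarrow> ennreal" where
  "pos_variation \<F> m A = (SUP B\<in>{B \<in> \<F>. B \<subseteq> A}. ennreal (m B))"

definition neg_variation :: "'a set set \<Rightarrow> ('a set \<Rightarrow> real) \<Rightarrow> 'a set \<Rightarrow> ennreal" where
  "neg_variation \<F> m A = pos_variation \<F> (\<lambda>B. - m B) A"

definition total_variation :: "'a set set \<Rightarrow> ('a set \<Rightarrow> real) \<Rightarrow> 'a set \<Rightarrow> ennreal" where
  "total_variation \<F> m A = pos_variation \<F> m A + neg_variation \<F> m A"


section \<open>Levy measures and quasi-Levy type measures\<close>

definition trunc :: "real \<Rightarrow> real" where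
  "trunc x = (if \<bar>x\<bar> \<le> 1 then x else x / \<bar>x\<bar>)"

definition borel_off_zero :: "real set set" where
  "borel_off_zero = {B \<in> sets borel. 0 \<notin> closure B}"

definition borel_off :: "real \<Rightarrow> real set set" where
  "borel_off r = {B \<in> sets borel. B \<inter> {-r<..<r} = {}}"

definition levy_measure :: "real measure \<Rightarrow> bool" where
  "levy_measure \<nu> \<longleftrightarrow> sets \<nu> = sets borel \<and> emeasure \<nu> {0} = 0 \<and>
     (\<integral>\<^sup>+x. ennreal (min 1 (x\<^sup>2)) \<partial>\<nu>) < \<infinity>"

text \<open>
  The unique measure on the Borel sets without mass at \<open>0\<close> that coincides on each
  \<open>borel_off r\<close> with \<open>v (borel_off r)\<close>, where \<open>v\<close> assigns to a \<open>\<sigma>\<close>-algebra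
  one of the variations of the restriction to it.
\<close>

definition glue_off_zero :: "(real set set \<Rightarrow> real set \<Rightarrow> ennreal) \<Rightarrow> real measure" where
  "glue_off_zero v = (THE \<mu>. sets \<mu> = sets borel \<and> emeasure \<mu> {0} = 0 \<and>
     (\<forall>r>0. \<forall>B\<in>borel_off r. emeasure \<mu> B = v (borel_off r) B))"

definition ql_pos :: "(real set \<Rightarrow> real) \<Rightarrow> real measure" where
  "ql_pos \<nu> = glue_off_zero (\<lambda>\<F>. pos_variation \<F> \<nu>)"

definition ql_neg :: "(real set \<Rightarrow> real) \<Rightarrow> real measure" where
  "ql_neg \<nu> = glue_off_zero (\<lambda>\<F>. neg_variation \<F> \<nu>)"

definition ql_abs :: "(real set \<Rightarrow> real) \<Rightarrow> real measure" where
  "ql_abs \<nu> = glue_off_zero (\<lambda>\<F>. total_variation \<F> \<nu>)"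

text \<open>A set function on \<open>borel_off_zero\<close> is a total function whose other values are irrelevant.\<close>

definition quasi_levy_type :: "(real set \<Rightarrow> real) \<Rightarrow> bool" where
  "quasi_levy_type \<nu> \<longleftrightarrow> (\<forall>r>0. signed_measure_on (borel_off r) \<nu>) \<and>
     (\<integral>\<^sup>+x. ennreal (min 1 (x\<^sup>2)) \<partial>ql_abs \<nu>) < \<infinity>"

definition ql_integral ::
    "(real set \<Rightarrow> real) \<Rightarrow> (real \<Rightarrow> 'b::{banach, second_countable_topology}) \<Rightarrow> 'b" where
  "ql_integral \<nu> g = (\<integral>x. g x \<partial>ql_pos \<nu>) - (\<integral>x. g x \<partial>ql_neg \<nu>)"

definition levy_diff :: "real measure \<Rightarrow> real measure \<Rightarrow> real set \<Rightarrow> real" where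
  "levy_diff G M = (\<lambda>B\<in>borel_off_zero. measure G B - measure M B)"


section \<open>Quasi-infinitely divisible distributions\<close>

definition qid_triplet :: "real measure \<Rightarrow> real \<Rightarrow> real \<Rightarrow> (real set \<Rightarrow> real) \<Rightarrow> bool" where
  "qid_triplet \<mu> \<gamma> a \<nu> \<longleftrightarrow> real_distribution \<mu> \<and> quasi_levy_type \<nu> \<and>
     (\<forall>\<theta>. char \<mu> \<theta> = exp (\<i> * of_real (\<theta> * \<gamma>) - of_real (\<theta>\<^sup>2 / 2 * a)
        + ql_integral \<nu> (\<lambda>x. iexp (\<theta> * x) - 1 - \<i> * of_real (\<theta> * trunc x))))"

definition quasi_levy_measure :: "(real set \<Rightarrow> real) \<Rightarrow> bool" where
  "quasi_levy_measure \<nu> \<longleftrightarrow> (\<exists>\<mu> \<gamma> a. qid_triplet \<mu> \<gamma> a \<nu>)"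


section \<open>QID random measures\<close>

locale delta_ring = ring_of_sets +
  assumes countable_INT_closed: "\<And>A :: nat \<Rightarrow> 'a set. range A \<subseteq> M \<Longrightarrow> (\<Inter>n. A n) \<in> M"

locale exhausted_delta_ring = delta_ring S \<S> for S :: "'s set" and \<S> +
  assumes nonempty: "S \<noteq> {}"
    and exhausting: "\<exists>E :: nat \<Rightarrow> 's set. range E \<subseteq> \<S> \<and> incseq E \<and> (\<Union>n. E n) = S"

locale indep_scattered_random_measure =
  prob_space P + exhausted_delta_ring S \<S>
  for P :: "'w measure" and S :: "'s set" and \<S> +
  fixes \<Lambda> :: "'s set \<Rightarrow> 'w \<Rightarrow> real"
  assumes rv: "\<And>A. A \<in> \<S> \<Longrightarrow> random_variable borel (\<Lambda> A)"
    and independent: "\<And>A :: nat \<Rightarrow> 's set. range A \<subseteq> \<S> \<Longrightarrow> disjoint_family A \<Longrightarrow>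
      indep_vars (\<lambda>_. borel) (\<lambda>n. \<Lambda> (A n)) UNIV"
    and additive: "\<And>A :: nat \<Rightarrow> 's set. range A \<subseteq> \<S> \<Longrightarrow> disjoint_family A \<Longrightarrow> (\<Union>n. A n) \<in> \<S> \<Longrightarrow>
      AE \<omega> in P. (\<lambda>n. \<Lambda> (A n) \<omega>) sums \<Lambda> (\<Union>n. A n) \<omega>"

locale qid_random_measure = indep_scattered_random_measure P S \<S> \<Lambda>
  for P :: "'w measure" and S :: "'s set" and \<S> and \<Lambda> +
  fixes \<nu>0 \<nu>1 :: "'s set \<Rightarrow> real" and G M :: "'s set \<Rightarrow> real measure"
  assumes \<nu>0: "signed_measure_on \<S> \<nu>0"
    and \<nu>1: "signed_measure_on \<S> \<nu>1" "\<And>A. A \<in> \<S> \<Longrightarrow> 0 \<le> \<nu>1 A"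
    and levy_G: "\<And>A. A \<in> \<S> \<Longrightarrow> levy_measure (G A)"
    and levy_M: "\<And>A. A \<in> \<S> \<Longrightarrow> levy_measure (M A)"
    and measure_G: "\<And>B. B \<in> borel_off_zero \<Longrightarrow> signed_measure_on \<S> (\<lambda>A. measure (G A) B)"
    and measure_M: "\<And>B. B \<in> borel_off_zero \<Longrightarrow> signed_measure_on \<S> (\<lambda>A. measure (M A) B)"
    and triplet: "\<And>A. A \<in> \<S> \<Longrightarrow> qid_triplet (distr P borel (\<Lambda> A)) (\<nu>0 A) (\<nu>1 A) (levy_diff (G A) (M A))"

text \<open>
  The library's \<open>RN_deriv\<close> is for measures; \<open>m\<close> may be signed here and is defined on \<open>\<S>\<close> only.
\<close>

definition density_on :: "'s measure \<Rightarrow> 's set set \<Rightarrow> ('s set \<Rightarrow> real) \<Rightarrow> ('s \<Rightarrow> real) \<Rightarrow> bool" where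
  "density_on L \<S> m g \<longleftrightarrow> g \<in> borel_measurable L \<and>
     (\<forall>A\<in>\<S>. set_integrable L A g \<and> m A = (LINT s:A|L. g s))"

definition levy_kernel_on ::
    "'s measure \<Rightarrow> 's set set \<Rightarrow> ('s set \<Rightarrow> real measure) \<Rightarrow> ('s \<Rightarrow> real measure) \<Rightarrow> bool" where
  "levy_kernel_on L \<S> G \<kappa> \<longleftrightarrow> (\<forall>s\<in>space L. levy_measure (\<kappa> s)) \<and>
     (\<forall>B\<in>sets borel. (\<lambda>s. emeasure (\<kappa> s) B) \<in> borel_measurable L) \<and>
     (\<forall>A\<in>\<S>. \<forall>B\<in>sets borel. emeasure (G A) B = (\<integral>\<^sup>+s\<in>A. emeasure (\<kappa> s) B \<partial>L))"

text \<open>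
  The control measure \<open>L\<close> with the densities \<open>a\<close>, \<open>\<sigma>2\<close> (the latter standing for \<open>\<sigma>\<^sup>2\<close>) and
  the kernels \<open>\<rho>G\<close>, \<open>\<rho>M\<close>.
\<close>

locale controlled_qid_random_measure = qid_random_measure P S \<S> \<Lambda> \<nu>0 \<nu>1 G M
  for P :: "'w measure" and S :: "'s set" and \<S> and \<Lambda> and \<nu>0 \<nu>1 and G M +
  fixes L :: "'s measure" and a \<sigma>2 :: "'s \<Rightarrow> real" and \<rho>G \<rho>M :: "'s \<Rightarrow> real measure"
  assumes sets_L: "sets L = sets (sigma S \<S>)"
    and sigma_finite_L: "sigma_finite_measure L"
    and emeasure_L: "\<And>A. A \<in> \<S> \<Longrightarrow> emeasure L A =
      total_variation \<S> \<nu>0 A + ennreal (\<nu>1 A)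
      + (\<integral>\<^sup>+x. ennreal (min 1 (x\<^sup>2)) \<partial>G A) + (\<integral>\<^sup>+x. ennreal (min 1 (x\<^sup>2)) \<partial>M A)"
    and density_a: "density_on L \<S> \<nu>0 a"
    and density_\<sigma>2: "density_on L \<S> \<nu>1 \<sigma>2"
    and kernel_\<rho>G: "levy_kernel_on L \<S> G \<rho>G"
    and kernel_\<rho>M: "levy_kernel_on L \<S> M \<rho>M"


section \<open>The stochastic integral\<close>

text \<open>
  A simple function is given by a representation: a list of pairs \<open>(x, B)\<close> with pairwise
  disjoint \<open>B \<in> \<S>\<close>.
\<close>

definition simple_rep :: "'s set set \<Rightarrow> (real \<times> 's set) list \<Rightarrow> bool" where
  "simple_rep \<S> h \<longleftrightarrow> (\<forall>(x, B)\<in>set h. B \<in> \<S>) \<and> sorted_wrt (\<lambda>(x, B) (y, C). B \<inter> C = {}) h"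

definition simple_fun :: "(real \<times> 's set) list \<Rightarrow> 's \<Rightarrow> real" where
  "simple_fun h s = (\<Sum>(x, B)\<leftarrow>h. x * indicator B s)"

definition simple_integral ::
    "('s set \<Rightarrow> 'w \<Rightarrow> real) \<Rightarrow> 's set \<Rightarrow> (real \<times> 's set) list \<Rightarrow> 'w \<Rightarrow> real" where
  "simple_integral \<Lambda> A h \<omega> = (\<Sum>(x, B)\<leftarrow>h. x * \<Lambda> (A \<inter> B) \<omega>)"

definition tendsto_in_prob :: "'w measure \<Rightarrow> (nat \<Rightarrow> 'w \<Rightarrow> real) \<Rightarrow> ('w \<Rightarrow> real) \<Rightarrow> bool" where
  "tendsto_in_prob P X Y \<longleftrightarrow> Y \<in> borel_measurable P \<and>
     (\<forall>\<epsilon>>0. (\<lambda>n. measure P {\<omega> \<in> space P. \<epsilon> < \<bar>X n \<omega> - Y \<omega>\<bar>}) \<longlonglongrightarrow> 0)"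

definition integral_approximation ::
    "'w measure \<Rightarrow> 's set set \<Rightarrow> ('s set \<Rightarrow> 'w \<Rightarrow> real) \<Rightarrow> 's measure \<Rightarrow>
     (nat \<Rightarrow> (real \<times> 's set) list) \<Rightarrow> ('s \<Rightarrow> real) \<Rightarrow> bool" where
  "integral_approximation P \<S> \<Lambda> L h f \<longleftrightarrow> (\<forall>n. simple_rep \<S> (h n)) \<and>
     (AE s in L. (\<lambda>n. simple_fun (h n) s) \<longlonglongrightarrow> f s) \<and>
     (\<forall>A\<in>sets L. \<exists>Y. tendsto_in_prob P (\<lambda>n. simple_integral \<Lambda> A (h n)) Y)"

definition rm_integrable ::
    "'w measure \<Rightarrow> 's set set \<Rightarrow> ('s set \<Rightarrow> 'w \<Rightarrow> real) \<Rightarrow> 's measure \<Rightarrow> ('s \<Rightarrow> real) \<Rightarrow> bool" where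
  "rm_integrable P \<S> \<Lambda> L f \<longleftrightarrow> f \<in> borel_measurable L \<and> (\<exists>h. integral_approximation P \<S> \<Lambda> L h f)"

text \<open>
  \<open>Y\<close> is a version of the integral of \<open>f\<close> over \<open>A\<close>.  The integral is a limit in probability,
  hence an almost sure equivalence class; it is therefore a relation and not a function.
\<close>

definition has_rm_integral ::
    "'w measure \<Rightarrow> 's set set \<Rightarrow> ('s set \<Rightarrow> 'w \<Rightarrow> real) \<Rightarrow> 's measure \<Rightarrow>
     ('s \<Rightarrow> real) \<Rightarrow> 's set \<Rightarrow> ('w \<Rightarrow> real) \<Rightarrow> bool" where
  "has_rm_integral P \<S> \<Lambda> L f A Y \<longleftrightarrow> f \<in> borel_measurable L \<and> A \<in> sets L \<and>
     (\<exists>h. integral_approximation P \<S> \<Lambda> L h f \<and>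
          tendsto_in_prob P (\<lambda>n. simple_integral \<Lambda> A (h n)) Y)"


section \<open>Integrability functionals and image measures\<close>

definition U_fun :: "('s \<Rightarrow> real) \<Rightarrow> ('s \<Rightarrow> real set \<Rightarrow> real) \<Rightarrow> real \<Rightarrow> 's \<Rightarrow> real" where
  "U_fun a \<rho> u s = u * a s + ql_integral (\<rho> s) (\<lambda>x. trunc (x * u) - u * trunc x)"

definition V0_fun :: "('s \<Rightarrow> real set \<Rightarrow> real) \<Rightarrow> real \<Rightarrow> 's \<Rightarrow> ennreal" where
  "V0_fun \<rho> u s = (\<integral>\<^sup>+x. ennreal (min 1 (\<bar>x * u\<bar>\<^sup>2)) \<partial>ql_abs (\<rho> s))"

definition kernel_measure :: "'s measure \<Rightarrow> ('s \<Rightarrow> real measure) \<Rightarrow> ('s \<times> real) set \<Rightarrow> ennreal" where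
  "kernel_measure L \<kappa> C = (\<integral>\<^sup>+s. (\<integral>\<^sup>+x. indicator C (s, x) \<partial>\<kappa> s) \<partial>L)"

definition image_set_fun ::
    "'s measure \<Rightarrow> ('s \<Rightarrow> real measure) \<Rightarrow> ('s \<Rightarrow> real) \<Rightarrow> real set \<Rightarrow> ennreal" where
  "image_set_fun L \<kappa> f B = kernel_measure L \<kappa> {(s, x). s \<in> space L \<and> f s * x \<in> B - {0}}"

text \<open>
  \<open>measure_of\<close> yields the zero measure if its argument is not countably additive; that
  \<open>image_levy\<close> has the values \<open>image_set_fun\<close> is therefore something to be proved.
\<close>

definition image_levy :: "'s measure \<Rightarrow> ('s \<Rightarrow> real measure) \<Rightarrow> ('s \<Rightarrow> real) \<Rightarrow> real measure" where
  "image_levy L \<kappa> f = measure_of UNIV (sets borel) (image_set_fun L \<kappa> f)"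

end

theory Submission
  imports Defs
begin

text \<open>
  The cumulant of the random measure is a density.  If \<open>K(u, s)\<close> is the exponent of the triplet
  \<open>(a(s), \<sigma>\<^sup>2(s), \<rho>(s, \<cdot>))\<close> at \<open>u\<close>, then \<open>E exp(i u \<Lambda>(A)) = exp \<integral>\<^sub>A K(u, s) \<lambda>(ds)\<close>, and independence turns
  this into \<open>exp \<integral>\<^sub>A K(\<theta> h(s), s) \<lambda>(ds)\<close> for the integral over \<open>A\<close> of a simple function \<open>h\<close>.  The whole
  theorem is a passage to the limit in this formula.

  The limit rests on one estimate (\<open>norm_cumulant_mult_le\<close>): up to a constant that depends only on
  \<open>C\<close>, \<open>\<bar>K(c u, s)\<bar>\<close> for \<open>\<bar>c\<bar> \<le> C\<close> is bounded by
  \<open>\<bar>U(u, s)\<bar> + u\<^sup>2 \<sigma>\<^sup>2(s) + V\<^sub>0(u, s)\<close>.  By (i)--(iii) this majorant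
  is integrable for \<open>u = f(s)\<close>.  Take simple \<open>f\<^sub>n \<rightarrow> f\<close> with \<open>\<bar>f\<^sub>n\<bar> \<le> 2 \<bar>f\<bar>\<close>.  Then
  \<open>\<integral>\<^sub>A K(\<theta> (f\<^sub>n - f\<^sub>m)) d\<lambda> \<rightarrow> 0\<close> by dominated convergence, so the characteristic functions of
  \<open>\<integral>\<^sub>A (f\<^sub>n - f\<^sub>m) d\<Lambda>\<close> tend to \<open>1\<close>; these integrals are therefore Cauchy in probability, and \<open>f\<close> is integrable.

  The characteristic function of the integral has to be found for every approximating sequence
  \<open>h\<^sub>n\<close>, and an arbitrary one is not dominated.  What is known is that \<open>exp \<integral>\<^sub>A K(\<theta> h\<^sub>n) d\<lambda>\<close>
  converges for every \<open>A\<close>.  A gliding hump argument (\<open>exp_integral_gliding_hump\<close>), in the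
  spirit of the Vitali--Hahn--Saks theorem, shows that this already forces the limit for \<open>A = S\<close> to be
  \<open>exp \<integral> K(\<theta> f) d\<lambda>\<close>.  A decomposition of \<open>K(\<theta> f(s), s)\<close> and Fubini for the images of \<open>\<rho>\<^sup>+, \<rho>\<^sup>-\<close>
  (\<open>image_levy_mixture\<close>) bring this into the stated form.

  The signed setting enters in two places.  The Jordan decomposition of a difference \<open>G - M\<close> of Levy
  measures is computed from densities with respect to one finite measure (\<open>ql_variations_density\<close>); this
  gives \<open>\<integral> h d\<nu> = \<integral> h dG - \<integral> h dM\<close> for all \<open>h\<close> with \<open>\<bar>h(x)\<bar> \<le> C min(1, x\<^sup>2)\<close>.  And \<open>s \<longmapsto> \<rho>\<^sup>+(s, B)\<close> is measurable because the
  supremum that defines it can be taken over a countable family of sets (\<open>levy_kernel_ql_pos\<close>).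
\<close>

section \<open>Truncation and the compensated exponential\<close>

abbreviation wt :: "real \<Rightarrow> real" where "wt x \<equiv> min 1 (x\<^sup>2)"

lemma wt_scale: "wt (c * x) \<le> (1 + c\<^sup>2) * wt x"
proof (cases "x\<^sup>2 \<le> 1")
  case True
  then have "wt x = x\<^sup>2" by simp
  moreover have "wt (c * x) \<le> c\<^sup>2 * x\<^sup>2" by (simp add: power_mult_distrib)
  ultimately show ?thesis by (simp add: algebra_simps add_increasing)
next
  case False
  then have "wt x = 1" by simp
  moreover have "wt (c * x) \<le> 1" "1 \<le> 1 + c\<^sup>2" by simp_all
  ultimately show ?thesis by (metis mult.right_neutral order_trans)
qed

lemma abs_trunc_le_1: "\<bar>trunc x\<bar> \<le> 1"
  by (auto simp: trunc_def)

lemma trunc_measurable [measurable]: "trunc \<in> borel_measurable borel"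
  unfolding trunc_def[abs_def] by measurable

definition trunc_bound :: "real \<Rightarrow> real" where
  "trunc_bound c = (1 + \<bar>c\<bar>) * (1 + c\<^sup>2)"

text \<open>
  Truncation commutes with a factor \<open>c\<close> as long as both \<open>y\<close> and \<open>c y\<close> lie in \<open>[-1, 1]\<close>.  The
  commutator thus lives where \<open>y\<close> is bounded away from \<open>0\<close>, and there \<open>min 1 (y\<^sup>2)\<close> is at least \<open>1 / (1 + c\<^sup>2)\<close>.
\<close>

lemma trunc_scale_bound: "\<bar>trunc (c * y) - c * trunc y\<bar> \<le> trunc_bound c * wt y"
proof (cases "\<bar>y\<bar> \<le> 1 \<and> \<bar>c * y\<bar> \<le> 1")
  case True
  then have "trunc (c * y) - c * trunc y = 0" by (simp add: trunc_def)
  then show ?thesis by (simp add: trunc_bound_def)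
next
  case False
  have "1 \<le> (1 + c\<^sup>2) * wt y"
  proof (cases "\<bar>y\<bar> \<le> 1")
    case True
    with False have "1 < \<bar>c * y\<bar>" by simp
    then have "1 < (c * y)\<^sup>2" using abs_square_le_1[of "c * y"] by linarith
    with True have "wt y = y\<^sup>2" by (simp add: abs_square_le_1)
    then show ?thesis using \<open>1 < (c * y)\<^sup>2\<close>
      by (simp add: algebra_simps power_mult_distrib add_increasing)
  next
    case False
    then have "wt y = 1" using abs_square_le_1[of y] by (simp add: min_def)
    then show ?thesis by simp
  qed
  moreover have "\<bar>trunc (c * y) - c * trunc y\<bar> \<le> 1 + \<bar>c\<bar>"
  proof -
    have "\<bar>c * trunc y\<bar> \<le> \<bar>c\<bar>"
      using mult_left_mono[OF abs_trunc_le_1[of y], of "\<bar>c\<bar>"] by (simp add: abs_mult)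
    then show ?thesis using abs_trunc_le_1[of "c * y"] by linarith
  qed
  moreover have "(1 + \<bar>c\<bar>) * 1 \<le> (1 + \<bar>c\<bar>) * ((1 + c\<^sup>2) * wt y)"
    using calculation(1) by (intro mult_left_mono) auto
  ultimately show ?thesis by (simp add: trunc_bound_def algebra_simps)
qed

lemma norm_compensated_exp_le: "cmod (iexp y - 1 - \<i> * of_real (trunc y)) \<le> 3 * wt y"
proof (cases "\<bar>y\<bar> \<le> 1")
  case True
  then have "wt y = y\<^sup>2" by (simp add: abs_square_le_1)
  moreover have "cmod (iexp y - 1 - \<i> * of_real y) \<le> y\<^sup>2 / 2"
    using iexp_approx1[of y 1] by (simp add: power2_eq_square diff_diff_eq)
  moreover have "y\<^sup>2 / 2 \<le> 3 * y\<^sup>2" using zero_le_power2[of y] by linarith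
  ultimately show ?thesis using True by (simp only: trunc_def if_True)
next
  case False
  then have "wt y = 1" using abs_square_le_1[of y] by (simp add: min_def)
  moreover have "cmod (iexp y - 1 - \<i> * of_real (trunc y)) \<le> cmod (iexp y) + cmod 1 + cmod (\<i> * of_real (trunc y))"
    by (metis (no_types, lifting) add_right_mono norm_triangle_ineq4 order_trans)
  moreover have "cmod (\<i> * of_real (trunc y)) \<le> 1" using abs_trunc_le_1[of y] by (simp add: norm_mult)
  ultimately show ?thesis by simp
qed

section \<open>Pairs of Levy measures as densities\<close>

lemma sum_of_measures:
  assumes [simp]: "sets N = sets M"
  obtains T where "sets T = sets M"
    "\<And>B. B \<in> sets M \<Longrightarrow> emeasure T B = emeasure M B + emeasure N B"
proof -
  define T where "T = measure_of (space M) (sets M) (\<lambda>B. emeasure M B + emeasure N B)"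
  have "sets T = sets M" unfolding T_def by simp
  moreover have "emeasure T B = emeasure M B + emeasure N B" if "B \<in> sets M" for B
    unfolding T_def
  proof (rule emeasure_measure_of_sigma)
    show "positive (sets M) (\<lambda>B. emeasure M B + emeasure N B)" by (simp add: positive_def)
    show "countably_additive (sets M) (\<lambda>B. emeasure M B + emeasure N B)"
    proof (rule countably_additiveI)
      fix A :: "nat \<Rightarrow> _" assume A: "range A \<subseteq> sets M" "disjoint_family A"
      have "(\<Sum>i. emeasure M (A i) + emeasure N (A i)) = (\<Sum>i. emeasure M (A i)) + (\<Sum>i. emeasure N (A i))"
        by (intro suminf_add[symmetric]) auto
      also have "\<dots> = emeasure M (\<Union> (range A)) + emeasure N (\<Union> (range A))"
        using A by (simp add: suminf_emeasure)
      finally show "(\<Sum>i. emeasure M (A i) + emeasure N (A i)) = emeasure M (\<Union> (range A)) + emeasure N (\<Union> (range A))" .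
    qed
  qed (use that sets.sigma_algebra_axioms in auto)
  ultimately show ?thesis by (rule that)
qed

lemma levy_measure_sets: "levy_measure G \<Longrightarrow> sets G = sets borel"
  by (simp add: levy_measure_def)

lemma levy_weight_finite:
  assumes "levy_measure G"
  shows "finite_measure (density G (\<lambda>x. ennreal (wt x)))"
proof
  have [measurable_cong]: "sets G = sets borel" using assms by (rule levy_measure_sets)
  have "emeasure (density G (\<lambda>x. ennreal (wt x))) (space G) = (\<integral>\<^sup>+x. ennreal (wt x) \<partial>G)"
    by (subst emeasure_density) (auto intro!: nn_integral_cong)
  then show "emeasure (density G (\<lambda>x. ennreal (wt x))) (space (density G (\<lambda>x. ennreal (wt x)))) \<noteq> \<infinity>"
    using assms by (auto simp: levy_measure_def)
qed

lemma levy_AE_nonzero: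
  assumes "levy_measure G" shows "AE x in G. x \<noteq> 0"
proof (rule AE_I)
  show "{x \<in> space G. \<not> x \<noteq> 0} \<subseteq> {0}" by auto
  show "emeasure G {0} = 0" "{0} \<in> sets G" using assms by (auto simp: levy_measure_def)
qed

lemma levy_density_weight_inverse:
  assumes "levy_measure G"
  shows "density (density G (\<lambda>x. ennreal (wt x))) (\<lambda>x. ennreal (1 / wt x)) = G"
proof -
  have [measurable_cong]: "sets G = sets borel" using assms by (rule levy_measure_sets)
  have "density (density G (\<lambda>x. ennreal (wt x))) (\<lambda>x. ennreal (1 / wt x))
      = density G (\<lambda>x. ennreal (wt x) * ennreal (1 / wt x))"
    by (rule density_density_eq) measurable
  also have "\<dots> = density G (\<lambda>x. 1)"
  proof (rule density_cong)
    show "AE x in G. ennreal (wt x) * ennreal (1 / wt x) = 1"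
      using levy_AE_nonzero[OF assms]
      by eventually_elim (simp add: ennreal_mult[symmetric] min_def)
  qed measurable
  also have "\<dots> = G" by (simp add: density_1)
  finally show ?thesis .
qed

abbreviation rdensity :: "'a measure \<Rightarrow> ('a \<Rightarrow> real) \<Rightarrow> 'a measure" where
  "rdensity T u \<equiv> density T (\<lambda>x. ennreal (u x))"

lemma finite_measure_density_real:
  fixes T :: "'a measure"
  assumes T: "finite_measure T" and ac: "absolutely_continuous T N" "sets N = sets T" and N: "finite_measure N"
  obtains D :: "'a \<Rightarrow> real" where "D \<in> borel_measurable T" "\<And>x. 0 \<le> D x" "N = rdensity T D"
proof -
  interpret finite_measure T by fact
  obtain D where D: "D \<in> borel_measurable T" "AE x in T. RN_deriv T N x = ennreal (D x)" "\<And>x. 0 \<le> D x"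
    using real_RN_deriv[OF N ac] by metis
  have "N = density T (RN_deriv T N)" using ac by (simp add: density_RN_deriv)
  also have "\<dots> = rdensity T D" by (rule density_cong) (use D in auto)
  finally show ?thesis using that D by blast
qed

definition density_pair ::
    "real measure \<Rightarrow> (real \<Rightarrow> real) \<Rightarrow> (real \<Rightarrow> real) \<Rightarrow> real measure \<Rightarrow> real measure \<Rightarrow> bool" where
  "density_pair T g m G M \<longleftrightarrow> finite_measure T \<and> sets T = sets borel \<and>
     g \<in> borel_measurable borel \<and> m \<in> borel_measurable borel \<and> (\<forall>x. 0 \<le> g x) \<and> (\<forall>x. 0 \<le> m x) \<and>
     G = rdensity T g \<and> M = rdensity T m"

lemma density_pairD:
  assumes "density_pair T g m G M"
  shows "finite_measure T" "sets T = sets borel" "g \<in> borel_measurable borel" "m \<in> borel_measurable borel"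
    "\<And>x. 0 \<le> g x" "\<And>x. 0 \<le> m x" "G = rdensity T g" "M = rdensity T m"
  using assms by (auto simp: density_pair_def)

text \<open>
  Weighted by \<open>min 1 (x\<^sup>2)\<close>, both measures become finite; the sum of the weighted measures dominates
  each of them, and as there is no mass at \<open>0\<close> the weight can be divided out of the Radon--Nikodym
  densities again.  Real-valued densities make the Jordan decomposition of \<open>G - M\<close> explicit.
\<close>

lemma levy_pair_densities:
  assumes G: "levy_measure G" and M: "levy_measure M"
  shows "\<exists>T g m. density_pair T g m G M"
proof -
  define G' where "G' = density G (\<lambda>x. ennreal (wt x))"
  define M' where "M' = density M (\<lambda>x. ennreal (wt x))"
  have fin: "finite_measure G'" "finite_measure M'"
    using levy_weight_finite assms by (auto simp: G'_def M'_def)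
  have sets: "sets G' = sets borel" "sets M' = sets borel"
    using assms by (auto simp: G'_def M'_def levy_measure_sets)
  obtain T where T: "sets T = sets borel"
    "\<And>B. B \<in> sets borel \<Longrightarrow> emeasure T B = emeasure G' B + emeasure M' B"
    using sum_of_measures[of M' G'] sets by metis
  have spaces: "space T = UNIV" "space G' = UNIV" "space M' = UNIV"
    using sets_eq_imp_space_eq[OF T(1)] sets_eq_imp_space_eq[OF sets(1)] sets_eq_imp_space_eq[OF sets(2)] by simp_all
  have finT: "finite_measure T"
    by standard (use T(2)[of UNIV] fin spaces in \<open>auto simp: finite_measure.emeasure_finite\<close>)
  have ac: "absolutely_continuous T G'" "absolutely_continuous T M'"
    using T sets by (auto simp: absolutely_continuous_def null_sets_def)
  obtain D where D: "D \<in> borel_measurable T" "\<And>x. 0 \<le> D x" "G' = rdensity T D"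
    using finite_measure_density_real[OF finT ac(1)] fin sets T(1) by metis
  obtain E where E: "E \<in> borel_measurable T" "\<And>x. 0 \<le> E x" "M' = rdensity T E"
    using finite_measure_density_real[OF finT ac(2)] fin sets T(1) by metis
  have [measurable_cong]: "sets T = sets borel" by fact
  note [measurable] = D(1) E(1)
  have "G = density G' (\<lambda>x. ennreal (1 / wt x))"
    using levy_density_weight_inverse[OF G] by (simp add: G'_def)
  also have "\<dots> = density T (\<lambda>x. ennreal (D x) * ennreal (1 / wt x))"
    unfolding D(3) by (rule density_density_eq) measurable
  finally have G_eq: "G = density T (\<lambda>x. ennreal (D x * (1 / wt x)))"
    using D(2) by (subst ennreal_mult) auto
  have "M = density M' (\<lambda>x. ennreal (1 / wt x))"
    using levy_density_weight_inverse[OF M] by (simp add: M'_def)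
  also have "\<dots> = density T (\<lambda>x. ennreal (E x) * ennreal (1 / wt x))"
    unfolding E(3) by (rule density_density_eq) measurable
  finally have M_eq: "M = density T (\<lambda>x. ennreal (E x * (1 / wt x)))"
    using E(2) by (subst ennreal_mult) auto
  have "density_pair T (\<lambda>x. D x * (1 / wt x)) (\<lambda>x. E x * (1 / wt x)) G M"
    unfolding density_pair_def
  proof (intro conjI finT T(1) G_eq M_eq)
    show "(\<lambda>x. D x * (1 / wt x)) \<in> borel_measurable borel" "(\<lambda>x. E x * (1 / wt x)) \<in> borel_measurable borel"
      by measurable
  qed (use D E in auto)
  then show ?thesis by blast
qed

lemma levy_finite_off:
  assumes G: "levy_measure G" and r: "0 < r" and B: "B \<in> borel_off r"
  shows "emeasure G B < \<infinity>"
proof -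
  have [measurable_cong]: "sets G = sets borel" using G by (rule levy_measure_sets)
  have [measurable]: "B \<in> sets borel" using B by (simp add: borel_off_def)
  define c where "c = 1 / wt r"
  have c: "0 \<le> c" "c * wt r = 1" using r by (auto simp: c_def min_def)
  have le: "indicator B x \<le> ennreal c * ennreal (wt x)" for x
  proof (cases "x \<in> B")
    case True
    then have "r \<le> \<bar>x\<bar>" using B r by (auto simp: borel_off_def abs_if)
    then have "wt r \<le> wt x" using r by (simp add: abs_le_square_iff[symmetric] min_le_iff_disj) 
    then have "1 \<le> c * wt x" using mult_left_mono[of "wt r" "wt x" c] c by simp
    then show ?thesis using True c by (simp add: ennreal_mult[symmetric])
  qed simp
  have "emeasure G B = (\<integral>\<^sup>+x. indicator B x \<partial>G)" by simp
  also have "\<dots> \<le> (\<integral>\<^sup>+x. ennreal c * ennreal (wt x) \<partial>G)" by (intro nn_integral_mono le)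
  also have "\<dots> = ennreal c * (\<integral>\<^sup>+x. ennreal (wt x) \<partial>G)" by (rule nn_integral_cmult) measurable
  also have "\<dots> < \<infinity>" using G by (auto simp: levy_measure_def ennreal_mult_less_top)
  finally show ?thesis .
qed

section \<open>The variations of a difference of Levy measures\<close>

lemma borel_off_subset_off_zero: "0 < r \<Longrightarrow> borel_off r \<subseteq> borel_off_zero"
proof
  fix B assume r: "0 < r" and B: "B \<in> borel_off r"
  have "closure B \<subseteq> - {-r<..<r}"
    using B by (intro closure_minimal) (auto simp: borel_off_def closed_def)
  then show "B \<in> borel_off_zero" using B r by (auto simp: borel_off_def borel_off_zero_def)
qed

lemma emeasure_SUP_off_zero:
  fixes N :: "real measure"
  assumes N: "sets N = sets borel" "emeasure N {0} = 0" and [measurable]: "B \<in> sets borel"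
  shows "emeasure N B = (SUP n. emeasure N (B - {- (1 / real (Suc n)) <..< 1 / real (Suc n)}))"
proof -
  define C where "C n = B - {- (1 / real (Suc n)) <..< 1 / real (Suc n)}" for n
  have C [measurable]: "C n \<in> sets borel" for n by (simp add: C_def)
  have inc: "incseq C"
  proof (rule incseq_SucI)
    fix n
    have "1 / real (Suc (Suc n)) \<le> 1 / real (Suc n)" by (simp add: field_simps)
    then show "C n \<subseteq> C (Suc n)" unfolding C_def by auto
  qed
  have un: "(\<Union>n. C n) = B - {0}"
  proof
    show "(\<Union>n. C n) \<subseteq> B - {0}" by (auto simp: C_def)
    show "B - {0} \<subseteq> (\<Union>n. C n)"
    proof
      fix x assume x: "x \<in> B - {0}"
      then obtain n where "1 / real (Suc n) < \<bar>x\<bar>" using nat_approx_posE[of "\<bar>x\<bar>"] by auto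
      then show "x \<in> (\<Union>n. C n)" using x by (auto simp: C_def intro!: exI[of _ n])
    qed
  qed
  have "emeasure N B = emeasure N (B - {0})"
    using N by (intro emeasure_eq_AE AE_I[where N="{0}"]) auto
  also have "\<dots> = (SUP n. emeasure N (C n))"
    using N inc un by (subst SUP_emeasure_incseq) auto
  finally show ?thesis by (simp add: C_def)
qed

lemma borel_off_remove_ball:
  "B \<in> sets borel \<Longrightarrow> B - {- r <..< r} \<in> borel_off r"
  by (auto simp: borel_off_def)

lemma measure_off_zero_eqI:
  fixes \<mu> \<mu>' :: "real measure"
  assumes "sets \<mu> = sets borel" "sets \<mu>' = sets borel" "emeasure \<mu> {0} = 0" "emeasure \<mu>' {0} = 0"
    and eq: "\<And>r B. 0 < r \<Longrightarrow> B \<in> borel_off r \<Longrightarrow> emeasure \<mu> B = emeasure \<mu>' B"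
  shows "\<mu> = \<mu>'"
proof (rule measure_eqI)
  fix B assume "B \<in> sets \<mu>"
  then have B: "B \<in> sets borel" using assms by simp
  have "emeasure \<mu> (B - {- (1 / real (Suc n)) <..< 1 / real (Suc n)})
      = emeasure \<mu>' (B - {- (1 / real (Suc n)) <..< 1 / real (Suc n)})" for n
    by (rule eq[OF _ borel_off_remove_ball[OF B]]) simp
  then show "emeasure \<mu> B = emeasure \<mu>' B"
    by (simp only: emeasure_SUP_off_zero[OF assms(1,3) B] emeasure_SUP_off_zero[OF assms(2,4) B])
qed (use assms in simp)

lemma glue_off_zero_eqI:
  assumes "sets \<mu> = sets borel" "emeasure \<mu> {0} = 0"
    and "\<And>r B. 0 < r \<Longrightarrow> B \<in> borel_off r \<Longrightarrow> emeasure \<mu> B = v (borel_off r) B"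
  shows "glue_off_zero v = \<mu>"
  unfolding glue_off_zero_def
proof (rule the_equality)
  fix \<mu>' assume "sets \<mu>' = sets borel \<and> emeasure \<mu>' {0} = 0 \<and>
    (\<forall>r>0. \<forall>B\<in>borel_off r. emeasure \<mu>' B = v (borel_off r) B)"
  then show "\<mu>' = \<mu>" using assms by (intro measure_off_zero_eqI) auto
qed (use assms in auto)

text \<open>
  The supremum is attained at \<open>B \<inter> {m \<le> g}\<close>, a Hahn set; \<open>ennreal (g x - m x)\<close> is the positive
  part of \<open>g x - m x\<close>, since \<open>ennreal\<close> truncates.
\<close>

lemma pos_variation_density:
  assumes T: "sets T = sets borel"
    and [measurable]: "g \<in> borel_measurable borel" "m \<in> borel_measurable borel"
    and nn: "\<And>x. 0 \<le> g x" "\<And>x. 0 \<le> m x"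
    and G: "levy_measure (rdensity T g)" (is "levy_measure ?G")
    and M: "levy_measure (rdensity T m)" (is "levy_measure ?M")
    and r: "0 < r" and B: "B \<in> borel_off r"
  shows "pos_variation (borel_off r) (levy_diff ?G ?M) B
       = emeasure (rdensity T (\<lambda>x. g x - m x)) B"
proof -
  have [measurable_cong]: "sets T = sets borel" by fact
  have [measurable]: "B \<in> sets borel" using B by (simp add: borel_off_def)
  have int: "integrable T (\<lambda>x. indicator C x * g x)" "integrable T (\<lambda>x. indicator C x * m x)"
    "measure ?G C = (\<integral>x. indicator C x * g x \<partial>T)" "measure ?M C = (\<integral>x. indicator C x * m x \<partial>T)"
    if C: "C \<in> borel_off r" for C
  proof -
    have [measurable]: "C \<in> sets borel" using C by (simp add: borel_off_def)
    have 1: "integrable T (\<lambda>x. indicator C x * h x) \<and> measure (rdensity T h) C = (\<integral>x. indicator C x * h x \<partial>T)"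
      if [measurable]: "h \<in> borel_measurable borel" and h: "\<And>x. 0 \<le> h x" and L: "levy_measure (rdensity T h)"
      for h :: "real \<Rightarrow> real"
    proof -
      have eq: "emeasure (rdensity T h) C = (\<integral>\<^sup>+x. ennreal (indicator C x * h x) \<partial>T)"
        by (subst emeasure_density) (auto intro!: nn_integral_cong split: split_indicator)
      with levy_finite_off[OF L r C] have fin: "integrable T (\<lambda>x. indicator C x * h x)"
        by (intro integrableI_bounded) (simp_all add: abs_mult h)
      moreover have "measure (rdensity T h) C = (\<integral>x. indicator C x * h x \<partial>T)"
        unfolding measure_def eq by (subst integral_eq_nn_integral) (auto simp: h)
      ultimately show ?thesis by blast
    qed
    show "integrable T (\<lambda>x. indicator C x * g x)" "integrable T (\<lambda>x. indicator C x * m x)"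
      "measure ?G C = (\<integral>x. indicator C x * g x \<partial>T)" "measure ?M C = (\<integral>x. indicator C x * m x \<partial>T)"
      using 1[OF assms(2) nn(1) G] 1[OF assms(3) nn(2) M] by auto
  qed
  have diff: "levy_diff ?G ?M C = (\<integral>x. indicator C x * (g x - m x) \<partial>T)"
    "integrable T (\<lambda>x. indicator C x * (g x - m x))" if "C \<in> borel_off r" for C
  proof -
    have "C \<in> borel_off_zero" using that borel_off_subset_off_zero r by blast
    then show "levy_diff ?G ?M C = (\<integral>x. indicator C x * (g x - m x) \<partial>T)"
      using int[OF that] by (simp add: levy_diff_def algebra_simps)
    show "integrable T (\<lambda>x. indicator C x * (g x - m x))"
      using Bochner_Integration.integrable_diff[OF int(1,2)[OF that]] by (simp add: algebra_simps)
  qed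
  have pos: "emeasure (rdensity T (\<lambda>x. g x - m x)) B = (\<integral>\<^sup>+x. ennreal (indicator B x * (g x - m x)) \<partial>T)"
    by (subst emeasure_density) (auto intro!: nn_integral_cong split: split_indicator)
  show ?thesis
  proof (rule antisym)
    show "pos_variation (borel_off r) (levy_diff ?G ?M) B \<le> emeasure (rdensity T (\<lambda>x. g x - m x)) B"
      unfolding pos_variation_def
    proof (rule SUP_least)
      fix C assume "C \<in> {C \<in> borel_off r. C \<subseteq> B}"
      then have C: "C \<in> borel_off r" "C \<subseteq> B" by auto
      then have [measurable]: "C \<in> sets borel" by (simp add: borel_off_def)
      have "ennreal (levy_diff ?G ?M C) \<le> ennreal (\<integral>x. max 0 (indicator C x * (g x - m x)) \<partial>T)"
        unfolding diff(1)[OF C(1)] using diff(2)[OF C(1)]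
        by (intro ennreal_leI integral_mono) auto
      also have "\<dots> = (\<integral>\<^sup>+x. ennreal (max 0 (indicator C x * (g x - m x))) \<partial>T)"
        using diff(2)[OF C(1)] by (intro nn_integral_eq_integral[symmetric]) auto
      also have "\<dots> \<le> (\<integral>\<^sup>+x. ennreal (indicator B x * (g x - m x)) \<partial>T)"
        using C(2) by (intro nn_integral_mono) (auto split: split_indicator simp: max_def ennreal_leI)
      finally show "ennreal (levy_diff ?G ?M C) \<le> emeasure (rdensity T (\<lambda>x. g x - m x)) B"
        by (simp add: pos)
    qed
    define C where "C = B \<inter> {x. m x \<le> g x}"
    have C: "C \<in> borel_off r" "C \<subseteq> B" using B unfolding C_def borel_off_def by auto
    have "emeasure (rdensity T (\<lambda>x. g x - m x)) B = (\<integral>\<^sup>+x. ennreal (indicator C x * (g x - m x)) \<partial>T)"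
      unfolding pos by (intro nn_integral_cong) (auto simp: C_def ennreal_neg split: split_indicator)
    also have "\<dots> = ennreal (\<integral>x. indicator C x * (g x - m x) \<partial>T)"
      using diff(2)[OF C(1)] by (intro nn_integral_eq_integral) (auto simp: C_def split: split_indicator)
    also have "\<dots> = ennreal (levy_diff ?G ?M C)" by (simp add: diff(1)[OF C(1)])
    also have "\<dots> \<le> pos_variation (borel_off r) (levy_diff ?G ?M) B"
      unfolding pos_variation_def using C by (intro SUP_upper) auto
    finally show "emeasure (rdensity T (\<lambda>x. g x - m x)) B \<le> pos_variation (borel_off r) (levy_diff ?G ?M) B" .
  qed
qed

lemma neg_variation_levy_diff:
  assumes "0 < r"
  shows "neg_variation (borel_off r) (levy_diff G M) B = pos_variation (borel_off r) (levy_diff M G) B"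
  unfolding neg_variation_def pos_variation_def
  using borel_off_subset_off_zero[OF assms] by (intro SUP_cong refl) (auto simp: levy_diff_def)

lemma levy_measure_density_le:
  assumes "sets T = sets borel" and [measurable]: "g \<in> borel_measurable borel" "h \<in> borel_measurable borel"
    and G: "levy_measure (rdensity T g)" and le: "\<And>x. h x \<le> g x"
  shows "levy_measure (rdensity T h)"
proof -
  have [measurable_cong]: "sets T = sets borel" by fact
  have mono: "emeasure (rdensity T h) B \<le> emeasure (rdensity T g) B"
    if [measurable]: "B \<in> sets borel" for B
    using le by (subst (1 2) emeasure_density) (auto intro!: nn_integral_mono mult_right_mono ennreal_leI)
  have "(\<integral>\<^sup>+x. ennreal (wt x) \<partial>rdensity T h)
      \<le> (\<integral>\<^sup>+x. ennreal (wt x) \<partial>rdensity T g)"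
    using le by (subst (1 2) nn_integral_density) (auto intro!: nn_integral_mono mult_right_mono ennreal_leI)
  then show ?thesis using G mono[of "{0}"] assms(1) unfolding levy_measure_def by auto
qed

lemma ql_variations_density:
  assumes T: "sets T = sets borel"
    and [measurable]: "g \<in> borel_measurable borel" "m \<in> borel_measurable borel"
    and nn: "\<And>x. 0 \<le> g x" "\<And>x. 0 \<le> m x"
    and G: "levy_measure (rdensity T g)" (is "levy_measure ?G")
    and M: "levy_measure (rdensity T m)" (is "levy_measure ?M")
  shows "ql_pos (levy_diff ?G ?M) = rdensity T (\<lambda>x. g x - m x)"
    and "ql_neg (levy_diff ?G ?M) = rdensity T (\<lambda>x. m x - g x)"
    and "ql_abs (levy_diff ?G ?M) = rdensity T (\<lambda>x. \<bar>g x - m x\<bar>)"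
proof -
  have [measurable_cong]: "sets T = sets borel" by fact
  have levy: "levy_measure (rdensity T (\<lambda>x. g x - m x))"
    "levy_measure (rdensity T (\<lambda>x. m x - g x))"
    using nn by (auto intro: levy_measure_density_le[OF T _ _ G] levy_measure_density_le[OF T _ _ M])
  show "ql_pos (levy_diff ?G ?M) = rdensity T (\<lambda>x. g x - m x)"
    unfolding ql_pos_def using levy(1) pos_variation_density[OF assms]
    by (intro glue_off_zero_eqI) (auto simp: levy_measure_def)
  show "ql_neg (levy_diff ?G ?M) = rdensity T (\<lambda>x. m x - g x)"
    unfolding ql_neg_def using levy(2) pos_variation_density[OF T assms(3,2) nn(2,1) M G]
    by (intro glue_off_zero_eqI) (auto simp: levy_measure_def neg_variation_levy_diff)
  have abs: "ennreal \<bar>g x - m x\<bar> = ennreal (g x - m x) + ennreal (m x - g x)" for x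
    by (cases "m x \<le> g x") (auto simp: ennreal_neg abs_if)
  have sum: "emeasure (rdensity T (\<lambda>x. \<bar>g x - m x\<bar>)) B =
    emeasure (rdensity T (\<lambda>x. g x - m x)) B + emeasure (rdensity T (\<lambda>x. m x - g x)) B"
    if [measurable]: "B \<in> sets borel" for B
    by (simp add: emeasure_density abs distrib_right nn_integral_add)
  show "ql_abs (levy_diff ?G ?M) = rdensity T (\<lambda>x. \<bar>g x - m x\<bar>)"
    unfolding ql_abs_def total_variation_def
  proof (intro glue_off_zero_eqI)
    fix r B assume rB: "(0::real) < r" "B \<in> borel_off r"
    then have "B \<in> sets borel" by (simp add: borel_off_def)
    then show "emeasure (rdensity T (\<lambda>x. \<bar>g x - m x\<bar>)) B = pos_variation (borel_off r) (levy_diff ?G ?M) B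
        + neg_variation (borel_off r) (levy_diff ?G ?M) B"
      using rB pos_variation_density[OF assms rB] pos_variation_density[OF T assms(3,2) nn(2,1) M G rB]
      by (simp add: sum neg_variation_levy_diff)
  qed (use levy T in \<open>auto simp: levy_measure_def sum\<close>)
qed

lemma levy_measure_ql:
  assumes G: "levy_measure G" and M: "levy_measure M"
  shows "levy_measure (ql_pos (levy_diff G M))" "levy_measure (ql_neg (levy_diff G M))"
proof -
  obtain T g m where "density_pair T g m G M" using levy_pair_densities[OF assms] by blast
  note * = density_pairD[OF this]
  note q = ql_variations_density[OF *(2-6), folded *(7,8), OF G M]
  show "levy_measure (ql_pos (levy_diff G M))" "levy_measure (ql_neg (levy_diff G M))"
    unfolding q
    by (rule levy_measure_density_le[OF *(2,3) _ G[unfolded *(7)]] levy_measure_density_le[OF *(2,4) _ M[unfolded *(8)]],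
        use * in auto)+
qed

lemma ql_neg_levy_diff:
  assumes G: "levy_measure G" and M: "levy_measure M"
  shows "ql_neg (levy_diff G M) = ql_pos (levy_diff M G)"
proof -
  obtain T g m where "density_pair T g m G M" using levy_pair_densities[OF assms] by blast
  note * = density_pairD[OF this]
  show ?thesis
    using ql_variations_density(2)[OF *(2-6), folded *(7,8), OF G M]
      ql_variations_density(1)[OF *(2,4,3,6,5), folded *(7,8), OF M G] by simp
qed

lemma emeasure_ql_pos_off:
  assumes G: "levy_measure G" and M: "levy_measure M" and r: "0 < r" and B: "B \<in> borel_off r"
  shows "emeasure (ql_pos (levy_diff G M)) B = pos_variation (borel_off r) (levy_diff G M) B"
proof -
  obtain T g m where "density_pair T g m G M" using levy_pair_densities[OF G M] by blast
  note * = density_pairD[OF this]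
  show ?thesis
    using ql_variations_density(1)[OF *(2-6), folded *(7,8), OF G M]
      pos_variation_density[OF *(2-6), folded *(7,8), OF G M r B] by simp
qed

lemma nn_integral_ql_abs:
  assumes G: "levy_measure G" and M: "levy_measure M" and [measurable]: "h \<in> borel_measurable borel"
  shows "(\<integral>\<^sup>+x. h x \<partial>ql_abs (levy_diff G M))
       = (\<integral>\<^sup>+x. h x \<partial>ql_pos (levy_diff G M)) + (\<integral>\<^sup>+x. h x \<partial>ql_neg (levy_diff G M))"
proof -
  obtain T g m where "density_pair T g m G M" using levy_pair_densities[OF assms(1,2)] by blast
  note * = density_pairD[OF this]
  note q = ql_variations_density[OF *(2-6), folded *(7,8), OF G M]
  have [measurable_cong]: "sets T = sets borel" by fact
  note [measurable] = *(3,4)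
  have abs: "ennreal \<bar>g x - m x\<bar> = ennreal (g x - m x) + ennreal (m x - g x)" for x
    by (cases "m x \<le> g x") (auto simp: ennreal_neg abs_if)
  have "(\<integral>\<^sup>+x. h x \<partial>ql_abs (levy_diff G M)) = (\<integral>\<^sup>+x. ennreal (g x - m x) * h x + ennreal (m x - g x) * h x \<partial>T)"
    unfolding q by (simp add: nn_integral_density abs distrib_right)
  also have "\<dots> = (\<integral>\<^sup>+x. ennreal (g x - m x) * h x \<partial>T) + (\<integral>\<^sup>+x. ennreal (m x - g x) * h x \<partial>T)"
    by (rule nn_integral_add) measurable
  finally show ?thesis
    unfolding q by (simp add: nn_integral_density)
qed

lemma levy_integrable:
  fixes h :: "real \<Rightarrow> 'b::{banach, second_countable_topology}"
  assumes G: "levy_measure G" and [measurable]: "h \<in> borel_measurable borel"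
    and bound: "\<And>x. norm (h x) \<le> C * wt x"
  shows "integrable G h"
proof (rule Bochner_Integration.integrable_bound)
  have [measurable_cong]: "sets G = sets borel" using G by (rule levy_measure_sets)
  have "integrable G wt"
    using G by (intro integrableI_bounded) (auto simp: levy_measure_def)
  then show "integrable G (\<lambda>x. C * wt x)" by simp
  show "h \<in> borel_measurable G" by measurable
  show "AE x in G. norm (h x) \<le> norm (C * wt x)"
    using bound order_trans[OF bound abs_ge_self] by (auto simp: abs_mult)
qed

text \<open>
  The integral against the Jordan decomposition can be computed from any representation as a
  difference of Levy measures, since \<open>(g - m)\<^sup>+ - (m - g)\<^sup>+ = g - m\<close>.  This removes the variations from
  all formulas that are linear in the measure.
\<close>

lemma ql_integral_levy_diff:
  fixes h :: "real \<Rightarrow> 'b::{banach, second_countable_topology}"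
  assumes G: "levy_measure G" and M: "levy_measure M" and [measurable]: "h \<in> borel_measurable borel"
    and bound: "\<And>x. norm (h x) \<le> C * wt x"
  shows "ql_integral (levy_diff G M) h = (\<integral>x. h x \<partial>G) - (\<integral>x. h x \<partial>M)"
proof -
  obtain T g m where "density_pair T g m G M" using levy_pair_densities[OF assms(1,2)] by blast
  note * = density_pairD[OF this]
  note q = ql_variations_density[OF *(2-6), folded *(7,8), OF G M]
  have [measurable_cong]: "sets T = sets borel" by fact
  note [measurable] = *(3,4)
  define p where "p x = max 0 (g x - m x)" for x
  define n where "n x = max 0 (m x - g x)" for x
  have [measurable]: "p \<in> borel_measurable borel" "n \<in> borel_measurable borel"
    unfolding p_def n_def by measurable
  have "ennreal (g x - m x) = ennreal (p x)" "ennreal (m x - g x) = ennreal (n x)" for x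
    by (auto simp: p_def n_def max_def ennreal_neg)
  then have q': "ql_pos (levy_diff G M) = rdensity T p"
    "ql_neg (levy_diff G M) = rdensity T n"
    by (simp_all add: q)
  have dens: "integrable T (\<lambda>x. u x *\<^sub>R h x) \<and> (\<integral>x. h x \<partial>N) = (\<integral>x. u x *\<^sub>R h x \<partial>T)"
    if "levy_measure N" "N = rdensity T u" "u \<in> borel_measurable borel" "\<And>x. 0 \<le> u x"
    for N and u :: "real \<Rightarrow> real"
  proof -
    note [measurable] = that(3)
    have "integrable (rdensity T u) h"
      using levy_integrable[OF that(1) _ bound] that(2) by simp
    then show ?thesis
      unfolding that(2) using that(4) by (simp add: integrable_density integral_density)
  qed
  have pos: "integrable T (\<lambda>x. p x *\<^sub>R h x)" "(\<integral>x. h x \<partial>ql_pos (levy_diff G M)) = (\<integral>x. p x *\<^sub>R h x \<partial>T)"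
    using dens[OF levy_measure_ql(1)[OF G M] q'(1)] by (auto simp: p_def)
  have neg: "integrable T (\<lambda>x. n x *\<^sub>R h x)" "(\<integral>x. h x \<partial>ql_neg (levy_diff G M)) = (\<integral>x. n x *\<^sub>R h x \<partial>T)"
    using dens[OF levy_measure_ql(2)[OF G M] q'(2)] by (auto simp: n_def)
  have g: "integrable T (\<lambda>x. g x *\<^sub>R h x)" "(\<integral>x. h x \<partial>G) = (\<integral>x. g x *\<^sub>R h x \<partial>T)"
    using dens[OF G *(7) *(3)] *(5) by auto
  have m: "integrable T (\<lambda>x. m x *\<^sub>R h x)" "(\<integral>x. h x \<partial>M) = (\<integral>x. m x *\<^sub>R h x \<partial>T)"
    using dens[OF M *(8) *(4)] *(6) by auto
  have "ql_integral (levy_diff G M) h = (\<integral>x. p x *\<^sub>R h x - n x *\<^sub>R h x \<partial>T)"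
    unfolding ql_integral_def pos(2) neg(2) using pos(1) neg(1) by simp
  also have "\<dots> = (\<integral>x. g x *\<^sub>R h x - m x *\<^sub>R h x \<partial>T)"
    by (intro Bochner_Integration.integral_cong refl)
      (auto simp: p_def n_def max_def scaleR_diff_left[symmetric])
  also have "\<dots> = (\<integral>x. h x \<partial>G) - (\<integral>x. h x \<partial>M)"
    unfolding g(2) m(2) using g(1) m(1) by simp
  finally show ?thesis .
qed

lemma quasi_levy_type_levy_diff:
  assumes G: "levy_measure G" and M: "levy_measure M"
  shows "quasi_levy_type (levy_diff G M)"
  unfolding quasi_levy_type_def
proof (intro conjI allI impI)
  fix r :: real assume r: "0 < r"
  have "signed_measure_on (borel_off r) (levy_diff G M)"
    unfolding signed_measure_on_def
  proof (intro conjI allI impI)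
    show "levy_diff G M {} = 0" by (simp add: levy_diff_def borel_off_zero_def)
    fix A :: "nat \<Rightarrow> real set"
    assume A: "range A \<subseteq> borel_off r" "disjoint_family A" "(\<Union>n. A n) \<in> borel_off r"
    have sums: "(\<lambda>n. measure N (A n)) sums measure N (\<Union>n. A n)" if N: "levy_measure N" for N
      using A levy_finite_off[OF N r A(3)]
      by (intro measure_UNION) (auto simp: levy_measure_sets[OF N] borel_off_def subset_eq)
    have "A n \<in> borel_off_zero" "(\<Union>n. A n) \<in> borel_off_zero" for n
      using A borel_off_subset_off_zero[OF r] by blast+
    then show "(\<lambda>n. levy_diff G M (A n)) sums levy_diff G M (\<Union>n. A n)"
      using sums_diff[OF sums[OF G] sums[OF M]] by (simp add: levy_diff_def)
  qed
  then show "signed_measure_on (borel_off r) (levy_diff G M)" .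
next
  show "(\<integral>\<^sup>+x. ennreal (wt x) \<partial>ql_abs (levy_diff G M)) < \<infinity>"
    using levy_measure_ql[OF assms] by (subst nn_integral_ql_abs[OF assms]) (auto simp: levy_measure_def)
qed

section \<open>Levy kernels and mixtures\<close>

definition levy_kernel :: "'s measure \<Rightarrow> ('s \<Rightarrow> real measure) \<Rightarrow> bool" where
  "levy_kernel L \<kappa> \<longleftrightarrow> (\<forall>s\<in>space L. levy_measure (\<kappa> s)) \<and>
     (\<forall>B\<in>sets borel. (\<lambda>s. emeasure (\<kappa> s) B) \<in> borel_measurable L)"

lemma
  assumes sets: "\<And>s. s \<in> space L \<Longrightarrow> sets (\<kappa> s) = sets N"
    and meas: "\<And>B. B \<in> sets N \<Longrightarrow> (\<lambda>s. emeasure (\<kappa> s) B) \<in> borel_measurable L"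
    and h: "h \<in> borel_measurable N"
  shows nn_integral_kernel_measurable: "(\<lambda>s. \<integral>\<^sup>+x. h x \<partial>\<kappa> s) \<in> borel_measurable L"
    and mixture_nn_integral: "sets \<mu> = sets N \<Longrightarrow> (\<And>B. B \<in> sets N \<Longrightarrow> emeasure \<mu> B = (\<integral>\<^sup>+s. emeasure (\<kappa> s) B \<partial>L)) \<Longrightarrow>
      (\<integral>\<^sup>+x. h x \<partial>\<mu>) = (\<integral>\<^sup>+s. (\<integral>\<^sup>+x. h x \<partial>\<kappa> s) \<partial>L)"
proof -
  let ?mix = "\<lambda>h. sets \<mu> = sets N \<longrightarrow> (\<forall>B\<in>sets N. emeasure \<mu> B = (\<integral>\<^sup>+s. emeasure (\<kappa> s) B \<partial>L)) \<longrightarrow>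
      (\<integral>\<^sup>+x. h x \<partial>\<mu>) = (\<integral>\<^sup>+s. (\<integral>\<^sup>+x. h x \<partial>\<kappa> s) \<partial>L)"
  have "(\<lambda>s. \<integral>\<^sup>+x. h x \<partial>\<kappa> s) \<in> borel_measurable L \<and> ?mix h"
    using h
  proof induct
    case (cong f g)
    have eq: "(\<integral>\<^sup>+x. f x \<partial>M) = (\<integral>\<^sup>+x. g x \<partial>M)" if "sets M = sets N" for M
      using cong sets_eq_imp_space_eq[OF that] by (intro nn_integral_cong) auto
    then show ?case using cong sets eq[OF sets] by (simp cong: measurable_cong nn_integral_cong)
  next
    case (set A)
    have eq: "(\<integral>\<^sup>+x. indicator A x \<partial>M) = emeasure M A" if "sets M = sets N" for M
      using set that by simp
    then show ?case using set meas eq[OF sets] by (simp cong: measurable_cong nn_integral_cong)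
  next
    case (mult u c)
    have eq: "(\<integral>\<^sup>+x. c * u x \<partial>M) = c * (\<integral>\<^sup>+x. u x \<partial>M)" if "sets M = sets N" for M
      using mult that by (intro nn_integral_cmult) (simp cong: measurable_cong_sets)
    then show ?case using mult eq[OF sets] by (auto simp: nn_integral_cmult cong: measurable_cong nn_integral_cong)
  next
    case (add u v)
    have eq: "(\<integral>\<^sup>+x. v x + u x \<partial>M) = (\<integral>\<^sup>+x. v x \<partial>M) + (\<integral>\<^sup>+x. u x \<partial>M)" if "sets M = sets N" for M
      using add that by (intro nn_integral_add) (simp_all cong: measurable_cong_sets)
    then show ?case using add eq[OF sets] by (auto simp: nn_integral_add cong: measurable_cong nn_integral_cong)
  next
    case (seq U)
    have SUP: "(\<integral>\<^sup>+x. (SUP i. U i) x \<partial>M) = (SUP i. \<integral>\<^sup>+x. U i x \<partial>M)" if "sets M = sets N" for M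
      using seq that unfolding SUP_apply
      by (intro nn_integral_monotone_convergence_SUP) (simp_all cong: measurable_cong_sets)
    have "(\<integral>\<^sup>+s. (SUP i. \<integral>\<^sup>+x. U i x \<partial>\<kappa> s) \<partial>L) = (SUP i. \<integral>\<^sup>+s. (\<integral>\<^sup>+x. U i x \<partial>\<kappa> s) \<partial>L)"
      using seq by (intro nn_integral_monotone_convergence_SUP)
        (auto simp: incseq_def le_fun_def intro!: nn_integral_mono)
    moreover have "(\<lambda>s. SUP i. \<integral>\<^sup>+x. U i x \<partial>\<kappa> s) \<in> borel_measurable L"
      using seq by (intro borel_measurable_SUP) auto
    ultimately show ?case using seq SUP SUP[OF sets] by (simp cong: measurable_cong nn_integral_cong)
  qed
  then show "(\<lambda>s. \<integral>\<^sup>+x. h x \<partial>\<kappa> s) \<in> borel_measurable L"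
    "sets \<mu> = sets N \<Longrightarrow> (\<And>B. B \<in> sets N \<Longrightarrow> emeasure \<mu> B = (\<integral>\<^sup>+s. emeasure (\<kappa> s) B \<partial>L)) \<Longrightarrow>
      (\<integral>\<^sup>+x. h x \<partial>\<mu>) = (\<integral>\<^sup>+s. (\<integral>\<^sup>+x. h x \<partial>\<kappa> s) \<partial>L)"
    by blast+
qed

lemma levy_kernelD:
  assumes "levy_kernel L \<kappa>"
  shows "\<And>s. s \<in> space L \<Longrightarrow> levy_measure (\<kappa> s)" "\<And>s. s \<in> space L \<Longrightarrow> sets (\<kappa> s) = sets borel"
    "\<And>B. B \<in> sets borel \<Longrightarrow> (\<lambda>s. emeasure (\<kappa> s) B) \<in> borel_measurable L"
  using assms by (auto simp: levy_kernel_def levy_measure_sets)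

text \<open>
  The integration theory of kernels in the Giry monad is for sub-probability kernels.  A Levy kernel is
  such a kernel up to a density: weight it by \<open>min 1 (x\<^sup>2)\<close> and divide by one plus the total mass.
\<close>

lemma levy_kernel_normalise:
  assumes \<kappa>: "levy_kernel L \<kappa>"
  obtains \<pi> :: "'s \<Rightarrow> real measure" and c :: "'s \<Rightarrow> real"
  where "\<pi> \<in> L \<rightarrow>\<^sub>M subprob_algebra borel" "c \<in> borel_measurable L" "\<And>s. 0 < c s"
    "\<And>s. s \<in> space L \<Longrightarrow> \<kappa> s = density (\<pi> s) (\<lambda>x. ennreal (c s / wt x))"
proof -
  note k = levy_kernelD[OF \<kappa>]
  have km: "(\<lambda>s. \<integral>\<^sup>+x. h x \<partial>\<kappa> s) \<in> borel_measurable L" if "h \<in> borel_measurable borel" for h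
    using nn_integral_kernel_measurable[OF k(2,3) that] .
  define c where "c s = enn2real (\<integral>\<^sup>+x. ennreal (wt x) \<partial>\<kappa> s) + 1" for s
  have [measurable]: "(\<lambda>s. \<integral>\<^sup>+x. ennreal (wt x) \<partial>\<kappa> s) \<in> borel_measurable L"
    by (rule km) measurable
  have c: "c \<in> borel_measurable L" "0 < c s" for s
    unfolding c_def[abs_def] by (measurable, simp add: add_nonneg_pos)
  note [measurable] = c(1)
  define \<pi> where "\<pi> s = density (\<kappa> s) (\<lambda>x. ennreal (wt x) * ennreal (1 / c s))" for s
  have em: "emeasure (\<pi> s) B = ennreal (1 / c s) * (\<integral>\<^sup>+x. ennreal (wt x) * indicator B x \<partial>\<kappa> s)"
    if s: "s \<in> space L" and [measurable]: "B \<in> sets borel" for s B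
  proof -
    have [measurable_cong]: "sets (\<kappa> s) = sets borel" using k(2) s by simp
    have "emeasure (\<pi> s) B = (\<integral>\<^sup>+x. ennreal (1 / c s) * (ennreal (wt x) * indicator B x) \<partial>\<kappa> s)"
      unfolding \<pi>_def by (subst emeasure_density) (auto intro!: nn_integral_cong simp: mult_ac)
    also have "\<dots> = ennreal (1 / c s) * (\<integral>\<^sup>+x. ennreal (wt x) * indicator B x \<partial>\<kappa> s)"
      by (rule nn_integral_cmult) measurable
    finally show ?thesis .
  qed
  have 1: "\<pi> \<in> L \<rightarrow>\<^sub>M subprob_algebra borel"
  proof (rule measurable_subprob_algebra)
    fix s assume s: "s \<in> space L"
    show sets: "sets (\<pi> s) = sets borel" using k(2)[OF s] by (simp add: \<pi>_def)
    then have sp: "space (\<pi> s) = UNIV" using sets_eq_imp_space_eq[OF sets] by simp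
    have fin: "(\<integral>\<^sup>+x. ennreal (wt x) \<partial>\<kappa> s) < \<infinity>" using k(1)[OF s] by (simp add: levy_measure_def)
    have "emeasure (\<pi> s) (space (\<pi> s)) = ennreal (1 / c s) * (\<integral>\<^sup>+x. ennreal (wt x) \<partial>\<kappa> s)"
      using em[OF s, of UNIV] sp by simp
    also have "\<dots> = ennreal (1 / c s) * ennreal (enn2real (\<integral>\<^sup>+x. ennreal (wt x) \<partial>\<kappa> s))"
      using fin by simp
    also have "\<dots> = ennreal (enn2real (\<integral>\<^sup>+x. ennreal (wt x) \<partial>\<kappa> s) / c s)"
      using c(2)[of s] by (subst ennreal_mult[symmetric]) auto
    also have "\<dots> \<le> 1" using c(2)[of s] by (simp add: c_def)
    finally show "subprob_space (\<pi> s)" using sp by (intro subprob_spaceI) auto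
  next
    fix B :: "real set" assume [measurable]: "B \<in> sets borel"
    have [measurable]: "(\<lambda>s. \<integral>\<^sup>+x. ennreal (wt x) * indicator B x \<partial>\<kappa> s) \<in> borel_measurable L"
      by (rule km) measurable
    have "(\<lambda>s. ennreal (1 / c s) * (\<integral>\<^sup>+x. ennreal (wt x) * indicator B x \<partial>\<kappa> s)) \<in> borel_measurable L"
      by measurable
    then show "(\<lambda>s. emeasure (\<pi> s) B) \<in> borel_measurable L"
      using em by (simp cong: measurable_cong)
  qed
  have 2: "\<kappa> s = density (\<pi> s) (\<lambda>x. ennreal (c s / wt x))" if s: "s \<in> space L" for s
  proof -
    have [measurable_cong]: "sets (\<kappa> s) = sets borel" using k(2) s by simp
    have "density (\<pi> s) (\<lambda>x. ennreal (c s / wt x))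
        = density (\<kappa> s) (\<lambda>x. ennreal (wt x) * ennreal (1 / c s) * ennreal (c s / wt x))"
      unfolding \<pi>_def by (rule density_density_eq) measurable
    also have "\<dots> = density (\<kappa> s) (\<lambda>x. 1)"
    proof (rule density_cong)
      show "AE x in \<kappa> s. ennreal (wt x) * ennreal (1 / c s) * ennreal (c s / wt x) = 1"
        using levy_AE_nonzero[OF k(1)[OF s]]
      proof eventually_elim
        fix x :: real assume "x \<noteq> 0"
        then have "0 < wt x" by (simp add: min_def)
        then show "ennreal (wt x) * ennreal (1 / c s) * ennreal (c s / wt x) = 1"
          using c(2)[of s] by (simp add: ennreal_mult[symmetric] del: min_less_iff_conj)
      qed
    qed measurable
    finally show ?thesis by (simp add: density_1)
  qed
  show ?thesis by (rule that[OF 1 c 2])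
qed

lemma levy_kernel_nn_integral:
  assumes \<kappa>: "levy_kernel L \<kappa>" and h: "(\<lambda>(s, x). h s x) \<in> borel_measurable (L \<Otimes>\<^sub>M borel)"
  shows "(\<lambda>s. \<integral>\<^sup>+x. h s x \<partial>\<kappa> s) \<in> borel_measurable L"
proof -
  obtain \<pi> c where *: "\<pi> \<in> L \<rightarrow>\<^sub>M subprob_algebra borel" "c \<in> borel_measurable L" "\<And>s. 0 < c s"
    "\<And>s. s \<in> space L \<Longrightarrow> \<kappa> s = density (\<pi> s) (\<lambda>x. ennreal (c s / wt x))"
    using levy_kernel_normalise[OF \<kappa>] by blast
  note [measurable] = *(1,2) h
  have "(\<lambda>s. \<integral>\<^sup>+x. ennreal (c s / wt x) * h s x \<partial>\<pi> s) \<in> borel_measurable L"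
    by (rule nn_integral_measurable_subprob_algebra2[OF _ *(1)]) measurable
  moreover have "(\<integral>\<^sup>+x. h s x \<partial>\<kappa> s) = (\<integral>\<^sup>+x. ennreal (c s / wt x) * h s x \<partial>\<pi> s)" if s: "s \<in> space L" for s
  proof -
    have m: "borel_measurable (\<pi> s) = borel_measurable borel"
      by (rule measurable_cong_sets[OF sets_kernel[OF *(1) s] refl])
    have [measurable]: "h s \<in> borel_measurable borel" using measurable_Pair2[OF h s] by simp
    show ?thesis unfolding *(4)[OF s]
      by (rule nn_integral_density) (unfold m, measurable)
  qed
  ultimately show ?thesis by (simp cong: measurable_cong)
qed

lemma levy_kernel_integral:
  fixes h :: "'s \<Rightarrow> real \<Rightarrow> 'b::{banach, second_countable_topology}"
  assumes \<kappa>: "levy_kernel L \<kappa>" and h: "(\<lambda>(s, x). h s x) \<in> borel_measurable (L \<Otimes>\<^sub>M borel)"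
  shows "(\<lambda>s. \<integral>x. h s x \<partial>\<kappa> s) \<in> borel_measurable L"
proof -
  obtain \<pi> c where *: "\<pi> \<in> L \<rightarrow>\<^sub>M subprob_algebra borel" "c \<in> borel_measurable L" "\<And>s. 0 < c s"
    "\<And>s. s \<in> space L \<Longrightarrow> \<kappa> s = density (\<pi> s) (\<lambda>x. ennreal (c s / wt x))"
    using levy_kernel_normalise[OF \<kappa>] by blast
  note [measurable] = *(1,2) h measurable_distr2
  have "(\<lambda>s. \<integral>p. (c (fst p) / wt (snd p)) *\<^sub>R h (fst p) (snd p)
      \<partial>distr (\<pi> s) (L \<Otimes>\<^sub>M borel) (\<lambda>x. (s, x))) \<in> borel_measurable L"
    by (rule measurable_compose[OF _ integral_measurable_subprob_algebra]) measurable
  moreover have "(\<integral>x. h s x \<partial>\<kappa> s) = (\<integral>p. (c (fst p) / wt (snd p)) *\<^sub>R h (fst p) (snd p)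
      \<partial>distr (\<pi> s) (L \<Otimes>\<^sub>M borel) (\<lambda>x. (s, x)))" if s: "s \<in> space L" for s
  proof -
    have m: "borel_measurable (\<pi> s) = borel_measurable borel"
      by (rule measurable_cong_sets[OF sets_kernel[OF *(1) s] refl])
    have [measurable]: "h s \<in> borel_measurable borel" using measurable_Pair2[OF h s] by simp
    have "(\<integral>x. h s x \<partial>\<kappa> s) = (\<integral>x. (c s / wt x) *\<^sub>R h s x \<partial>\<pi> s)"
      unfolding *(4)[OF s] using *(3)[of s]
      by (intro integral_density AE_I2 divide_nonneg_nonneg) (unfold m, auto intro: less_imp_le)
    also have "\<dots> = (\<integral>p. (c (fst p) / wt (snd p)) *\<^sub>R h (fst p) (snd p)
        \<partial>distr (\<pi> s) (L \<Otimes>\<^sub>M borel) (\<lambda>x. (s, x)))"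
      using s measurable_cong_sets[OF sets_kernel[OF *(1) s] refl, of "L \<Otimes>\<^sub>M borel"]
      by (subst integral_distr) auto
    finally show ?thesis .
  qed
  ultimately show ?thesis by (simp cong: measurable_cong)
qed

text \<open>
  Fubini for a Levy measure that is a mixture of a Levy kernel.  Domination by the Levy weight makes all
  inner integrals finite, for every \<open>s\<close> and not only almost everywhere.
\<close>

lemma mixture_integral:
  fixes h :: "real \<Rightarrow> complex"
  assumes \<kappa>: "levy_kernel L \<kappa>"
    and \<mu>: "sets \<mu> = sets borel" "\<And>B. B \<in> sets borel \<Longrightarrow> emeasure \<mu> B = (\<integral>\<^sup>+s. emeasure (\<kappa> s) B \<partial>L)"
    and fin: "levy_measure \<mu>"
    and h: "h \<in> borel_measurable borel" and bound: "\<And>x. norm (h x) \<le> C * wt x"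
  shows "integrable L (\<lambda>s. \<integral>x. h x \<partial>\<kappa> s)" "(\<integral>x. h x \<partial>\<mu>) = (\<integral>s. (\<integral>x. h x \<partial>\<kappa> s) \<partial>L)"
proof -
  note k = levy_kernelD[OF \<kappa>]
  have mix: "(\<integral>\<^sup>+x. u x \<partial>\<mu>) = (\<integral>\<^sup>+s. (\<integral>\<^sup>+x. u x \<partial>\<kappa> s) \<partial>L)" if "u \<in> borel_measurable borel" for u
    using mixture_nn_integral[OF k(2,3) that \<mu>] .
  have nonneg: "integrable L (\<lambda>s. \<integral>x. u x \<partial>\<kappa> s) \<and> (\<integral>x. u x \<partial>\<mu>) = (\<integral>s. (\<integral>x. u x \<partial>\<kappa> s) \<partial>L)"
    if [measurable]: "u \<in> borel_measurable borel" and u: "\<And>x. 0 \<le> u x" "\<And>x. u x \<le> C * wt x" for u :: "real \<Rightarrow> real"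
  proof -
    have nb: "norm (u x) \<le> C * wt x" for x using u by simp
    have [measurable]: "(\<lambda>s. \<integral>x. u x \<partial>\<kappa> s) \<in> borel_measurable L"
      by (rule levy_kernel_integral[OF \<kappa>]) measurable
    have inner: "ennreal (\<integral>x. u x \<partial>\<kappa> s) = (\<integral>\<^sup>+x. ennreal (u x) \<partial>\<kappa> s)" if "s \<in> space L" for s
      using levy_integrable[OF k(1)[OF that] _ nb] u by (intro nn_integral_eq_integral[symmetric]) auto
    have nn: "0 \<le> (\<integral>x. u x \<partial>\<kappa> s)" for s using u by (intro integral_nonneg_AE) auto
    have "(\<integral>\<^sup>+x. ennreal (u x) \<partial>\<mu>) = (\<integral>\<^sup>+s. (\<integral>\<^sup>+x. ennreal (u x) \<partial>\<kappa> s) \<partial>L)"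
      by (rule mix) measurable
    also have "\<dots> = (\<integral>\<^sup>+s. ennreal (\<integral>x. u x \<partial>\<kappa> s) \<partial>L)"
      using inner by (simp cong: nn_integral_cong)
    finally have eq: "ennreal (\<integral>x. u x \<partial>\<mu>) = (\<integral>\<^sup>+s. ennreal (\<integral>x. u x \<partial>\<kappa> s) \<partial>L)"
      using levy_integrable[OF fin _ nb] u by (subst nn_integral_eq_integral[symmetric]) auto
    then have int: "integrable L (\<lambda>s. \<integral>x. u x \<partial>\<kappa> s)"
      using nn by (intro integrableI_bounded) (auto simp: less_top[symmetric])
    with eq have "ennreal (\<integral>x. u x \<partial>\<mu>) = ennreal (\<integral>s. (\<integral>x. u x \<partial>\<kappa> s) \<partial>L)"
      using nn by (simp add: nn_integral_eq_integral)
    then have "(\<integral>x. u x \<partial>\<mu>) = (\<integral>s. (\<integral>x. u x \<partial>\<kappa> s) \<partial>L)"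
      using nn u by (subst (asm) ennreal_inj) (auto intro!: integral_nonneg_AE)
    with int show ?thesis by blast
  qed
  have real: "integrable L (\<lambda>s. \<integral>x. u x \<partial>\<kappa> s) \<and> (\<integral>x. u x \<partial>\<mu>) = (\<integral>s. (\<integral>x. u x \<partial>\<kappa> s) \<partial>L)"
    if [measurable]: "u \<in> borel_measurable borel" and u: "\<And>x. \<bar>u x\<bar> \<le> C * wt x" for u :: "real \<Rightarrow> real"
  proof -
    let ?p = "\<lambda>x. max 0 (u x)" and ?n = "\<lambda>x. max 0 (- u x)"
    have b: "?p x \<le> C * wt x" "?n x \<le> C * wt x" for x
      using u[of x] by (auto simp: max_def abs_if split: if_splits)
    have P: "integrable L (\<lambda>s. \<integral>x. ?p x \<partial>\<kappa> s) \<and> (\<integral>x. ?p x \<partial>\<mu>) = (\<integral>s. (\<integral>x. ?p x \<partial>\<kappa> s) \<partial>L)"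
      by (rule nonneg) (use b in auto)
    have N: "integrable L (\<lambda>s. \<integral>x. ?n x \<partial>\<kappa> s) \<and> (\<integral>x. ?n x \<partial>\<mu>) = (\<integral>s. (\<integral>x. ?n x \<partial>\<kappa> s) \<partial>L)"
      by (rule nonneg) (use b in auto)
    have split: "(\<integral>x. u x \<partial>\<nu>) = (\<integral>x. ?p x \<partial>\<nu>) - (\<integral>x. ?n x \<partial>\<nu>)" if "levy_measure \<nu>" for \<nu>
    proof -
      have "(\<integral>x. u x \<partial>\<nu>) = (\<integral>x. ?p x - ?n x \<partial>\<nu>)"
        by (intro Bochner_Integration.integral_cong refl) (auto simp: max_def)
      also have "\<dots> = (\<integral>x. ?p x \<partial>\<nu>) - (\<integral>x. ?n x \<partial>\<nu>)"
        using b by (intro Bochner_Integration.integral_diff levy_integrable[OF that, where C=C]) auto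
      finally show ?thesis .
    qed
    have "integrable L (\<lambda>s. (\<integral>x. ?p x \<partial>\<kappa> s) - (\<integral>x. ?n x \<partial>\<kappa> s))" using P N by simp
    then have "integrable L (\<lambda>s. \<integral>x. u x \<partial>\<kappa> s)"
      using split k(1) by (simp cong: Bochner_Integration.integrable_cong)
    moreover have "(\<integral>x. u x \<partial>\<mu>) = (\<integral>s. (\<integral>x. ?p x \<partial>\<kappa> s) - (\<integral>x. ?n x \<partial>\<kappa> s) \<partial>L)"
      using P N split[OF fin] by simp
    moreover have "\<dots> = (\<integral>s. (\<integral>x. u x \<partial>\<kappa> s) \<partial>L)"
      using split k(1) by (intro Bochner_Integration.integral_cong refl) auto
    ultimately show ?thesis by simp
  qed
  note [measurable] = h
  have R: "integrable L (\<lambda>s. \<integral>x. Re (h x) \<partial>\<kappa> s) \<and> (\<integral>x. Re (h x) \<partial>\<mu>) = (\<integral>s. (\<integral>x. Re (h x) \<partial>\<kappa> s) \<partial>L)"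
    by (rule real) (use order_trans[OF abs_Re_le_cmod bound] in auto)
  have I: "integrable L (\<lambda>s. \<integral>x. Im (h x) \<partial>\<kappa> s) \<and> (\<integral>x. Im (h x) \<partial>\<mu>) = (\<integral>s. (\<integral>x. Im (h x) \<partial>\<kappa> s) \<partial>L)"
    by (rule real) (use order_trans[OF abs_Im_le_cmod bound] in auto)
  have split: "(\<integral>x. h x \<partial>\<nu>) = of_real (\<integral>x. Re (h x) \<partial>\<nu>) + \<i> * of_real (\<integral>x. Im (h x) \<partial>\<nu>)"
    if "levy_measure \<nu>" for \<nu>
    using levy_integrable[OF that h bound] by (simp add: complex_eq_iff)
  have "integrable L (\<lambda>s. of_real (\<integral>x. Re (h x) \<partial>\<kappa> s) + \<i> * of_real (\<integral>x. Im (h x) \<partial>\<kappa> s))"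
    using R I by simp
  then show int: "integrable L (\<lambda>s. \<integral>x. h x \<partial>\<kappa> s)"
    using split k(1) by (simp cong: Bochner_Integration.integrable_cong)
  have "(\<integral>x. h x \<partial>\<mu>) = (\<integral>s. of_real (\<integral>x. Re (h x) \<partial>\<kappa> s) + \<i> * of_real (\<integral>x. Im (h x) \<partial>\<kappa> s) \<partial>L)"
    using R I split[OF fin] by simp
  also have "\<dots> = (\<integral>s. (\<integral>x. h x \<partial>\<kappa> s) \<partial>L)"
    using split k(1) by (intro Bochner_Integration.integral_cong refl) auto
  finally show "(\<integral>x. h x \<partial>\<mu>) = (\<integral>s. (\<integral>x. h x \<partial>\<kappa> s) \<partial>L)" .
qed

section \<open>Measurability of the variations of a kernel\<close>

text \<open>
  The family consists of the finite unions of sets of a countable basis: by outer regularity a Borel set is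
  approximated from outside by an open set, which is an increasing limit of such unions.  The family works for all finite
  measures at once.
\<close>

lemma countable_approximating_family:
  obtains \<U> :: "real set set" where "countable \<U>" "\<U> \<subseteq> sets borel"
    "\<And>N D e. finite_measure N \<Longrightarrow> sets N = sets borel \<Longrightarrow> D \<in> sets borel \<Longrightarrow> 0 < e \<Longrightarrow>
       \<exists>C\<in>\<U>. measure N (D - C) < e \<and> measure N (C - D) < e"
proof -
  obtain B :: "real set set" where B: "countable B" "topological_basis B"
    using ex_countable_basis by blast
  define \<U> where "\<U> = Union ` {F. finite F \<and> F \<subseteq> B}"
  have opn: "open b" if "b \<in> B" for b using B(2) that by (rule topological_basis_open)
  have 1: "countable \<U>" unfolding \<U>_def
    using countable_Collect_finite_subset[OF B(1)] by (auto simp: conj_commute)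
  have 2: "\<U> \<subseteq> sets borel" unfolding \<U>_def using opn by (auto intro!: borel_open)
  have 3: "\<exists>C\<in>\<U>. measure N (D - C) < e \<and> measure N (C - D) < e"
    if N: "finite_measure N" "sets N = sets borel" and [measurable]: "D \<in> sets borel" and e: "0 < e" for N D and e :: real
  proof -
    interpret finite_measure N by fact
    have [measurable_cong]: "sets N = sets borel" by fact
    have "emeasure N D < emeasure N D + ennreal e"
      using e by (simp add: emeasure_eq_measure ennreal_less_iff flip: ennreal_plus)
    then have "(INF U\<in>{U. D \<subseteq> U \<and> open U}. emeasure N U) < emeasure N D + ennreal e"
      using outer_regular[OF N(2), of D] by (simp add: emeasure_finite)
    then obtain U where U: "D \<subseteq> U" "open U" "emeasure N U < emeasure N D + ennreal e"
      unfolding INF_less_iff by blast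
    have "measure N U < measure N D + e"
      using U(3) e by (simp add: emeasure_eq_measure ennreal_less_iff flip: ennreal_plus)
    moreover have "measure N (U - D) = measure N U - measure N D"
      using U by (intro finite_measure_Diff) auto
    ultimately have UD: "measure N (U - D) < e" by simp
    obtain B' where B': "B' \<subseteq> B" "\<Union>B' = U" using B(2) U(2) unfolding topological_basis_def by blast
    have "\<exists>C\<in>\<U>. C \<subseteq> U \<and> measure N (U - C) < e"
    proof (cases "B' = {}")
      case True
      then show ?thesis using B' e by (intro bexI[of _ "{}"]) (auto simp: \<U>_def intro!: image_eqI[of _ _ "{}"])
    next
      case False
      define b where "b = from_nat_into B'"
      have b: "range b = B'" unfolding b_def
        using False countable_subset[OF B'(1) B(1)] by (rule range_from_nat_into)
      define C where "C n = (\<Union>i<n. b i)" for n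
      have bB: "b i \<in> B" for i using b B' by auto
      have Cm [measurable]: "C n \<in> sets borel" for n unfolding C_def using bB opn by (auto intro!: borel_open)
      have CU: "C n \<in> \<U>" for n unfolding \<U>_def C_def using bB by (intro image_eqI[of _ _ "b ` {..<n}"]) auto
      have "incseq C" unfolding C_def by (rule incseq_SucI) (auto simp: less_Suc_eq)
      moreover have "(\<Union>n. C n) = U" unfolding C_def B'(2)[symmetric] b[symmetric] by blast
      moreover have "range C \<subseteq> sets N" by (simp add: image_subset_iff N(2))
      ultimately have "(\<lambda>n. measure N (C n)) \<longlonglongrightarrow> measure N U"
        using finite_Lim_measure_incseq[of C] by simp
      then obtain n where "measure N U - e < measure N (C n)"
        using order_tendstoD(1)[of _ "measure N U" sequentially "measure N U - e"] e
        by (auto simp: eventually_sequentially)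
      moreover have sub: "C n \<subseteq> U" using b B' by (auto simp: C_def)
      moreover have "measure N (U - C n) = measure N U - measure N (C n)"
        using U sub by (intro finite_measure_Diff) auto
      ultimately show ?thesis using CU by (intro bexI[of _ "C n"]) auto
    qed
    then obtain C where C: "C \<in> \<U>" "C \<subseteq> U" "measure N (U - C) < e" by blast
    have [measurable]: "C \<in> sets borel" "U \<in> sets borel" using C 2 U by auto
    have "measure N (D - C) \<le> measure N (U - C)" using U by (intro finite_measure_mono) auto
    moreover have "measure N (C - D) \<le> measure N (U - D)" using C by (intro finite_measure_mono) auto
    ultimately show ?thesis using C UD by (intro bexI[of _ C]) auto
  qed
  show ?thesis by (rule that[OF 1 2 3])
qed

lemma ennreal_plus_le:
  assumes "0 \<le> e" shows "ennreal (x + e) \<le> ennreal x + ennreal e"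
proof (cases "0 \<le> x")
  case True
  then show ?thesis using assms by (simp add: ennreal_plus)
next
  case False
  then show ?thesis by (simp add: ennreal_neg ennreal_leI)
qed

text \<open>
  Away from \<open>0\<close> the positive variation of \<open>\<kappa> s - \<kappa>' s\<close> is a supremum over all Borel subsets of \<open>B\<close>.  Both
  measures are finite there, so subsets of the form \<open>C \<inter> B\<close> with \<open>C\<close> from a countable family that does not depend
  on \<open>s\<close> give the same supremum.
\<close>

lemma levy_kernel_ql_pos:
  assumes \<kappa>: "levy_kernel L \<kappa>" and \<kappa>': "levy_kernel L \<kappa>'"
  shows "levy_kernel L (\<lambda>s. ql_pos (levy_diff (\<kappa> s) (\<kappa>' s)))"
proof -
  note k = levy_kernelD[OF \<kappa>] and k' = levy_kernelD[OF \<kappa>']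
  let ?d = "\<lambda>s B C. ennreal (measure (\<kappa> s) (C \<inter> B) - measure (\<kappa>' s) (C \<inter> B))"
  let ?q = "\<lambda>s. ql_pos (levy_diff (\<kappa> s) (\<kappa>' s))"
  have levy: "levy_measure (?q s)" if "s \<in> space L" for s
    using levy_measure_ql(1)[OF k(1)[OF that] k'(1)[OF that]] .
  obtain \<U> :: "real set set" where \<U>: "countable \<U>" "\<U> \<subseteq> sets borel"
    "\<And>N D e. finite_measure N \<Longrightarrow> sets N = sets borel \<Longrightarrow> D \<in> sets borel \<Longrightarrow> 0 < e \<Longrightarrow>
       \<exists>C\<in>\<U>. measure N (D - C) < e \<and> measure N (C - D) < e"
    using countable_approximating_family by blast
  have SUP: "emeasure (?q s) B = (SUP C\<in>\<U>. ?d s B C)"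
    if s: "s \<in> space L" and r: "0 < r" and B: "B \<in> borel_off r" for s r B
  proof -
    have [measurable_cong]: "sets (\<kappa> s) = sets borel" "sets (\<kappa>' s) = sets borel"
      using k(2) k'(2) s by auto
    have Bm [measurable]: "B \<in> sets borel" using B by (simp add: borel_off_def)
    let ?G = "density (\<kappa> s) (indicator B)" and ?M = "density (\<kappa>' s) (indicator B)"
    obtain N where N: "sets N = sets borel" "\<And>X. X \<in> sets borel \<Longrightarrow> emeasure N X = emeasure ?G X + emeasure ?M X"
      using sum_of_measures[of ?M ?G] k(2) k'(2) s by auto
    have sp: "space N = UNIV" using sets_eq_imp_space_eq[OF N(1)] by simp
    have restr: "emeasure ?G X = emeasure (\<kappa> s) (B \<inter> X)" "emeasure ?M X = emeasure (\<kappa>' s) (B \<inter> X)"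
      if [measurable]: "X \<in> sets borel" for X
      by (auto simp: emeasure_restricted)
    have fin: "emeasure (\<kappa> s) (B \<inter> X) < \<infinity>" "emeasure (\<kappa>' s) (B \<inter> X) < \<infinity>" if "X \<in> sets borel" for X
    proof -
      have "B \<inter> X \<in> borel_off r" using that B by (auto simp: borel_off_def)
      then show "emeasure (\<kappa> s) (B \<inter> X) < \<infinity>" "emeasure (\<kappa>' s) (B \<inter> X) < \<infinity>"
        using levy_finite_off[OF k(1)[OF s] r] levy_finite_off[OF k'(1)[OF s] r] by auto
    qed
    have finN: "finite_measure N"
      by standard (use N(2)[of UNIV] restr[of UNIV] fin[of UNIV] sp in auto)
    have mN: "measure N X = measure (\<kappa> s) (B \<inter> X) + measure (\<kappa>' s) (B \<inter> X)" if X: "X \<in> sets borel" for X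
      using N(2)[OF X] restr[OF X] fin[OF X] by (simp add: measure_def enn2real_plus)
    have diff: "levy_diff (\<kappa> s) (\<kappa>' s) X = measure (\<kappa> s) X - measure (\<kappa>' s) X" if "X \<in> borel_off r" for X
      using that borel_off_subset_off_zero[OF r] by (auto simp: levy_diff_def)
    show ?thesis
      unfolding emeasure_ql_pos_off[OF k(1)[OF s] k'(1)[OF s] r B] pos_variation_def
    proof (rule antisym)
      show "(SUP C\<in>\<U>. ?d s B C)
          \<le> (SUP B\<in>{Ba \<in> borel_off r. Ba \<subseteq> B}. ennreal (levy_diff (\<kappa> s) (\<kappa>' s) B))"
      proof (rule SUP_least)
        fix C assume "C \<in> \<U>"
        then have "C \<inter> B \<in> borel_off r" using \<U>(2) B by (auto simp: borel_off_def)
        then show "?d s B C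
          \<le> (SUP B\<in>{Ba \<in> borel_off r. Ba \<subseteq> B}. ennreal (levy_diff (\<kappa> s) (\<kappa>' s) B))"
          by (intro SUP_upper2[of "C \<inter> B"]) (auto simp: diff)
      qed
      show "(SUP B\<in>{Ba \<in> borel_off r. Ba \<subseteq> B}. ennreal (levy_diff (\<kappa> s) (\<kappa>' s) B))
          \<le> (SUP C\<in>\<U>. ?d s B C)" (is "_ \<le> ?R")
      proof (rule SUP_least)
        fix D assume "D \<in> {Ba \<in> borel_off r. Ba \<subseteq> B}"
        then have D: "D \<in> borel_off r" "D \<subseteq> B" by auto
        then have [measurable]: "D \<in> sets borel" by (simp add: borel_off_def)
        show "ennreal (levy_diff (\<kappa> s) (\<kappa>' s) D) \<le> ?R"
        proof (rule ennreal_le_epsilon)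
          fix e :: real assume e: "0 < e"
          obtain C where C: "C \<in> \<U>" "measure N (D - C) < e / 2" "measure N (C - D) < e / 2"
            using \<U>(3)[OF finN N(1), of D "e / 2"] e by auto
          have [measurable]: "C \<in> sets borel" using C(1) \<U>(2) by auto
          have le: "measure (\<kappa> s) D \<le> measure (\<kappa> s) (C \<inter> B) + measure (\<kappa> s) (B \<inter> (D - C))"
          proof -
            have "measure (\<kappa> s) D \<le> measure (\<kappa> s) ((C \<inter> B) \<union> (B \<inter> (D - C)))"
              using D fin[of "(C \<inter> B) \<union> (B \<inter> (D - C))"]
              by (intro measure_mono_fmeasurable) (auto simp: fmeasurable_def Int_Un_distrib Int_absorb1 Int_commute Int_left_commute)
            also have "\<dots> \<le> measure (\<kappa> s) (C \<inter> B) + measure (\<kappa> s) (B \<inter> (D - C))"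
              by (intro measure_Un_le) auto
            finally show ?thesis .
          qed
          have le': "measure (\<kappa>' s) (C \<inter> B) \<le> measure (\<kappa>' s) D + measure (\<kappa>' s) (B \<inter> (C - D))"
          proof -
            have "D \<union> (B \<inter> (C - D)) = B \<inter> (D \<union> C)" using D by blast
            then have "measure (\<kappa>' s) (C \<inter> B) \<le> measure (\<kappa>' s) (D \<union> (B \<inter> (C - D)))"
              using fin(2)[of "D \<union> C"] by (intro measure_mono_fmeasurable) (auto simp: fmeasurable_def)
            also have "\<dots> \<le> measure (\<kappa>' s) D + measure (\<kappa>' s) (B \<inter> (C - D))"
              by (intro measure_Un_le) auto
            finally show ?thesis .
          qed
          have "measure (\<kappa> s) (B \<inter> (D - C)) \<le> measure N (D - C)" "measure (\<kappa>' s) (B \<inter> (C - D)) \<le> measure N (C - D)"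
            by (simp_all add: mN)
          then have "levy_diff (\<kappa> s) (\<kappa>' s) D \<le> measure (\<kappa> s) (C \<inter> B) - measure (\<kappa>' s) (C \<inter> B) + e"
            using le le' C diff[OF D(1)] by linarith
          then have "ennreal (levy_diff (\<kappa> s) (\<kappa>' s) D)
              \<le> ?d s B C + ennreal e"
            using e by (intro order_trans[OF ennreal_leI ennreal_plus_le]) auto
          also have "\<dots> \<le> ?R + ennreal e"
            using C(1) by (intro add_right_mono SUP_upper)
          finally show "ennreal (levy_diff (\<kappa> s) (\<kappa>' s) D) \<le> ?R + ennreal e" .
        qed
      qed
    qed
  qed
  have off: "(\<lambda>s. emeasure (?q s) B) \<in> borel_measurable L" if r: "0 < r" and B: "B \<in> borel_off r" for r B
  proof -
    have [measurable]: "(\<lambda>s. measure (\<kappa> s) (C \<inter> B)) \<in> borel_measurable L"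
      "(\<lambda>s. measure (\<kappa>' s) (C \<inter> B)) \<in> borel_measurable L" if "C \<in> \<U>" for C
    proof -
      have "C \<inter> B \<in> sets borel" using that \<U>(2) B by (auto simp: borel_off_def)
      then show "(\<lambda>s. measure (\<kappa> s) (C \<inter> B)) \<in> borel_measurable L"
        "(\<lambda>s. measure (\<kappa>' s) (C \<inter> B)) \<in> borel_measurable L"
        using k(3) k'(3) unfolding measure_def by (auto intro!: borel_measurable_enn2real)
    qed
    have "(\<lambda>s. SUP C\<in>\<U>. ?d s B C) \<in> borel_measurable L"
      by (rule borel_measurable_SUP[OF \<U>(1)]) measurable
    then show ?thesis using SUP[OF _ r B] by (simp cong: measurable_cong)
  qed
  have "(\<lambda>s. emeasure (?q s) B) \<in> borel_measurable L" if B: "B \<in> sets borel" for B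
  proof -
    have "(\<lambda>s. SUP n. emeasure (?q s) (B - {- (1 / real (Suc n)) <..< 1 / real (Suc n)})) \<in> borel_measurable L"
      by (intro borel_measurable_SUP off[OF _ borel_off_remove_ball[OF B]]) auto
    moreover have "emeasure (?q s) B = (SUP n. emeasure (?q s) (B - {- (1 / real (Suc n)) <..< 1 / real (Suc n)}))"
      if "s \<in> space L" for s
      using levy[OF that] B by (intro emeasure_SUP_off_zero) (auto simp: levy_measure_def)
    ultimately show ?thesis by (simp cong: measurable_cong)
  qed
  with levy show ?thesis by (auto simp: levy_kernel_def)
qed

lemma levy_kernel_ql_neg:
  assumes \<kappa>: "levy_kernel L \<kappa>" and \<kappa>': "levy_kernel L \<kappa>'"
  shows "levy_kernel L (\<lambda>s. ql_neg (levy_diff (\<kappa> s) (\<kappa>' s)))"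
  using levy_kernel_ql_pos[OF \<kappa>' \<kappa>] levy_kernelD(1)[OF \<kappa>] levy_kernelD(1)[OF \<kappa>']
  unfolding levy_kernel_def by (simp add: ql_neg_levy_diff cong: measurable_cong)

section \<open>A gliding hump argument\<close>

text \<open>
  On the sets \<open>E k\<close>, where all \<open>g n\<close> are bounded by \<open>k\<close> and which have finite measure, integrals converge to \<open>0\<close> by dominated
  convergence; for fixed \<open>n\<close> the integral of \<open>\<bar>g n\<bar>\<close> outside \<open>E k\<close> is small for large \<open>k\<close>.  Hence one finds
  indices \<open>N j\<close> and disjoint blocks \<open>E (K (j + 1)) - E (K j)\<close> such that the integral of
  \<open>g (N (j + 1))\<close> over the \<open>j\<close>-th block is almost the full integral, and is almost \<open>0\<close> over each set fixed before.
  Let \<open>B\<close> be the union of the even blocks.  Along odd \<open>j\<close> the integral over \<open>B\<close>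
  is almost \<open>0\<close>, along even \<open>j\<close> it is almost the full integral.  Its exponential converges by hypothesis, so
  the limit is \<open>1\<close> and is also the limit for the full integral.

  The hypothesis is only on exponentials: the integrals themselves are known modulo \<open>2 \<pi> i\<close> only.
\<close>

lemma exp_integral_gliding_hump:
  fixes g :: "nat \<Rightarrow> 's \<Rightarrow> complex"
  assumes L: "sigma_finite_measure L" and int: "\<And>n. integrable L (g n)"
    and lim: "AE s in L. (\<lambda>n. g n s) \<longlonglongrightarrow> 0"
    and conv: "\<And>A. A \<in> sets L \<Longrightarrow> convergent (\<lambda>n. exp (LINT s:A|L. g n s))"
  shows "(\<lambda>n. exp (\<integral>s. g n s \<partial>L)) \<longlonglongrightarrow> 1"
proof -
  interpret sigma_finite_measure L by fact
  obtain W :: "nat \<Rightarrow> 's set" where W: "range W \<subseteq> sets L" "(\<Union>i. W i) = space L"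
    "\<And>i. emeasure L (W i) \<noteq> \<infinity>" "incseq W"
    using sigma_finite_incseq by blast
  have gm [measurable]: "g n \<in> borel_measurable L" for n using int by (rule borel_measurable_integrable)
  have Wm [measurable]: "W k \<in> sets L" for k using W(1) by auto
  define c where "c n A = (LINT s:A|L. g n s)" for n A
  define E where "E k = {s \<in> space L. s \<in> W k \<and> (\<forall>n. norm (g n s) \<le> real k)}" for k
  have Em [measurable]: "E k \<in> sets L" for k unfolding E_def by measurable
  have E_mono: "E k \<subseteq> E k'" if "k \<le> k'" for k k'
    using that incseqD[OF W(4) that] unfolding E_def by (auto intro: order_trans)
  have Esp: "E k \<subseteq> space L" for k unfolding E_def by auto
  define \<tau> where "\<tau> n k = (\<integral>s. indicator (space L - E k) s * norm (g n s) \<partial>L)" for n k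
  have sint: "set_integrable L A (g n)" if "A \<in> sets L" for A n
    using that int by (simp add: set_integrable_def integrable_mult_indicator)
  have add: "c n (A \<union> B) = c n A + c n B" if "A \<inter> B = {}" "A \<in> sets L" "B \<in> sets L" for n A B
    unfolding c_def using that sint by (intro set_integral_Un) auto
  have small: "(\<lambda>n. c n A) \<longlonglongrightarrow> 0" if [measurable]: "A \<in> sets L" and sub: "A \<subseteq> E k" for A k
  proof -
    have "(\<lambda>n. \<integral>s. indicator A s *\<^sub>R g n s \<partial>L) \<longlonglongrightarrow> (\<integral>s. 0 \<partial>L)"
    proof (rule integral_dominated_convergence[where w="\<lambda>s. indicator (W k) s * real k"])
      have "emeasure L (W k) < \<infinity>" using W(3)[of k] by (simp add: less_top)
      then show "integrable L (\<lambda>s. indicator (W k) s * real k)" by simp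
      show "AE s in L. (\<lambda>n. indicator A s *\<^sub>R g n s) \<longlonglongrightarrow> 0"
        using lim by eventually_elim (auto split: split_indicator)
      show "AE s in L. norm (indicator A s *\<^sub>R g n s) \<le> indicator (W k) s * real k" for n
        using sub by (intro AE_I2) (auto simp: E_def split: split_indicator)
    qed auto
    then show ?thesis by (simp add: c_def set_lebesgue_integral_def)
  qed
  have tail: "(\<lambda>k. \<tau> n k) \<longlonglongrightarrow> 0" for n
  proof -
    have "(\<lambda>k. \<integral>s. indicator (space L - E k) s * norm (g n s) \<partial>L) \<longlonglongrightarrow> (\<integral>s. 0 \<partial>L)"
    proof (rule integral_dominated_convergence[where w="\<lambda>s. norm (g n s)"])
      show "AE s in L. (\<lambda>k. indicator (space L - E k) s * norm (g n s)) \<longlonglongrightarrow> 0"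
        using lim AE_space
      proof eventually_elim
        fix s assume s: "(\<lambda>n. g n s) \<longlonglongrightarrow> 0" "s \<in> space L"
        obtain i where i: "s \<in> W i" using W(2) s(2) by blast
        have "Bseq (\<lambda>n. g n s)" using s(1) by (intro convergent_imp_Bseq) (auto simp: convergent_def)
        then obtain K where K: "\<And>n. norm (g n s) \<le> K" by (auto simp: Bseq_def)
        obtain j where j: "K \<le> real j" using real_arch_simple by blast
        have "s \<in> E k" if "max i j \<le> k" for k
        proof -
          have "s \<in> W k" using i incseqD[OF W(4), of i k] that by auto
          moreover have "norm (g n s) \<le> real k" for n
            using K[of n] j that by (meson max.bounded_iff of_nat_le_iff order_trans)
          ultimately show ?thesis using s(2) by (auto simp: E_def)
        qed
        then have "eventually (\<lambda>k. indicator (space L - E k) s * norm (g n s) = 0) sequentially"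
          unfolding eventually_sequentially by (intro exI[of _ "max i j"]) auto
        then show "(\<lambda>k. indicator (space L - E k) s * norm (g n s)) \<longlonglongrightarrow> 0"
          by (rule tendsto_eventually)
      qed
      show "AE s in L. norm (indicator (space L - E k) s * norm (g n s)) \<le> norm (g n s)" for k
        by (intro AE_I2) (auto split: split_indicator)
    qed (use int in auto)
    then show ?thesis by (simp add: \<tau>_def)
  qed
  have c_le: "norm (c n A) \<le> \<tau> n k" if [measurable]: "A \<in> sets L" and "A \<inter> E k = {}" for n A k
  proof -
    have "norm (c n A) \<le> (\<integral>s. norm (indicator A s *\<^sub>R g n s) \<partial>L)"
      unfolding c_def set_lebesgue_integral_def by (rule integral_norm_bound)
    also have "\<dots> \<le> \<tau> n k"
      unfolding \<tau>_def
    proof (rule integral_mono)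
      show "integrable L (\<lambda>s. norm (indicator A s *\<^sub>R g n s))"
        using sint[OF that(1), of n] by (simp add: set_integrable_def del: norm_scaleR)
      show "integrable L (\<lambda>s. indicator (space L - E k) s * norm (g n s))"
        using integrable_mult_indicator[OF _ integrable_norm[OF int[of n]], of "space L - E k"] by simp
      show "norm (indicator A s *\<^sub>R g n s) \<le> indicator (space L - E k) s * norm (g n s)" if "s \<in> space L" for s
        using that \<open>A \<inter> E k = {}\<close> by (auto split: split_indicator)
    qed
    finally show ?thesis .
  qed
  define \<delta> where "\<delta> j = inverse (real (Suc j))" for j
  have \<delta>: "0 < \<delta> j" for j by (simp add: \<delta>_def)
  \<comment> \<open>A state is an index, the level of the current \<open>E\<close>, and the part of \<open>B\<close> constructed so far.\<close>
  define Q where "Q j x y = (case x of (n, k, A) \<Rightarrow> case y of (n', k', A') \<Rightarrow>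
      n < n' \<and> k \<le> k' \<and> norm (c n' A) < \<delta> j \<and> norm (c n' (E k)) < \<delta> j \<and> \<tau> n' k' < \<delta> j \<and>
      A' = (if even j then A \<union> (E k' - E k) else A))" for j and x y :: "nat \<times> nat \<times> 's set"
  define R where "R x = (case x of (n, k, A) \<Rightarrow> A \<in> sets L \<and> A \<subseteq> E k)" for x :: "nat \<times> nat \<times> 's set"
  have "\<exists>F. \<forall>j. R (F j) \<and> Q j (F j) (F (Suc j))"
  proof (rule dependent_nat_choice[where P="\<lambda>_. R" and Q=Q])
    show "\<exists>x. R x" by (intro exI[of _ "(0, 0, {})"]) (auto simp: R_def)
    fix x :: "nat \<times> nat \<times> 's set" and j
    assume x: "R x"
    obtain n k A where xeq: "x = (n, k, A)" by (cases x)
    with x have A: "A \<in> sets L" "A \<subseteq> E k" by (auto simp: R_def)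
    have "eventually (\<lambda>n'. norm (c n' A) < \<delta> j) sequentially" "eventually (\<lambda>n'. norm (c n' (E k)) < \<delta> j) sequentially"
      using tendstoD[OF small[OF A] \<delta>[of j]] tendstoD[OF small[OF Em order_refl] \<delta>[of j]]
      by (auto simp: dist_norm)
    then have "eventually (\<lambda>n'. n < n' \<and> norm (c n' A) < \<delta> j \<and> norm (c n' (E k)) < \<delta> j) sequentially"
      using eventually_gt_at_top[of n] by eventually_elim auto
    then obtain n' where n': "n < n'" "norm (c n' A) < \<delta> j" "norm (c n' (E k)) < \<delta> j"
      by (auto simp: eventually_sequentially)
    have "eventually (\<lambda>k'. \<tau> n' k' < \<delta> j) sequentially"
      using order_tendstoD(2)[OF tail \<delta>[of j]] .
    then have "eventually (\<lambda>k'. k \<le> k' \<and> \<tau> n' k' < \<delta> j) sequentially"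
      using eventually_ge_at_top[of k] by eventually_elim auto
    then obtain k' where k': "k \<le> k'" "\<tau> n' k' < \<delta> j"
      by (auto simp: eventually_sequentially)
    let ?A = "if even j then A \<union> (E k' - E k) else A"
    have "?A \<in> sets L" "?A \<subseteq> E k'" using A E_mono[OF k'(1)] by auto
    then show "\<exists>y. R y \<and> Q j x y"
      unfolding xeq Q_def R_def using n' k' by (intro exI[of _ "(n', k', ?A)"]) auto
  qed
  then obtain F where F: "\<And>j. R (F j)" "\<And>j. Q j (F j) (F (Suc j))"
    by blast
  define N where "N j = fst (F j)" for j
  define K where "K j = fst (snd (F j))" for j
  define A where "A j = snd (snd (F j))" for j
  have Feq: "F j = (N j, K j, A j)" for j by (simp add: N_def K_def A_def)
  have A [measurable]: "A j \<in> sets L" and AE: "A j \<subseteq> E (K j)" for j using F(1)[of j] by (auto simp: Feq R_def)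
  have step: "N j < N (Suc j)" "K j \<le> K (Suc j)" "norm (c (N (Suc j)) (A j)) < \<delta> j"
    "norm (c (N (Suc j)) (E (K j))) < \<delta> j" "\<tau> (N (Suc j)) (K (Suc j)) < \<delta> j"
    "A (Suc j) = (if even j then A j \<union> (E (K (Suc j)) - E (K j)) else A j)" for j
    using F(2)[of j] by (auto simp: Feq Q_def)
  define B where "B = (\<Union>j. A j)"
  have [measurable]: "B \<in> sets L" by (simp add: B_def)
  have "incseq K" using step(2) by (rule incseq_SucI)
  have A_mono: "incseq A" using step(6) by (intro incseq_SucI) auto
  have A_inter: "A i \<inter> E (K j) \<subseteq> A j" if "j \<le> i" for i j
    using that
  proof (induction i rule: dec_induct)
    case (step i)
    have "E (K j) \<subseteq> E (K i)" using step(1) incseqD[OF \<open>incseq K\<close>] by (intro E_mono) auto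
    then show ?case using step(3) \<open>A (Suc i) = (if even i then A i \<union> (E (K (Suc i)) - E (K i)) else A i)\<close>
      by (auto split: if_splits)
  qed auto
  \<comment> \<open>Later blocks do not change \<open>B\<close> inside \<open>E (K j)\<close>.\<close>
  have BE: "B \<inter> E (K j) = A j" for j
  proof
    show "A j \<subseteq> B \<inter> E (K j)" using AE by (auto simp: B_def)
    show "B \<inter> E (K j) \<subseteq> A j"
    proof
      fix s assume "s \<in> B \<inter> E (K j)"
      then obtain i where "s \<in> A i" "s \<in> E (K j)" by (auto simp: B_def)
      then have "s \<in> A (max i j)" using incseqD[OF A_mono, of i "max i j"] by auto
      then show "s \<in> A j" using A_inter[of j "max i j"] \<open>s \<in> E (K j)\<close> by auto
    qed
  qed
  have B_split: "c n B = c n (A j) + c n (B - E (K j))" for n j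
  proof -
    have "c n (A j \<union> (B - E (K j))) = c n (A j) + c n (B - E (K j))"
      using AE[of j] by (intro add) auto
    moreover have "A j \<union> (B - E (K j)) = B" using BE[of j] by blast
    ultimately show ?thesis by simp
  qed
  have rest: "norm (c (N (Suc j)) (B - E (K (Suc j)))) < \<delta> j" for j
    using order_le_less_trans[OF c_le[of "B - E (K (Suc j))" "K (Suc j)" "N (Suc j)"] step(5)[of j]]
    by (simp add: Diff_disjoint Int_commute)
  have odd: "norm (c (N (Suc j)) B) < 2 * \<delta> j" if "odd j" for j
  proof -
    have "c (N (Suc j)) B = c (N (Suc j)) (A j) + c (N (Suc j)) (B - E (K (Suc j)))"
      using B_split[of _ "Suc j"] step(6)[of j] that by simp
    then show ?thesis
      using norm_triangle_ineq[of "c (N (Suc j)) (A j)" "c (N (Suc j)) (B - E (K (Suc j)))"]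
        step(3)[of j] rest[of j] by simp
  qed
  have even: "norm (c (N (Suc j)) B - c (N (Suc j)) (space L)) < 4 * \<delta> j" if "even j" for j
  proof -
    let ?n = "N (Suc j)" and ?E = "E (K (Suc j))"
    have "A (Suc j) = A j \<union> (?E - E (K j))" using step(6)[of j] that by simp
    then have 1: "c ?n (A (Suc j)) = c ?n (A j) + c ?n (?E - E (K j))"
      using AE[of j] by (simp only:) (intro add, auto)
    have 2: "c ?n ?E = c ?n (E (K j)) + c ?n (?E - E (K j))"
    proof -
      have "?E = E (K j) \<union> (?E - E (K j))" using E_mono[OF step(2)] by blast
      then show ?thesis using add[of "E (K j)" "?E - E (K j)" ?n] by auto
    qed
    have 3: "c ?n (space L) = c ?n ?E + c ?n (space L - ?E)"
    proof -
      have "space L = ?E \<union> (space L - ?E)" using Esp by blast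
      then show ?thesis using add[of ?E "space L - ?E" ?n] by auto
    qed
    have 4: "norm (c ?n (space L - ?E)) < \<delta> j"
      using order_le_less_trans[OF c_le[of "space L - ?E" "K (Suc j)" ?n] step(5)[of j]]
      by (simp add: Diff_disjoint Int_commute)
    have "c ?n B - c ?n (space L) = c ?n (A j) - c ?n (E (K j)) + (c ?n (B - ?E) - c ?n (space L - ?E))"
      using B_split[of ?n "Suc j"] 1 2 3 by simp
    also have "norm \<dots> \<le> norm (c ?n (A j)) + norm (c ?n (E (K j))) + (norm (c ?n (B - ?E)) + norm (c ?n (space L - ?E)))"
      by (intro order_trans[OF norm_triangle_ineq] add_mono norm_triangle_ineq4)
    also have "\<dots> < 4 * \<delta> j" using step(3)[of j] step(4)[of j] rest[of j] 4 by simp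
    finally show ?thesis .
  qed
  have \<delta>_lim: "\<delta> \<longlonglongrightarrow> 0" unfolding \<delta>_def by (rule LIMSEQ_inverse_real_of_nat)
  have sm: "strict_mono N" using step(1) by (simp add: strict_mono_Suc_iff)
  obtain l where l: "(\<lambda>n. exp (c n B)) \<longlonglongrightarrow> l" using conv[of B] by (auto simp: convergent_def c_def)
  obtain l' where l': "(\<lambda>n. exp (c n (space L))) \<longlonglongrightarrow> l'" using conv[of "space L"] by (auto simp: convergent_def c_def)
  have so: "strict_mono (\<lambda>i. N (Suc (2 * i + 1)))" and se: "strict_mono (\<lambda>i. N (Suc (2 * i)))"
    using sm by (auto simp: strict_mono_def)
  have dl: "(\<lambda>i. \<delta> (2 * i + 1)) \<longlonglongrightarrow> 0" "(\<lambda>i. \<delta> (2 * i)) \<longlonglongrightarrow> 0"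
    using LIMSEQ_subseq_LIMSEQ[OF \<delta>_lim, of "\<lambda>i. 2 * i + 1"] LIMSEQ_subseq_LIMSEQ[OF \<delta>_lim, of "\<lambda>i. 2 * i"]
    by (auto simp: strict_mono_def o_def)
  have "(\<lambda>i. c (N (Suc (2 * i + 1))) B) \<longlonglongrightarrow> 0"
    by (rule Lim_null_comparison[OF _ tendsto_mult_right_zero[OF dl(1), of 2]])
      (auto intro!: always_eventually less_imp_le[OF odd])
  then have "(\<lambda>i. exp (c (N (Suc (2 * i + 1))) B)) \<longlonglongrightarrow> exp 0" by (rule tendsto_exp)
  moreover have "(\<lambda>i. exp (c (N (Suc (2 * i + 1))) B)) \<longlonglongrightarrow> l"
    using LIMSEQ_subseq_LIMSEQ[OF l so] by (simp add: o_def)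
  ultimately have l1: "l = 1" using LIMSEQ_unique by fastforce
  have "(\<lambda>i. c (N (Suc (2 * i))) B - c (N (Suc (2 * i))) (space L)) \<longlonglongrightarrow> 0"
    by (rule Lim_null_comparison[OF _ tendsto_mult_right_zero[OF dl(2), of 4]])
      (auto intro!: always_eventually less_imp_le[OF even])
  then have "(\<lambda>i. exp (c (N (Suc (2 * i))) B - c (N (Suc (2 * i))) (space L))) \<longlonglongrightarrow> exp 0"
    by (rule tendsto_exp)
  then have e1: "(\<lambda>i. exp (c (N (Suc (2 * i))) B - c (N (Suc (2 * i))) (space L))) \<longlonglongrightarrow> 1" by simp
  have e2: "(\<lambda>i. exp (c (N (Suc (2 * i))) B)) \<longlonglongrightarrow> 1"
    using LIMSEQ_subseq_LIMSEQ[OF l se] l1 by (simp add: o_def)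
  have "(\<lambda>i. exp (c (N (Suc (2 * i))) B) / exp (c (N (Suc (2 * i))) B - c (N (Suc (2 * i))) (space L))) \<longlonglongrightarrow> 1 / 1"
    by (rule tendsto_divide[OF e2 e1]) simp
  then have "(\<lambda>i. exp (c (N (Suc (2 * i))) (space L))) \<longlonglongrightarrow> 1"
    by (simp add: exp_diff)
  moreover have "(\<lambda>i. exp (c (N (Suc (2 * i))) (space L))) \<longlonglongrightarrow> l'"
    using LIMSEQ_subseq_LIMSEQ[OF l' se] by (simp add: o_def)
  ultimately have "l' = 1" using LIMSEQ_unique by blast
  moreover have "c n (space L) = (\<integral>s. g n s \<partial>L)" for n
    unfolding c_def by (rule set_integral_space) (use int in auto)
  ultimately show ?thesis using l' by simp
qed

section \<open>Convergence in probability and characteristic functions\<close>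

lemma char_distr_eq:
  "X \<in> borel_measurable P \<Longrightarrow> char (distr P borel X) \<theta> = (\<integral>\<omega>. iexp (\<theta> * X \<omega>) \<partial>P)"
  unfolding char_def by (subst integral_distr) auto

lemma norm_iexp_diff_le: "norm (iexp a - iexp b) \<le> \<bar>a - b\<bar>"
proof -
  have "iexp a - iexp b = iexp b * (iexp (a - b) - 1)"
    by (simp add: algebra_simps flip: exp_add)
  then have "norm (iexp a - iexp b) = norm (iexp (a - b) - 1)" by (simp add: norm_mult)
  also have "\<dots> \<le> \<bar>a - b\<bar>" using iexp_approx1[of "a - b" 0] by simp
  finally show ?thesis .
qed

abbreviation prob_far :: "'w measure \<Rightarrow> real \<Rightarrow> ('w \<Rightarrow> real) \<Rightarrow> ('w \<Rightarrow> real) \<Rightarrow> real" where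
  "prob_far P \<epsilon> X Y \<equiv> measure P {\<omega> \<in> space P. \<epsilon> < \<bar>X \<omega> - Y \<omega>\<bar>}"

lemma tendsto_in_prob_char:
  assumes P: "prob_space P" and [measurable]: "\<And>n. X n \<in> borel_measurable P"
    and lim: "tendsto_in_prob P X Y"
  shows "(\<lambda>n. char (distr P borel (X n)) \<theta>) \<longlonglongrightarrow> char (distr P borel Y) \<theta>"
proof (rule LIMSEQ_I)
  interpret prob_space P by fact
  have [measurable]: "Y \<in> borel_measurable P" using lim by (simp add: tendsto_in_prob_def)
  fix r :: real assume r: "0 < r"
  define \<epsilon> where "\<epsilon> = r / (2 * (\<bar>\<theta>\<bar> + 1))"
  have \<epsilon>: "0 < \<epsilon>" using r by (simp add: \<epsilon>_def)
  have \<epsilon>': "\<bar>\<theta>\<bar> * \<epsilon> \<le> r / 2"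
  proof -
    have "\<bar>\<theta>\<bar> * \<epsilon> \<le> (\<bar>\<theta>\<bar> + 1) * \<epsilon>" using \<epsilon> by simp
    also have "\<dots> = r / 2" by (simp add: \<epsilon>_def field_simps)
    finally show ?thesis .
  qed
  have bound: "norm (char (distr P borel (X n)) \<theta> - char (distr P borel Y) \<theta>)
      \<le> r / 2 + 2 * prob_far P \<epsilon> (X n) Y" for n
  proof -
    let ?A = "{\<omega> \<in> space P. \<epsilon> < \<bar>X n \<omega> - Y \<omega>\<bar>}"
    have iX: "integrable P (\<lambda>\<omega>. iexp (\<theta> * X n \<omega>))" and iY: "integrable P (\<lambda>\<omega>. iexp (\<theta> * Y \<omega>))"
      by (auto intro!: integrable_const_bound[where B=1])
    have "norm (char (distr P borel (X n)) \<theta> - char (distr P borel Y) \<theta>)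
        = norm (\<integral>\<omega>. iexp (\<theta> * X n \<omega>) - iexp (\<theta> * Y \<omega>) \<partial>P)"
      using iX iY by (simp add: char_distr_eq)
    also have "\<dots> \<le> (\<integral>\<omega>. norm (iexp (\<theta> * X n \<omega>) - iexp (\<theta> * Y \<omega>)) \<partial>P)"
      by (rule integral_norm_bound)
    also have "\<dots> \<le> (\<integral>\<omega>. r / 2 + 2 * indicator ?A \<omega> \<partial>P)"
    proof (rule integral_mono)
      fix \<omega> assume \<omega>: "\<omega> \<in> space P"
      show "norm (iexp (\<theta> * X n \<omega>) - iexp (\<theta> * Y \<omega>)) \<le> r / 2 + 2 * indicator ?A \<omega>"
      proof (cases "\<omega> \<in> ?A")
        case True
        have "norm (iexp (\<theta> * X n \<omega>) - iexp (\<theta> * Y \<omega>)) \<le> norm (iexp (\<theta> * X n \<omega>)) + norm (iexp (\<theta> * Y \<omega>))"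
          by (rule norm_triangle_ineq4)
        then show ?thesis using True r by simp
      next
        case False
        then have "\<bar>\<theta>\<bar> * \<bar>X n \<omega> - Y \<omega>\<bar> \<le> \<bar>\<theta>\<bar> * \<epsilon>" using \<omega> by (intro mult_left_mono) auto
        then show ?thesis
          using False \<epsilon>' norm_iexp_diff_le[of "\<theta> * X n \<omega>" "\<theta> * Y \<omega>"]
          by (simp add: abs_mult flip: right_diff_distrib)
      qed
    next
      show "integrable P (\<lambda>\<omega>. norm (iexp (\<theta> * X n \<omega>) - iexp (\<theta> * Y \<omega>)))"
        using iX iY by (intro integrable_norm Bochner_Integration.integrable_diff)
      show "integrable P (\<lambda>\<omega>. r / 2 + 2 * indicator ?A \<omega>)"
        by (intro Bochner_Integration.integrable_add integrable_mult_right integrable_real_indicator)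
          (auto simp: emeasure_finite less_top[symmetric])
    qed
    also have "\<dots> = r / 2 + 2 * prob ?A"
    proof -
      have "integrable P (\<lambda>\<omega>. 2 * indicator ?A \<omega> :: real)"
        by (intro integrable_mult_right integrable_real_indicator)
          (auto simp: emeasure_finite less_top[symmetric])
      then show ?thesis by (subst Bochner_Integration.integral_add) (simp_all add: prob_space)
    qed
    finally show ?thesis .
  qed
  have "(\<lambda>n. prob_far P \<epsilon> (X n) Y) \<longlonglongrightarrow> 0"
    using lim \<epsilon> by (simp add: tendsto_in_prob_def)
  then have "eventually (\<lambda>n. prob_far P \<epsilon> (X n) Y < r / 4) sequentially"
    by (rule order_tendstoD) (use r in simp)
  then obtain n0 where n0: "\<And>n. n \<ge> n0 \<Longrightarrow> prob_far P \<epsilon> (X n) Y < r / 4"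
    by (auto simp: eventually_sequentially)
  show "\<exists>no. \<forall>n\<ge>no. norm (char (distr P borel (X n)) \<theta> - char (distr P borel Y) \<theta>) < r"
  proof (intro exI[of _ n0] allI impI)
    fix n assume "n0 \<le> n"
    then show "norm (char (distr P borel (X n)) \<theta> - char (distr P borel Y) \<theta>) < r"
      using bound[of n] n0[of n] by linarith
  qed
qed

text \<open>
  By the Levy continuity theorem the laws converge weakly to the point mass at \<open>0\<close>, which does not
  charge the boundary of \<open>{x. \<epsilon> < \<bar>x\<bar>}\<close>.
\<close>

lemma char_tendsto_1_imp_prob_tendsto_0:
  assumes P: "prob_space P" and [measurable]: "\<And>n. X n \<in> borel_measurable P"
    and lim: "\<And>\<theta>. (\<lambda>n. char (distr P borel (X n)) \<theta>) \<longlonglongrightarrow> 1" and \<epsilon>: "0 < \<epsilon>"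
  shows "(\<lambda>n. measure P {\<omega> \<in> space P. \<epsilon> < \<bar>X n \<omega>\<bar>}) \<longlonglongrightarrow> 0"
proof -
  interpret prob_space P by fact
  have d: "real_distribution (distr P borel (X n))" for n by (rule real_distribution_distr) measurable
  have r: "real_distribution (return borel (0::real))"
    by (auto simp: real_distribution_def real_distribution_axioms_def prob_space_return)
  have "char (return borel 0) \<theta> = 1" for \<theta> :: real
    unfolding char_def by (subst integral_return) auto
  then have w: "weak_conv_m (\<lambda>n. distr P borel (X n)) (return borel 0)"
    using lim by (intro levy_continuity[OF d r]) simp
  let ?A = "{x::real. \<epsilon> < \<bar>x\<bar>}"
  have "closure ?A \<subseteq> {x. \<epsilon> \<le> \<bar>x\<bar>}"
    by (intro closure_minimal) (auto intro!: closed_Collect_le continuous_intros)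
  then have "0 \<notin> frontier ?A" using \<epsilon> by (auto simp: frontier_def)
  then have "emeasure (return borel 0) (frontier ?A) = 0" by simp
  moreover have "?A \<in> sets borel" by measurable
  ultimately have "(\<lambda>n. measure (distr P borel (X n)) ?A) \<longlonglongrightarrow> measure (return borel 0) ?A"
    by (intro weak_conv_imp_continuity_set_conv[OF d r w]) auto
  then show ?thesis using \<epsilon>
    by (simp add: measure_distr vimage_def Int_def measure_return conj_commute)
qed

text \<open>
  By the Borel--Cantelli lemma, a subsequence whose \<open>k\<close>-th step exceeds \<open>2\<^sup>-\<^sup>k\<close> with probability at most \<open>2\<^sup>-\<^sup>k\<close>
  converges almost surely; the Cauchy condition carries the whole sequence along.
\<close>

lemma cauchy_in_prob_imp_tendsto_in_prob:
  assumes P: "prob_space P" and [measurable]: "\<And>n. X n \<in> borel_measurable P"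
    and cauchy: "\<And>\<epsilon> \<delta>. 0 < \<epsilon> \<Longrightarrow> 0 < \<delta> \<Longrightarrow>
      \<exists>N. \<forall>m\<ge>N. \<forall>n\<ge>N. prob_far P \<epsilon> (X m) (X n) < \<delta>"
  shows "\<exists>Y. tendsto_in_prob P X Y"
proof -
  interpret prob_space P by fact
  have "\<exists>r::nat \<Rightarrow> nat. \<forall>k. (\<forall>m\<ge>r k. \<forall>n\<ge>r k. prob_far P ((1/2)^k) (X m) (X n) < (1/2)^k) \<and> r k \<le> r (Suc k) \<and> k \<le> r k"
  proof -
    have "\<exists>N. \<forall>m\<ge>N. \<forall>n\<ge>N. prob_far P ((1/2)^k) (X m) (X n) < (1/2)^k" for k
      by (rule cauchy) auto
    then obtain N where N: "\<And>k m n. m \<ge> N k \<Longrightarrow> n \<ge> N k \<Longrightarrow> prob_far P ((1/2)^k) (X m) (X n) < (1/2)^k"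
      by metis
    define r where "r k = (\<Sum>i\<le>k. N i) + k" for k
    have "N k \<le> r k" for k unfolding r_def by (intro trans_le_add1 member_le_sum) auto
    then have "\<forall>m\<ge>r k. \<forall>n\<ge>r k. prob_far P ((1/2)^k) (X m) (X n) < (1/2)^k" for k
      using N order_trans by blast
    moreover have "r k \<le> r (Suc k)" "k \<le> r k" for k by (simp_all add: r_def)
    ultimately show ?thesis by blast
  qed
  then obtain r :: "nat \<Rightarrow> nat" where
    r: "\<And>k m n. m \<ge> r k \<Longrightarrow> n \<ge> r k \<Longrightarrow> prob_far P ((1/2)^k) (X m) (X n) < (1/2)^k"
    and rS: "\<And>k. r k \<le> r (Suc k)" and rk: "\<And>k. k \<le> r k"
    by blast
  define A where "A k = {\<omega> \<in> space P. (1/2)^k < \<bar>X (r (Suc k)) \<omega> - X (r k) \<omega>\<bar>}" for k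
  have [measurable]: "A k \<in> sets P" for k unfolding A_def by measurable
  have pA: "prob (A k) \<le> (1/2)^k" for k unfolding A_def using r[of k "r (Suc k)" "r k"] rS[of k] by simp
  have "summable (\<lambda>k. prob (A k))"
    by (rule summable_comparison_test'[of "\<lambda>k. (1/2)^k" 0]) (use pA in \<open>auto intro!: summable_geometric\<close>)
  then have bc: "AE \<omega> in P. eventually (\<lambda>k. \<omega> \<in> space P - A k) sequentially"
    by (intro borel_cantelli_AE1) (auto simp: emeasure_finite less_top[symmetric])
  define Y where "Y \<omega> = lim (\<lambda>k. X (r k) \<omega>)" for \<omega>
  have [measurable]: "Y \<in> borel_measurable P" unfolding Y_def[abs_def] by measurable
  have ae: "AE \<omega> in P. (\<lambda>k. X (r k) \<omega>) \<longlonglongrightarrow> Y \<omega>"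
    using bc
  proof eventually_elim
    fix \<omega> assume "eventually (\<lambda>k. \<omega> \<in> space P - A k) sequentially"
    then obtain k0 where k0: "\<And>k. k \<ge> k0 \<Longrightarrow> \<omega> \<in> space P - A k" by (auto simp: eventually_sequentially)
    have "summable (\<lambda>k. X (r (Suc k)) \<omega> - X (r k) \<omega>)"
    proof (rule summable_comparison_test'[of "\<lambda>k. (1/2)^k" k0])
      show "norm (X (r (Suc k)) \<omega> - X (r k) \<omega>) \<le> (1/2)^k" if "k0 \<le> k" for k
        using k0[OF that] by (auto simp: A_def)
    qed (auto intro!: summable_geometric)
    then have "(\<lambda>n. \<Sum>k<n. X (r (Suc k)) \<omega> - X (r k) \<omega>) \<longlonglongrightarrow> (\<Sum>k. X (r (Suc k)) \<omega> - X (r k) \<omega>)"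
      by (rule summable_LIMSEQ)
    then have "(\<lambda>n. X (r n) \<omega> - X (r 0) \<omega>) \<longlonglongrightarrow> (\<Sum>k. X (r (Suc k)) \<omega> - X (r k) \<omega>)"
      by (simp only: sum_lessThan_telescope[of "\<lambda>k. X (r k) \<omega>"])
    then have "(\<lambda>n. X (r n) \<omega> - X (r 0) \<omega> + X (r 0) \<omega>) \<longlonglongrightarrow> (\<Sum>k. X (r (Suc k)) \<omega> - X (r k) \<omega>) + X (r 0) \<omega>"
      by (rule tendsto_add) simp
    then have "convergent (\<lambda>n. X (r n) \<omega>)" by (auto simp: convergent_def)
    then show "(\<lambda>k. X (r k) \<omega>) \<longlonglongrightarrow> Y \<omega>" by (simp add: Y_def convergent_LIMSEQ_iff)
  qed
  have sub: "(\<lambda>k. prob_far P \<epsilon> (X (r k)) Y) \<longlonglongrightarrow> 0" if \<epsilon>: "0 < \<epsilon>" for \<epsilon>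
  proof -
    have "(\<lambda>k. \<integral>\<omega>. indicator {\<omega> \<in> space P. \<epsilon> < \<bar>X (r k) \<omega> - Y \<omega>\<bar>} \<omega> \<partial>P) \<longlonglongrightarrow> (\<integral>\<omega>. (0::real) \<partial>P)"
    proof (rule integral_dominated_convergence[where w="\<lambda>_. 1"])
      show "AE \<omega> in P. (\<lambda>k. indicator {\<omega> \<in> space P. \<epsilon> < \<bar>X (r k) \<omega> - Y \<omega>\<bar>} \<omega> :: real) \<longlonglongrightarrow> 0"
        using ae
      proof eventually_elim
        fix \<omega> assume "(\<lambda>k. X (r k) \<omega>) \<longlonglongrightarrow> Y \<omega>"
        then have "eventually (\<lambda>k. dist (X (r k) \<omega>) (Y \<omega>) < \<epsilon>) sequentially" using \<epsilon> by (rule tendstoD)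
        then have "eventually (\<lambda>k. indicator {\<omega> \<in> space P. \<epsilon> < \<bar>X (r k) \<omega> - Y \<omega>\<bar>} \<omega> = (0::real)) sequentially"
          by eventually_elim (auto simp: dist_real_def)
        then show "(\<lambda>k. indicator {\<omega> \<in> space P. \<epsilon> < \<bar>X (r k) \<omega> - Y \<omega>\<bar>} \<omega> :: real) \<longlonglongrightarrow> 0"
          by (rule tendsto_eventually)
      qed
    qed (auto split: split_indicator)
    then show ?thesis by simp
  qed
  have "(\<lambda>n. prob_far P \<epsilon> (X n) Y) \<longlonglongrightarrow> 0" if \<epsilon>: "0 < \<epsilon>" for \<epsilon>
  proof (rule LIMSEQ_I)
    fix d :: real assume d: "0 < d"
    obtain N where N: "\<And>m n. m \<ge> N \<Longrightarrow> n \<ge> N \<Longrightarrow> prob_far P (\<epsilon> / 2) (X m) (X n) < d / 2"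
      using cauchy[of "\<epsilon> / 2" "d / 2"] \<epsilon> d by auto
    have "eventually (\<lambda>k. prob_far P (\<epsilon> / 2) (X (r k)) Y < d / 2) sequentially"
      using sub[of "\<epsilon> / 2"] \<epsilon> d by (intro order_tendstoD(2)[of _ 0]) auto
    then have "eventually (\<lambda>k. N \<le> k \<and> prob_far P (\<epsilon> / 2) (X (r k)) Y < d / 2) sequentially"
      using eventually_ge_at_top[of N] by eventually_elim auto
    then obtain k where k: "N \<le> k" "prob_far P (\<epsilon> / 2) (X (r k)) Y < d / 2"
      by (auto simp: eventually_sequentially)
    have "prob_far P \<epsilon> (X n) Y < d" if n: "n \<ge> N" for n
    proof -
      have "prob_far P \<epsilon> (X n) Y
          \<le> prob ({\<omega> \<in> space P. \<epsilon> / 2 < \<bar>X n \<omega> - X (r k) \<omega>\<bar>} \<union> {\<omega> \<in> space P. \<epsilon> / 2 < \<bar>X (r k) \<omega> - Y \<omega>\<bar>})"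
      proof (rule finite_measure_mono, rule subsetI)
        fix \<omega> assume "\<omega> \<in> {\<omega> \<in> space P. \<epsilon> < \<bar>X n \<omega> - Y \<omega>\<bar>}"
        moreover have "\<epsilon> / 2 < \<bar>X n \<omega> - X (r k) \<omega>\<bar> \<or> \<epsilon> / 2 < \<bar>X (r k) \<omega> - Y \<omega>\<bar>"
          if "\<epsilon> < \<bar>X n \<omega> - Y \<omega>\<bar>" using that by linarith
        ultimately show "\<omega> \<in> {\<omega> \<in> space P. \<epsilon> / 2 < \<bar>X n \<omega> - X (r k) \<omega>\<bar>} \<union> {\<omega> \<in> space P. \<epsilon> / 2 < \<bar>X (r k) \<omega> - Y \<omega>\<bar>}"
          by auto
      qed measurable
      also have "\<dots> \<le> prob_far P (\<epsilon> / 2) (X n) (X (r k)) + prob_far P (\<epsilon> / 2) (X (r k)) Y"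
        by (rule measure_Un_le) auto
      also have "\<dots> < d / 2 + d / 2"
        using N[of n "r k"] n k rk[of k] by (intro add_strict_mono) auto
      finally show ?thesis by simp
    qed
    then show "\<exists>no. \<forall>n\<ge>no. norm (prob_far P \<epsilon> (X n) Y - 0) < d"
      by (intro exI[of _ N]) auto
  qed
  then show ?thesis by (intro exI[of _ Y]) (simp add: tendsto_in_prob_def)
qed

text \<open>
  The Cauchy property is expressed through pairs of index sequences that tend to infinity, so that it can be verified
  by dominated convergence along sequences.
\<close>

lemma char_cauchy_imp_tendsto_in_prob:
  assumes P: "prob_space P" and [measurable]: "\<And>n. X n \<in> borel_measurable P"
    and lim: "\<And>p q \<theta>. (\<And>j. j \<le> p j) \<Longrightarrow> (\<And>j. j \<le> q j) \<Longrightarrow>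
      (\<lambda>j. char (distr P borel (\<lambda>\<omega>. X (p j) \<omega> - X (q j) \<omega>)) \<theta>) \<longlonglongrightarrow> 1"
  shows "\<exists>Y. tendsto_in_prob P X Y"
proof (rule cauchy_in_prob_imp_tendsto_in_prob[OF P])
  fix \<epsilon> \<delta> :: real assume \<epsilon>: "0 < \<epsilon>" and \<delta>: "0 < \<delta>"
  show "\<exists>N. \<forall>m\<ge>N. \<forall>n\<ge>N. prob_far P \<epsilon> (X m) (X n) < \<delta>"
  proof (rule ccontr)
    assume "\<nexists>N. \<forall>m\<ge>N. \<forall>n\<ge>N. prob_far P \<epsilon> (X m) (X n) < \<delta>"
    then have "\<forall>N. \<exists>m n. N \<le> m \<and> N \<le> n \<and> \<delta> \<le> prob_far P \<epsilon> (X m) (X n)"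
      by (meson not_le)
    then obtain p q where pq: "\<And>j. j \<le> p j" "\<And>j. j \<le> q j"
      "\<And>j. \<delta> \<le> prob_far P \<epsilon> (X (p j)) (X (q j))"
      by metis
    have "(\<lambda>j. prob_far P \<epsilon> (X (p j)) (X (q j))) \<longlonglongrightarrow> 0"
      by (rule char_tendsto_1_imp_prob_tendsto_0[OF P _ lim[OF pq(1,2)] \<epsilon>]) measurable
    then have "eventually (\<lambda>j. prob_far P \<epsilon> (X (p j)) (X (q j)) < \<delta>) sequentially"
      using \<delta> by (rule order_tendstoD)
    then show False using pq(3) by (auto simp: eventually_sequentially not_le[symmetric])
  qed
qed measurable

section \<open>The cumulant function and its majorant\<close>

definition cumulant_kernel :: "real \<Rightarrow> real \<Rightarrow> complex" where
  "cumulant_kernel u x = iexp (u * x) - 1 - \<i> * of_real (u * trunc x)"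

lemma cumulant_kernel_measurable [measurable]:
  assumes [measurable]: "u \<in> borel_measurable N" "x \<in> borel_measurable N"
  shows "(\<lambda>s. cumulant_kernel (u s) (x s)) \<in> borel_measurable N"
  unfolding cumulant_kernel_def by measurable

lemma cumulant_kernel_0 [simp]: "cumulant_kernel 0 x = 0"
  by (simp add: cumulant_kernel_def)

text \<open>
  Compensating at scale \<open>u x\<close> instead of \<open>x\<close> costs exactly the integrand of \<open>U_fun\<close>; this is where the drift of the
  integral comes from.
\<close>

lemma cumulant_kernel_mult:
  "cumulant_kernel (c * u) x = cumulant_kernel c (u * x) + \<i> * of_real (c * (trunc (x * u) - u * trunc x))"
  by (simp add: cumulant_kernel_def algebra_simps)

definition cumulant_bound :: "real \<Rightarrow> real" where
  "cumulant_bound c = 3 * (1 + c\<^sup>2) + trunc_bound c"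

lemma cumulant_bound_nonneg: "0 \<le> cumulant_bound c"
  by (simp add: cumulant_bound_def trunc_bound_def)

lemma cumulant_bound_mono: "\<bar>c\<bar> \<le> C \<Longrightarrow> cumulant_bound c \<le> cumulant_bound C"
proof -
  assume c: "\<bar>c\<bar> \<le> C"
  then have "c\<^sup>2 \<le> C\<^sup>2" using abs_le_square_iff[of c C] by linarith
  moreover from this c have "(1 + \<bar>c\<bar>) * (1 + c\<^sup>2) \<le> (1 + \<bar>C\<bar>) * (1 + C\<^sup>2)"
    by (intro mult_mono) auto
  ultimately show ?thesis by (simp add: cumulant_bound_def trunc_bound_def)
qed

lemma norm_cumulant_kernel_le: "norm (cumulant_kernel c y) \<le> cumulant_bound c * wt y"
proof -
  have "cumulant_kernel c y = (iexp (c * y) - 1 - \<i> * of_real (trunc (c * y))) + \<i> * of_real (trunc (c * y) - c * trunc y)"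
    by (simp add: cumulant_kernel_def algebra_simps)
  then have "norm (cumulant_kernel c y) \<le> norm (iexp (c * y) - 1 - \<i> * of_real (trunc (c * y)))
      + norm (\<i> * complex_of_real (trunc (c * y) - c * trunc y))"
    by (metis norm_triangle_ineq)
  also have "\<dots> \<le> 3 * wt (c * y) + trunc_bound c * wt y"
    using norm_compensated_exp_le[of "c * y"] trunc_scale_bound[of c y]
    by (intro add_mono) (simp_all add: norm_mult del: of_real_diff)
  also have "\<dots> \<le> 3 * ((1 + c\<^sup>2) * wt y) + trunc_bound c * wt y"
    using wt_scale[of c y] by (intro add_right_mono mult_left_mono) auto
  finally show ?thesis by (simp add: cumulant_bound_def algebra_simps)
qed

lemma abs_trunc_diff_le: "\<bar>trunc (x * u) - u * trunc x\<bar> \<le> trunc_bound u * wt x"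
  using trunc_scale_bound[of u x] by (simp add: mult.commute)

lemma ql_integrable:
  fixes h :: "real \<Rightarrow> 'b::{banach, second_countable_topology}"
  assumes "levy_measure G" "levy_measure M" "h \<in> borel_measurable borel" "\<And>x. norm (h x) \<le> C * wt x"
  shows "integrable (ql_pos (levy_diff G M)) h" "integrable (ql_neg (levy_diff G M)) h"
  using levy_integrable[OF levy_measure_ql(1)[OF assms(1,2)] assms(3,4)]
    levy_integrable[OF levy_measure_ql(2)[OF assms(1,2)] assms(3,4)] by auto

lemma ql_integral_add:
  fixes h k :: "real \<Rightarrow> 'b::{banach, second_countable_topology}"
  assumes "levy_measure G" "levy_measure M" "h \<in> borel_measurable borel" "\<And>x. norm (h x) \<le> C * wt x"
    and "k \<in> borel_measurable borel" "\<And>x. norm (k x) \<le> D * wt x"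
  shows "ql_integral (levy_diff G M) (\<lambda>x. h x + k x) = ql_integral (levy_diff G M) h + ql_integral (levy_diff G M) k"
  unfolding ql_integral_def using ql_integrable[OF assms(1-4)] ql_integrable[OF assms(1,2,5,6)] by simp

lemma ql_integral_cmult:
  fixes h :: "real \<Rightarrow> complex"
  shows "ql_integral \<nu> (\<lambda>x. c * h x) = c * ql_integral \<nu> h"
  unfolding ql_integral_def by (simp add: algebra_simps)

lemma ql_integral_of_real: "ql_integral \<nu> (\<lambda>x. complex_of_real (h x)) = of_real (ql_integral \<nu> h)"
  unfolding ql_integral_def by simp

lemma ennreal_wt_scale: "ennreal (wt (c * x)) \<le> ennreal (1 + c\<^sup>2) * ennreal (wt x)"
  using ennreal_leI[OF wt_scale[of c x]] by (subst ennreal_mult[symmetric]) auto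

lemma norm_ql_integral_le:
  fixes h :: "real \<Rightarrow> 'b::{banach, second_countable_topology}"
  assumes G: "levy_measure G" and M: "levy_measure M" and h [measurable]: "h \<in> borel_measurable borel"
    and C: "0 \<le> C" and bound: "\<And>x. norm (h x) \<le> C * wt (x * u)"
  shows "norm (ql_integral (levy_diff G M) h)
    \<le> C * enn2real (\<integral>\<^sup>+x. ennreal (wt (x * u)) \<partial>ql_abs (levy_diff G M))"
proof -
  let ?p = "ql_pos (levy_diff G M)" and ?n = "ql_neg (levy_diff G M)"
  have wtu: "wt (x * u) \<le> (1 + u\<^sup>2) * wt x" for x using wt_scale[of u x] by (simp add: mult.commute)
  have b: "norm (h x) \<le> (C * (1 + u\<^sup>2)) * wt x" for x
    using order_trans[OF bound mult_left_mono[OF wtu C]] by (simp add: mult.assoc)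
  have wtm: "(\<lambda>x. wt (x * u)) \<in> borel_measurable borel" by measurable
  have wb: "norm (wt (x * u)) \<le> (1 + u\<^sup>2) * wt x" for x using wtu[of x] by simp
  have le: "norm (\<integral>x. h x \<partial>N) \<le> C * (\<integral>x. wt (x * u) \<partial>N)" if N: "levy_measure N" for N
  proof -
    have "norm (\<integral>x. h x \<partial>N) \<le> (\<integral>x. norm (h x) \<partial>N)" by (rule integral_norm_bound)
    also have "\<dots> \<le> (\<integral>x. C * wt (x * u) \<partial>N)"
      using levy_integrable[OF N h b] levy_integrable[OF N wtm wb] bound by (intro integral_mono) auto
    finally show ?thesis by simp
  qed
  have nn: "(\<integral>\<^sup>+x. ennreal (wt (x * u)) \<partial>N) = ennreal (\<integral>x. wt (x * u) \<partial>N)" if N: "levy_measure N" for N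
    using levy_integrable[OF N wtm wb] by (intro nn_integral_eq_integral) auto
  have pos: "0 \<le> (\<integral>x. wt (x * u) \<partial>N)" for N by (intro integral_nonneg_AE) auto
  have "norm (ql_integral (levy_diff G M) h) \<le> norm (\<integral>x. h x \<partial>?p) + norm (\<integral>x. h x \<partial>?n)"
    unfolding ql_integral_def by (rule norm_triangle_ineq4)
  also have "\<dots> \<le> C * ((\<integral>x. wt (x * u) \<partial>?p) + (\<integral>x. wt (x * u) \<partial>?n))"
    using le[OF levy_measure_ql(1)[OF G M]] le[OF levy_measure_ql(2)[OF G M]] by (simp add: distrib_left)
  also have "(\<integral>x. wt (x * u) \<partial>?p) + (\<integral>x. wt (x * u) \<partial>?n)
      = enn2real (\<integral>\<^sup>+x. ennreal (wt (x * u)) \<partial>ql_abs (levy_diff G M))"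
    using nn[OF levy_measure_ql(1)[OF G M]] nn[OF levy_measure_ql(2)[OF G M]] pos
    by (subst nn_integral_ql_abs[OF G M]) (simp_all add: ennreal_plus[symmetric] del: ennreal_plus)
  finally show ?thesis .
qed

definition cumulant :: "('s \<Rightarrow> real) \<Rightarrow> ('s \<Rightarrow> real) \<Rightarrow> ('s \<Rightarrow> real set \<Rightarrow> real) \<Rightarrow> real \<Rightarrow> 's \<Rightarrow> complex" where
  "cumulant a \<sigma>2 \<rho> u s = \<i> * of_real (u * a s) - of_real (u\<^sup>2 / 2 * \<sigma>2 s)
     + ql_integral (\<rho> s) (cumulant_kernel u)"

lemma cumulant_0 [simp]: "cumulant a \<sigma>2 \<rho> 0 s = 0"
  by (simp add: cumulant_def ql_integral_def)

text \<open>
  The triplet of the infinitesimal integral \<open>u \<Lambda>(ds)\<close>: drift \<open>U_fun a \<rho> u s\<close>, variance \<open>u\<^sup>2 \<sigma>\<^sup>2(s)\<close>, and jump measure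
  the image of \<open>\<rho> s\<close> under multiplication by \<open>u\<close>.
\<close>

lemma cumulant_mult:
  assumes \<rho>: "\<rho> s = levy_diff G M" and G: "levy_measure G" and M: "levy_measure M"
  shows "cumulant a \<sigma>2 \<rho> (c * u) s = \<i> * of_real (c * U_fun a \<rho> u s) - of_real (c\<^sup>2 / 2 * (u\<^sup>2 * \<sigma>2 s))
     + ql_integral (\<rho> s) (\<lambda>x. cumulant_kernel c (u * x))"
proof -
  have b1: "norm (cumulant_kernel c (u * x)) \<le> (cumulant_bound c * (1 + u\<^sup>2)) * wt x" for x
    using order_trans[OF norm_cumulant_kernel_le mult_left_mono[OF wt_scale cumulant_bound_nonneg]]
    by (simp add: mult.assoc)
  have b2: "norm (\<i> * complex_of_real (c * (trunc (x * u) - u * trunc x))) \<le> (\<bar>c\<bar> * trunc_bound u) * wt x" for x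
    using mult_left_mono[OF abs_trunc_diff_le[of x u], of "\<bar>c\<bar>"]
    by (simp add: norm_mult abs_mult mult.assoc del: of_real_diff of_real_mult)
  have "ql_integral (\<rho> s) (cumulant_kernel (c * u))
      = ql_integral (\<rho> s) (\<lambda>x. cumulant_kernel c (u * x) + \<i> * of_real (c * (trunc (x * u) - u * trunc x)))"
    by (simp only: cumulant_kernel_mult[symmetric])
  also have "\<dots> = ql_integral (\<rho> s) (\<lambda>x. cumulant_kernel c (u * x))
      + ql_integral (\<rho> s) (\<lambda>x. \<i> * of_real (c * (trunc (x * u) - u * trunc x)))"
    unfolding \<rho> by (rule ql_integral_add[OF G M _ b1 _ b2]) measurable
  also have "ql_integral (\<rho> s) (\<lambda>x. \<i> * of_real (c * (trunc (x * u) - u * trunc x)))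
      = \<i> * of_real (c * ql_integral (\<rho> s) (\<lambda>x. trunc (x * u) - u * trunc x))"
  proof -
    have "ql_integral (\<rho> s) (\<lambda>x. c * (trunc (x * u) - u * trunc x)) = c * ql_integral (\<rho> s) (\<lambda>x. trunc (x * u) - u * trunc x)"
      unfolding ql_integral_def integral_mult_right_zero by (simp only: right_diff_distrib)
    then show ?thesis by (simp only: ql_integral_cmult ql_integral_of_real)
  qed
  finally show ?thesis
    by (simp add: cumulant_def U_fun_def power_mult_distrib algebra_simps)
qed

definition cumulant_majorant :: "('s \<Rightarrow> real) \<Rightarrow> ('s \<Rightarrow> real) \<Rightarrow> ('s \<Rightarrow> real set \<Rightarrow> real) \<Rightarrow> real \<Rightarrow> 's \<Rightarrow> real" where
  "cumulant_majorant a \<sigma>2 \<rho> u s = \<bar>U_fun a \<rho> u s\<bar> + u\<^sup>2 * \<bar>\<sigma>2 s\<bar> + enn2real (V0_fun \<rho> u s)"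

text \<open>
  The key estimate.  The point is its uniformity in the factor: the majorant at \<open>u\<close> controls all multiples
  \<open>c u\<close> with \<open>\<bar>c\<bar> \<le> C\<close>, hence all functions that are pointwise at most \<open>C \<bar>f\<bar>\<close>.
\<close>

lemma norm_cumulant_mult_le:
  assumes \<rho>: "\<rho> s = levy_diff G M" and G: "levy_measure G" and M: "levy_measure M"
    and c: "\<bar>c\<bar> \<le> C"
  shows "norm (cumulant a \<sigma>2 \<rho> (c * u) s) \<le> cumulant_bound C * cumulant_majorant a \<sigma>2 \<rho> u s"
proof -
  let ?B = "cumulant_bound c"
  have "norm (ql_integral (\<rho> s) (\<lambda>x. cumulant_kernel c (u * x))) \<le> ?B * enn2real (V0_fun \<rho> u s)"
    unfolding V0_fun_def \<rho> power2_abs using norm_cumulant_kernel_le[of c "u * _"]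
    by (intro norm_ql_integral_le[OF G M _ cumulant_bound_nonneg]) (simp_all add: mult.commute)
  moreover have "norm (\<i> * complex_of_real (c * U_fun a \<rho> u s)) \<le> ?B * \<bar>U_fun a \<rho> u s\<bar>"
  proof -
    have "\<bar>c\<bar> * 1 \<le> (1 + \<bar>c\<bar>) * (1 + c\<^sup>2)" by (intro mult_mono) auto
    moreover have "0 \<le> 3 * (1 + c\<^sup>2)" by simp
    ultimately have "\<bar>c\<bar> \<le> ?B" unfolding cumulant_bound_def trunc_bound_def by linarith
    then show ?thesis by (simp add: norm_mult abs_mult mult_right_mono)
  qed
  moreover have "norm (complex_of_real (c\<^sup>2 / 2 * (u\<^sup>2 * \<sigma>2 s))) \<le> ?B * (u\<^sup>2 * \<bar>\<sigma>2 s\<bar>)"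
  proof -
    have "0 \<le> (1 + \<bar>c\<bar>) * (1 + c\<^sup>2)" by simp
    moreover have "c\<^sup>2 / 2 \<le> 3 * (1 + c\<^sup>2)" using zero_le_power2[of c] by simp
    ultimately have "c\<^sup>2 / 2 \<le> ?B" unfolding cumulant_bound_def trunc_bound_def by linarith
    then have "c\<^sup>2 / 2 * (u\<^sup>2 * \<bar>\<sigma>2 s\<bar>) \<le> ?B * (u\<^sup>2 * \<bar>\<sigma>2 s\<bar>)" by (intro mult_right_mono) auto
    then show ?thesis by (simp add: abs_mult norm_of_real del: of_real_mult of_real_divide)
  qed
  moreover have "norm (cumulant a \<sigma>2 \<rho> (c * u) s) \<le> norm (\<i> * complex_of_real (c * U_fun a \<rho> u s))
      + norm (complex_of_real (c\<^sup>2 / 2 * (u\<^sup>2 * \<sigma>2 s))) + norm (ql_integral (\<rho> s) (\<lambda>x. cumulant_kernel c (u * x)))"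
    unfolding cumulant_mult[where \<rho>=\<rho> and s=s, OF \<rho> G M]
    by (intro order_trans[OF norm_triangle_ineq] add_right_mono norm_triangle_ineq4)
  ultimately have "norm (cumulant a \<sigma>2 \<rho> (c * u) s) \<le> ?B * cumulant_majorant a \<sigma>2 \<rho> u s"
    unfolding cumulant_majorant_def distrib_left by linarith
  also have "\<dots> \<le> cumulant_bound C * cumulant_majorant a \<sigma>2 \<rho> u s"
    using cumulant_bound_mono[OF c] by (intro mult_right_mono) (auto simp: cumulant_majorant_def)
  finally show ?thesis .
qed

lemma cumulant_tendsto:
  assumes \<rho>: "\<rho> s = levy_diff G M" and G: "levy_measure G" and M: "levy_measure M"
    and u: "u \<longlonglongrightarrow> v"
  shows "(\<lambda>n. cumulant a \<sigma>2 \<rho> (u n) s) \<longlonglongrightarrow> cumulant a \<sigma>2 \<rho> v s"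
proof -
  have "Bseq u" using u by (intro convergent_imp_Bseq) (auto simp: convergent_def)
  then obtain C where C: "\<And>n. \<bar>u n\<bar> \<le> C" by (auto simp: Bseq_def)
  have b: "norm (cumulant_kernel (u n) x) \<le> cumulant_bound C * wt x" for n x
    using order_trans[OF norm_cumulant_kernel_le mult_right_mono[OF cumulant_bound_mono[OF C]]] by simp
  have int: "(\<lambda>n. \<integral>x. cumulant_kernel (u n) x \<partial>N) \<longlonglongrightarrow> (\<integral>x. cumulant_kernel v x \<partial>N)" if N: "levy_measure N" for N
  proof (rule integral_dominated_convergence)
    have [measurable_cong]: "sets N = sets borel" using N by (rule levy_measure_sets)
    show "(\<lambda>x. cumulant_kernel v x) \<in> borel_measurable N" "\<And>n. (\<lambda>x. cumulant_kernel (u n) x) \<in> borel_measurable N"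
      by measurable
    show "integrable N (\<lambda>x. cumulant_bound C * wt x)"
      using cumulant_bound_nonneg[of C] by (intro levy_integrable[OF N]) auto
    show "AE x in N. (\<lambda>n. cumulant_kernel (u n) x) \<longlonglongrightarrow> cumulant_kernel v x"
      unfolding cumulant_kernel_def by (intro AE_I2 tendsto_intros u)
    show "AE x in N. norm (cumulant_kernel (u n) x) \<le> cumulant_bound C * wt x" for n
      using b by (intro AE_I2)
  qed
  have "(\<lambda>n. ql_integral (\<rho> s) (cumulant_kernel (u n))) \<longlonglongrightarrow> ql_integral (\<rho> s) (cumulant_kernel v)"
    unfolding \<rho> ql_integral_def
    by (intro tendsto_diff int levy_measure_ql[OF G M])
  then show ?thesis unfolding cumulant_def by (intro tendsto_intros u) auto
qed

lemma ql_integral_kernel_measurable: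
  fixes h :: "'s \<Rightarrow> real \<Rightarrow> 'b::{banach, second_countable_topology}"
  assumes "levy_kernel L G" "levy_kernel L M" "(\<lambda>(s, x). h s x) \<in> borel_measurable (L \<Otimes>\<^sub>M borel)"
  shows "(\<lambda>s. ql_integral (levy_diff (G s) (M s)) (h s)) \<in> borel_measurable L"
  unfolding ql_integral_def
  using levy_kernel_integral[OF levy_kernel_ql_pos[OF assms(1,2)] assms(3)]
    levy_kernel_integral[OF levy_kernel_ql_neg[OF assms(1,2)] assms(3)]
  by measurable

lemma cumulant_measurable:
  assumes \<rho>: "\<rho> = (\<lambda>s. levy_diff (G s) (M s))" and k: "levy_kernel L G" "levy_kernel L M"
    and [measurable]: "a \<in> borel_measurable L" "\<sigma>2 \<in> borel_measurable L" "h \<in> borel_measurable L"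
  shows "(\<lambda>s. cumulant a \<sigma>2 \<rho> (h s) s) \<in> borel_measurable L"
proof -
  have "(\<lambda>s. ql_integral (\<rho> s) (cumulant_kernel (h s))) \<in> borel_measurable L"
    unfolding \<rho> by (rule ql_integral_kernel_measurable[OF k]) measurable
  then show ?thesis unfolding cumulant_def by measurable
qed

lemma U_fun_measurable:
  assumes \<rho>: "\<rho> = (\<lambda>s. levy_diff (G s) (M s))" and k: "levy_kernel L G" "levy_kernel L M"
    and [measurable]: "a \<in> borel_measurable L" "h \<in> borel_measurable L"
  shows "(\<lambda>s. U_fun a \<rho> (h s) s) \<in> borel_measurable L"
proof -
  have "(\<lambda>s. ql_integral (\<rho> s) (\<lambda>x. trunc (x * h s) - h s * trunc x)) \<in> borel_measurable L"
    unfolding \<rho> by (rule ql_integral_kernel_measurable[OF k]) measurable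
  then show ?thesis unfolding U_fun_def by measurable
qed

lemma V0_fun_eq:
  assumes \<rho>: "\<rho> s = levy_diff G M" and G: "levy_measure G" and M: "levy_measure M"
  shows "V0_fun \<rho> u s = (\<integral>\<^sup>+x. ennreal (wt (u * x)) \<partial>ql_pos (\<rho> s)) + (\<integral>\<^sup>+x. ennreal (wt (u * x)) \<partial>ql_neg (\<rho> s))"
  unfolding V0_fun_def \<rho> power2_abs mult.commute[of _ u] by (rule nn_integral_ql_abs[OF G M]) measurable

lemma V0_fun_measurable:
  assumes \<rho>: "\<rho> = (\<lambda>s. levy_diff (G s) (M s))" and k: "levy_kernel L G" "levy_kernel L M"
    and [measurable]: "h \<in> borel_measurable L"
  shows "(\<lambda>s. V0_fun \<rho> (h s) s) \<in> borel_measurable L"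
proof -
  have "(\<lambda>s. \<integral>\<^sup>+x. ennreal (wt (h s * x)) \<partial>ql_pos (\<rho> s)) \<in> borel_measurable L"
    "(\<lambda>s. \<integral>\<^sup>+x. ennreal (wt (h s * x)) \<partial>ql_neg (\<rho> s)) \<in> borel_measurable L"
    unfolding \<rho> by (rule levy_kernel_nn_integral[OF levy_kernel_ql_pos[OF k]] levy_kernel_nn_integral[OF levy_kernel_ql_neg[OF k]], measurable)+
  moreover have "V0_fun \<rho> (h s) s = (\<integral>\<^sup>+x. ennreal (wt (h s * x)) \<partial>ql_pos (\<rho> s)) + (\<integral>\<^sup>+x. ennreal (wt (h s * x)) \<partial>ql_neg (\<rho> s))"
    if "s \<in> space L" for s
    using levy_kernelD(1)[OF k(1) that] levy_kernelD(1)[OF k(2) that]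
    by (intro V0_fun_eq[of \<rho> s "G s" "M s"]) (auto simp: \<rho>)
  ultimately show ?thesis by (simp cong: measurable_cong)
qed

section \<open>Images of a Levy kernel\<close>

text \<open>
  The image of \<open>\<kappa> s\<close> under \<open>x \<longmapsto> f s * x\<close>, without its mass at \<open>0\<close>, is again a Levy kernel, and the image
  measure is its mixture.
\<close>

lemma image_levy_mixture:
  assumes \<kappa>: "levy_kernel L \<kappa>" and f [measurable]: "f \<in> borel_measurable L"
    and fin: "(\<integral>\<^sup>+s. (\<integral>\<^sup>+x. ennreal (wt (f s * x)) \<partial>\<kappa> s) \<partial>L) < \<infinity>"
  shows "\<And>B. B \<in> sets borel \<Longrightarrow> emeasure (image_levy L \<kappa> f) B = image_set_fun L \<kappa> f B"
    and "levy_measure (image_levy L \<kappa> f)"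
    and "\<And>h :: real \<Rightarrow> complex. \<And>C. h \<in> borel_measurable borel \<Longrightarrow> (\<And>x. norm (h x) \<le> C * wt x) \<Longrightarrow>
      integrable L (\<lambda>s. \<integral>x. h (f s * x) \<partial>\<kappa> s) \<and>
      (\<integral>x. h x \<partial>image_levy L \<kappa> f) = (\<integral>s. (\<integral>x. h (f s * x) \<partial>\<kappa> s) \<partial>L)"
proof -
  note k = levy_kernelD[OF \<kappa>]
  define \<kappa>' where "\<kappa>' s = density (distr (\<kappa> s) borel (\<lambda>x. f s * x)) (\<lambda>y. ennreal (indicator (- {0}) y))" for s
  have sets': "sets (\<kappa>' s) = sets borel" for s by (simp add: \<kappa>'_def)
  have nn': "(\<integral>\<^sup>+y. u y \<partial>\<kappa>' s) = (\<integral>\<^sup>+x. indicator (- {0}) (f s * x) * u (f s * x) \<partial>\<kappa> s)"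
    if s: "s \<in> space L" and [measurable]: "u \<in> borel_measurable borel" for u s
  proof -
    have [measurable_cong]: "sets (\<kappa> s) = sets borel" using k(2) s .
    have "(\<integral>\<^sup>+y. u y \<partial>\<kappa>' s) = (\<integral>\<^sup>+y. ennreal (indicator (- {0}) y) * u y \<partial>distr (\<kappa> s) borel (\<lambda>x. f s * x))"
      unfolding \<kappa>'_def by (rule nn_integral_density) measurable
    also have "\<dots> = (\<integral>\<^sup>+x. ennreal (indicator (- {0}) (f s * x)) * u (f s * x) \<partial>\<kappa> s)"
      by (rule nn_integral_distr) measurable
    also have "\<dots> = (\<integral>\<^sup>+x. indicator (- {0}) (f s * x) * u (f s * x) \<partial>\<kappa> s)"
      by (intro nn_integral_cong) (simp split: split_indicator)
    finally show ?thesis .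
  qed
  have em': "emeasure (\<kappa>' s) B = (\<integral>\<^sup>+x. indicator (B - {0}) (f s * x) \<partial>\<kappa> s)"
    if s: "s \<in> space L" and B: "B \<in> sets borel" for s B
  proof -
    have "emeasure (\<kappa>' s) B = (\<integral>\<^sup>+y. indicator B y \<partial>\<kappa>' s)" using B sets' by simp
    also have "\<dots> = (\<integral>\<^sup>+x. indicator (B - {0}) (f s * x) \<partial>\<kappa> s)"
      using B by (subst nn'[OF s]) (auto intro!: nn_integral_cong split: split_indicator)
    finally show ?thesis .
  qed
  have em'_meas: "(\<lambda>s. emeasure (\<kappa>' s) B) \<in> borel_measurable L" if B [measurable]: "B \<in> sets borel" for B
  proof -
    have "(\<lambda>s. \<integral>\<^sup>+x. indicator (B - {0}) (f s * x) \<partial>\<kappa> s) \<in> borel_measurable L"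
      by (rule levy_kernel_nn_integral[OF \<kappa>]) measurable
    then show ?thesis using em'[OF _ B] by (simp cong: measurable_cong)
  qed
  have levy': "levy_measure (\<kappa>' s)" if s: "s \<in> space L" for s
    unfolding levy_measure_def
  proof (intro conjI)
    have ks: "sets (\<kappa> s) = sets borel" using k(2) s .
    then have [measurable_cong]: "sets (\<kappa> s) = sets borel" .
    show "emeasure (\<kappa>' s) {0} = 0" using em'[OF s, of "{0}"] by simp
    have "(\<integral>\<^sup>+y. ennreal (wt y) \<partial>\<kappa>' s) = (\<integral>\<^sup>+x. indicator (- {0}) (f s * x) * ennreal (wt (f s * x)) \<partial>\<kappa> s)"
      by (rule nn'[OF s]) measurable
    also have "\<dots> \<le> (\<integral>\<^sup>+x. ennreal (1 + (f s)\<^sup>2) * ennreal (wt x) \<partial>\<kappa> s)"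
      using ennreal_wt_scale[of "f s"]
      by (intro nn_integral_mono) (auto simp del: ennreal_plus split: split_indicator)
    also have "\<dots> = ennreal (1 + (f s)\<^sup>2) * (\<integral>\<^sup>+x. ennreal (wt x) \<partial>\<kappa> s)"
      by (rule nn_integral_cmult) measurable
    also have "\<dots> < \<infinity>" using k(1)[OF s] by (auto simp: levy_measure_def ennreal_mult_less_top)
    finally show "(\<integral>\<^sup>+y. ennreal (wt y) \<partial>\<kappa>' s) < \<infinity>" .
  qed (rule sets')
  have \<kappa>': "levy_kernel L \<kappa>'" using levy' em'_meas by (simp add: levy_kernel_def)
  have image: "image_set_fun L \<kappa> f B = (\<integral>\<^sup>+s. emeasure (\<kappa>' s) B \<partial>L)" if "B \<in> sets borel" for B
    unfolding image_set_fun_def kernel_measure_def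
    by (intro nn_integral_cong) (auto simp: em'[OF _ that] intro!: nn_integral_cong split: split_indicator)
  show em: "emeasure (image_levy L \<kappa> f) B = image_set_fun L \<kappa> f B" if B: "B \<in> sets borel" for B
    unfolding image_levy_def
  proof (rule emeasure_measure_of_sigma)
    show "sigma_algebra UNIV (sets (borel :: real measure))"
      using sets.sigma_algebra_axioms[of "borel :: real measure"] by simp
    show "positive (sets borel) (image_set_fun L \<kappa> f)"
      by (simp add: positive_def image)
    show "countably_additive (sets borel) (image_set_fun L \<kappa> f)"
    proof (rule countably_additiveI)
      fix A :: "nat \<Rightarrow> real set"
      assume A: "range A \<subseteq> sets borel" "disjoint_family A" "\<Union> (range A) \<in> sets borel"
      have Ai: "A i \<in> sets borel" for i using A by auto
      have "(\<Sum>i. image_set_fun L \<kappa> f (A i)) = (\<Sum>i. \<integral>\<^sup>+s. emeasure (\<kappa>' s) (A i) \<partial>L)"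
        by (simp add: image[OF Ai])
      also have "\<dots> = (\<integral>\<^sup>+s. (\<Sum>i. emeasure (\<kappa>' s) (A i)) \<partial>L)"
        by (rule nn_integral_suminf[symmetric]) (rule em'_meas[OF Ai])
      also have "\<dots> = (\<integral>\<^sup>+s. emeasure (\<kappa>' s) (\<Union> (range A)) \<partial>L)"
        using A by (intro nn_integral_cong suminf_emeasure) (auto simp: sets')
      finally show "(\<Sum>i. image_set_fun L \<kappa> f (A i)) = image_set_fun L \<kappa> f (\<Union> (range A))"
        by (simp add: image[OF A(3)])
    qed
  qed (use B in auto)
  have sets: "sets (image_levy L \<kappa> f) = sets borel"
    unfolding image_levy_def using sets.sigma_sets_eq[of "borel :: real measure"] by simp
  have mix: "emeasure (image_levy L \<kappa> f) B = (\<integral>\<^sup>+s. emeasure (\<kappa>' s) B \<partial>L)" if "B \<in> sets borel" for B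
    using em[OF that] image[OF that] by simp
  show levy: "levy_measure (image_levy L \<kappa> f)"
    unfolding levy_measure_def
  proof (intro conjI)
    have "emeasure (\<kappa>' s) {0} = 0" if "s \<in> space L" for s using levy'[OF that] by (simp add: levy_measure_def)
    then show "emeasure (image_levy L \<kappa> f) {0} = 0" by (simp add: mix cong: nn_integral_cong)
    have "(\<integral>\<^sup>+x. ennreal (wt x) \<partial>image_levy L \<kappa> f) = (\<integral>\<^sup>+s. (\<integral>\<^sup>+x. ennreal (wt x) \<partial>\<kappa>' s) \<partial>L)"
      by (rule mixture_nn_integral[OF levy_kernelD(2,3)[OF \<kappa>'] _ sets mix]) auto
    also have "\<dots> \<le> (\<integral>\<^sup>+s. (\<integral>\<^sup>+x. ennreal (wt (f s * x)) \<partial>\<kappa> s) \<partial>L)"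
      by (intro nn_integral_mono) (auto simp: nn' intro!: nn_integral_mono split: split_indicator)
    finally show "(\<integral>\<^sup>+x. ennreal (wt x) \<partial>image_levy L \<kappa> f) < \<infinity>" using fin by simp
  qed (rule sets)
  fix h :: "real \<Rightarrow> complex" and C
  assume h [measurable]: "h \<in> borel_measurable borel" and bound: "\<And>x. norm (h x) \<le> C * wt x"
  have h0: "h 0 = 0" using bound[of 0] by simp
  have "(\<integral>x. h x \<partial>\<kappa>' s) = (\<integral>x. h (f s * x) \<partial>\<kappa> s)" if s: "s \<in> space L" for s
  proof -
    have [measurable_cong]: "sets (\<kappa> s) = sets borel" using k(2) s .
    have "(\<integral>x. h x \<partial>\<kappa>' s) = (\<integral>y. indicator (- {0}) y *\<^sub>R h y \<partial>distr (\<kappa> s) borel (\<lambda>x. f s * x))"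
      unfolding \<kappa>'_def by (rule integral_density) auto
    also have "\<dots> = (\<integral>x. indicator (- {0}) (f s * x) *\<^sub>R h (f s * x) \<partial>\<kappa> s)"
      by (rule integral_distr) measurable
    also have "\<dots> = (\<integral>x. h (f s * x) \<partial>\<kappa> s)"
      using h0 by (intro Bochner_Integration.integral_cong refl) (auto split: split_indicator)
    finally show ?thesis .
  qed
  then show "integrable L (\<lambda>s. \<integral>x. h (f s * x) \<partial>\<kappa> s) \<and>
      (\<integral>x. h x \<partial>image_levy L \<kappa> f) = (\<integral>s. (\<integral>x. h (f s * x) \<partial>\<kappa> s) \<partial>L)"
    using mixture_integral[OF \<kappa>' sets mix levy h bound]
    by (simp cong: Bochner_Integration.integrable_cong Bochner_Integration.integral_cong)
qed

section \<open>Refining simple functions\<close>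

text \<open>
  The difference of two simple functions comes with overlapping sets, whereas independence is about disjoint
  ones.  Inserting the term \<open>x 1\<^sub>B\<close> splits each \<open>C\<close> of the list along \<open>B\<close> and passes on what remains of \<open>B\<close>.
\<close>

fun refine_insert :: "real \<times> 's set \<Rightarrow> (real \<times> 's set) list \<Rightarrow> (real \<times> 's set) list" where
  "refine_insert (x, B) [] = [(x, B)]"
| "refine_insert (x, B) ((y, C) # k) = (y, C - B) # (x + y, C \<inter> B) # refine_insert (x, B - C) k"

lemma refine_insert_sets:
  assumes "ring_of_sets S \<S>" "B \<in> \<S>" "\<forall>(y, C)\<in>set k. C \<in> \<S>"
  shows "\<forall>(y, C)\<in>set (refine_insert (x, B) k). C \<in> \<S>"
  using assms(2,3)
proof (induction k arbitrary: B)
  case (Cons p k)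
  interpret ring_of_sets S \<S> by fact
  obtain y C where "p = (y, C)" by (cases p)
  then show ?case using Cons.IH[of "B - C"] Cons.prems by auto
qed simp

lemma refine_insert_subset:
  "(y, D) \<in> set (refine_insert (x, B) k) \<Longrightarrow> D \<subseteq> B \<union> (\<Union>(z, C)\<in>set k. C)"
proof (induction k arbitrary: B)
  case (Cons p k)
  obtain z C where "p = (z, C)" by (cases p)
  then show ?case using Cons.IH[of "B - C"] Cons.prems by auto
qed simp

lemma refine_insert_disjoint:
  "sorted_wrt (\<lambda>(x, B) (y, C). B \<inter> C = {}) k \<Longrightarrow> sorted_wrt (\<lambda>(x, B) (y, C). B \<inter> C = {}) (refine_insert (x, B) k)"
proof (induction k arbitrary: B)
  case (Cons p k)
  obtain z C where p: "p = (z, C)" by (cases p)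
  have "C \<inter> D = {}" if "(y, D) \<in> set (refine_insert (x, B - C) k)" for y D
  proof -
    have "C \<inter> (\<Union>(z, C)\<in>set k. C) = {}" using Cons.prems by (fastforce simp: p)
    then show ?thesis using refine_insert_subset[OF that] by blast
  qed
  then have "(C - B) \<inter> D = {}" "(C \<inter> B) \<inter> D = {}" if "(y, D) \<in> set (refine_insert (x, B - C) k)" for y D
    using that by blast+
  then show ?case using Cons.IH[of "B - C"] Cons.prems by (fastforce simp: p)
qed simp

lemma refine_insert_simple_fun:
  "simple_fun (refine_insert (x, B) k) s = x * indicator B s + simple_fun k s"
proof (induction k arbitrary: B)
  case (Cons p k)
  obtain z C where p: "p = (z, C)" by (cases p)
  show ?case using Cons.IH[of "B - C"]
    by (auto simp: p simple_fun_def split: split_indicator)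
qed (simp add: simple_fun_def)

lemma simple_fun_Cons [simp]: "simple_fun ((x, B) # h) s = x * indicator B s + simple_fun h s"
  by (simp add: simple_fun_def)

lemma simple_fun_Nil [simp]: "simple_fun [] s = 0"
  by (simp add: simple_fun_def)

lemma simple_integral_Cons [simp]:
  "simple_integral \<Lambda> X ((x, B) # h) \<omega> = x * \<Lambda> (X \<inter> B) \<omega> + simple_integral \<Lambda> X h \<omega>"
  by (simp add: simple_integral_def)

lemma simple_integral_Nil [simp]: "simple_integral \<Lambda> X [] \<omega> = 0"
  by (simp add: simple_integral_def)

text \<open>
  At most one of the disjoint sets contains \<open>s\<close>.  Applied to the cumulant, this splits the integral for a simple
  function into those for its terms.
\<close>

lemma simple_rep_apply:
  fixes \<phi> :: "real \<Rightarrow> complex"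
  assumes "\<phi> 0 = 0" "sorted_wrt (\<lambda>(x, B) (y, C). B \<inter> C = {}) h"
  shows "\<phi> (simple_fun h s) = (\<Sum>i<length h. indicator (snd (h ! i)) s *\<^sub>R \<phi> (fst (h ! i)))"
  using assms(2)
proof (induction h)
  case (Cons p h)
  obtain x B where p: "p = (x, B)" by (cases p)
  have disj: "B \<inter> C = {}" if "(y, C) \<in> set h" for y C using Cons.prems that by (auto simp: p)
  have IH: "\<phi> (simple_fun h s) = (\<Sum>i<length h. indicator (snd (h ! i)) s *\<^sub>R \<phi> (fst (h ! i)))"
    using Cons by simp
  show ?case
  proof (cases "s \<in> B")
    case True
    have 0: "s \<notin> snd q" if "q \<in> set h" for q using disj[of "fst q" "snd q"] that True by auto
    then have "simple_fun h s = 0"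
      by (auto simp: simple_fun_def sum_list_sum_nth split_beta intro!: sum.neutral split: split_indicator)
    moreover have "(\<Sum>i<length h. indicator (snd (h ! i)) s *\<^sub>R \<phi> (fst (h ! i))) = 0"
      using 0 by (intro sum.neutral) auto
    ultimately show ?thesis using True
      by (simp add: p sum.lessThan_Suc_shift del: sum.lessThan_Suc)
  next
    case False
    then show ?thesis using IH by (simp add: p sum.lessThan_Suc_shift del: sum.lessThan_Suc)
  qed
qed (simp add: assms(1))

lemma simple_integral_nth:
  "simple_integral \<Lambda> X h \<omega> = (\<Sum>i<length h. fst (h ! i) * \<Lambda> (X \<inter> snd (h ! i)) \<omega>)"
  by (simp add: simple_integral_def sum_list_sum_nth split_beta atLeast0LessThan)

lemma simple_function_rep:
  fixes \<phi> :: "'s \<Rightarrow> real"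
  assumes ring: "ring_of_sets S \<S>" and E: "E \<in> \<S>" "E \<subseteq> space L" and L: "\<And>X. X \<in> sets L \<Longrightarrow> X \<inter> E \<in> \<S>"
    and \<phi>: "simple_function L \<phi>"
  obtains h where "simple_rep \<S> h" "\<And>s. s \<in> space L \<Longrightarrow> simple_fun h s = \<phi> s * indicator E s"
proof -
  obtain vs where vs: "set vs = \<phi> ` space L" "distinct vs"
    using finite_distinct_list[OF simple_functionD(1)[OF \<phi>]] by blast
  define h where "h = map (\<lambda>y. (y, \<phi> -` {y} \<inter> space L \<inter> E)) vs"
  have "simple_rep \<S> h"
    unfolding simple_rep_def
  proof
    show "\<forall>(x, B)\<in>set h. B \<in> \<S>"
      unfolding h_def using L simple_functionD(2)[OF \<phi>] by (auto simp: Int_assoc[symmetric])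
    have "sorted_wrt (\<lambda>x y. x \<noteq> y) vs"
      using vs(2) by (auto simp: sorted_wrt_iff_nth_less nth_eq_iff_index_eq)
    then have "sorted_wrt (\<lambda>x y. (\<phi> -` {x} \<inter> space L \<inter> E) \<inter> (\<phi> -` {y} \<inter> space L \<inter> E) = {}) vs"
      by (rule sorted_wrt_mono_rel[rotated]) auto
    then show "sorted_wrt (\<lambda>(x, B) (y, C). B \<inter> C = {}) h"
      unfolding h_def by (simp add: sorted_wrt_map)
  qed
  moreover have "simple_fun h s = \<phi> s * indicator E s" if s: "s \<in> space L" for s
  proof -
    have "simple_fun h s = (\<Sum>y\<leftarrow>vs. y * indicator (\<phi> -` {y} \<inter> space L \<inter> E) s)"
      by (simp add: simple_fun_def h_def o_def)
    also have "\<dots> = (\<Sum>y\<in>\<phi> ` space L. y * indicator (\<phi> -` {y} \<inter> space L \<inter> E) s)"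
      using vs by (simp add: sum_list_distinct_conv_sum_set)
    also have "\<dots> = (\<Sum>y\<in>\<phi> ` space L. if y = \<phi> s then \<phi> s * indicator E s else 0)"
      using s by (intro sum.cong) (auto split: split_indicator)
    also have "\<dots> = \<phi> s * indicator E s"
      using s simple_functionD(1)[OF \<phi>] by (simp add: sum.delta)
    finally show ?thesis .
  qed
  ultimately show ?thesis by (rule that)
qed

section \<open>Integrals of simple functions\<close>

context controlled_qid_random_measure
begin

lemma space_L: "space L = S"
proof -
  have "space L = space (sigma S \<S>)" by (rule sets_eq_imp_space_eq[OF sets_L])
  then show ?thesis using space_closed by (simp add: space_measure_of)
qed

lemma sets_L_sigma_sets: "sets L = sigma_sets S \<S>"
  using sets_L space_closed by (simp add: sets_measure_of)

lemma base_in_sets_L: "A \<in> \<S> \<Longrightarrow> A \<in> sets L"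
  by (simp add: sets_L_sigma_sets sigma_sets.Basic)

lemma sets_L_Int_base:
  assumes "X \<in> sets L" "A \<in> \<S>" shows "X \<inter> A \<in> \<S>"
  using assms(1) unfolding sets_L_sigma_sets
proof induction
  case (Basic X)
  then show ?case using assms(2) by auto
next
  case (Compl X)
  have "(S - X) \<inter> A = A - X \<inter> A" using assms(2) sets_into_space by auto
  then show ?case using Compl.IH assms(2) by auto
next
  case (Union X)
  have "(\<Inter>n. A - X n \<inter> A) \<in> \<S>" using Union.IH assms(2) by (intro countable_INT_closed) auto
  then have "A - (\<Inter>n. A - X n \<inter> A) \<in> \<S>" by (rule Diff[OF assms(2)])
  moreover have "A - (\<Inter>n. A - X n \<inter> A) = (\<Union>n. X n) \<inter> A" by blast
  ultimately show ?case by simp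
qed auto

lemma levy_kernels: "levy_kernel L \<rho>G" "levy_kernel L \<rho>M"
  using kernel_\<rho>G kernel_\<rho>M by (auto simp: levy_kernel_on_def levy_kernel_def)

abbreviation \<rho> :: "'s \<Rightarrow> real set \<Rightarrow> real" where "\<rho> \<equiv> \<lambda>s. levy_diff (\<rho>G s) (\<rho>M s)"

abbreviation K :: "real \<Rightarrow> 's \<Rightarrow> complex" where "K \<equiv> cumulant a \<sigma>2 \<rho>"

lemma levy_at: "s \<in> space L \<Longrightarrow> levy_measure (\<rho>G s)" "s \<in> space L \<Longrightarrow> levy_measure (\<rho>M s)"
  using levy_kernelD(1)[OF levy_kernels(1)] levy_kernelD(1)[OF levy_kernels(2)] by auto

lemma densities_measurable [measurable]: "a \<in> borel_measurable L" "\<sigma>2 \<in> borel_measurable L"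
  using density_a density_\<sigma>2 by (auto simp: density_on_def)

lemma K_measurable [measurable]: "h \<in> borel_measurable L \<Longrightarrow> (\<lambda>s. K (h s) s) \<in> borel_measurable L"
  by (rule cumulant_measurable[OF refl levy_kernels]) auto

lemma jump_integral_base:
  assumes A: "A \<in> \<S>" and k: "levy_kernel_on L \<S> H \<kappa>" and H: "levy_measure (H A)"
    and h: "h \<in> borel_measurable borel" "\<And>x. norm (h x) \<le> C * wt x"
  shows "set_integrable L A (\<lambda>s. \<integral>x. (h x :: complex) \<partial>\<kappa> s)"
    "(\<integral>x. h x \<partial>H A) = (LINT s:A|L. (\<integral>x. h x \<partial>\<kappa> s))"
proof -
  have [measurable]: "A \<in> sets L" using A by (rule base_in_sets_L)
  let ?L = "restrict_space L A"
  have kk: "levy_kernel ?L \<kappa>"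
    unfolding levy_kernel_def
  proof (intro conjI ballI)
    show "levy_measure (\<kappa> s)" if "s \<in> space ?L" for s
      using that k sets.sets_into_space[OF base_in_sets_L[OF A]]
      by (auto simp: levy_kernel_on_def space_restrict_space)
    show "(\<lambda>s. emeasure (\<kappa> s) B) \<in> borel_measurable ?L" if "B \<in> sets borel" for B
      using that k by (intro measurable_restrict_space1) (simp add: levy_kernel_on_def)
  qed
  have mix0: "emeasure (H A) B = (\<integral>\<^sup>+s. emeasure (\<kappa> s) B \<partial>?L)" if "B \<in> sets borel" for B
    using k A that by (simp add: nn_integral_restrict_space levy_kernel_on_def)
  note mix = mixture_integral[where C=C and h=h, OF kk levy_measure_sets[OF H] mix0 H h]
  show "set_integrable L A (\<lambda>s. \<integral>x. h x \<partial>\<kappa> s)"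
    using mix(1) by (simp add: set_integrable_def integrable_restrict_space)
  show "(\<integral>x. h x \<partial>H A) = (LINT s:A|L. (\<integral>x. h x \<partial>\<kappa> s))"
    using mix(2) by (simp add: set_lebesgue_integral_def integral_restrict_space)
qed

text \<open>
  The exponent of each triplet is the integral of the local cumulant: \<open>\<nu>0\<close> and \<open>\<nu>1\<close> have the densities
  \<open>a\<close> and \<open>\<sigma>2\<close>, and the jump part is Fubini for the kernels \<open>\<rho>G\<close> and \<open>\<rho>M\<close>.
\<close>

lemma char_\<Lambda>:
  assumes A: "A \<in> \<S>"
  shows "set_integrable L A (K u)" "char (distr P borel (\<Lambda> A)) u = exp (LINT s:A|L. K u s)"
proof -
  have [measurable]: "A \<in> sets L" using A by (rule base_in_sets_L)
  note bG = jump_integral_base[OF A kernel_\<rho>G levy_G[OF A] _ norm_cumulant_kernel_le[of u]]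
  note bM = jump_integral_base[OF A kernel_\<rho>M levy_M[OF A] _ norm_cumulant_kernel_le[of u]]
  have m: "cumulant_kernel u \<in> borel_measurable borel" by measurable
  have da: "set_integrable L A a" "\<nu>0 A = (LINT s:A|L. a s)"
    and ds: "set_integrable L A \<sigma>2" "\<nu>1 A = (LINT s:A|L. \<sigma>2 s)"
    using density_a density_\<sigma>2 A by (auto simp: density_on_def)
  let ?a = "\<lambda>s. \<i> * complex_of_real (u * a s)" and ?s = "\<lambda>s. complex_of_real (u\<^sup>2 / 2 * \<sigma>2 s)"
  let ?j = "\<lambda>s. (\<integral>x. cumulant_kernel u x \<partial>\<rho>G s) - (\<integral>x. cumulant_kernel u x \<partial>\<rho>M s)"
  have K_eq: "K u s = ?a s - ?s s + ?j s" if "s \<in> space L" for s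
    unfolding cumulant_def
    using ql_integral_levy_diff[OF levy_at[OF that] m norm_cumulant_kernel_le] by simp
  have real: "set_integrable L A (\<lambda>s. z * of_real (c * g s)) \<and>
      (LINT s:A|L. z * of_real (c * g s)) = z * of_real (c * (LINT s:A|L. g s))"
    if "set_integrable L A g" for g :: "'s \<Rightarrow> real" and z :: complex and c :: real
  proof -
    have eq: "indicator A s *\<^sub>R (z * complex_of_real (c * g s)) = (z * of_real c) * of_real (indicator A s *\<^sub>R g s)" for s
      by (simp add: scaleR_conv_of_real mult_ac)
    have "complex_integrable L (\<lambda>s. (z * of_real c) * of_real (indicator A s *\<^sub>R g s))"
      using that unfolding set_integrable_def by (intro integrable_mult_right integrable_of_real)
    then show ?thesis
      unfolding set_integrable_def set_lebesgue_integral_def eq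
        integral_mult_right_zero integral_complex_of_real by simp
  qed
  have ia: "set_integrable L A ?a" "(LINT s:A|L. ?a s) = \<i> * of_real (u * \<nu>0 A)"
    using real[OF da(1), of \<i> u] da(2) by auto
  have iv: "set_integrable L A ?s" "(LINT s:A|L. ?s s) = of_real (u\<^sup>2 / 2 * \<nu>1 A)"
    using real[OF ds(1), of 1 "u\<^sup>2 / 2"] ds(2) by auto
  have ij: "set_integrable L A ?j"
    "(LINT s:A|L. ?j s) = ql_integral (levy_diff (G A) (M A)) (cumulant_kernel u)"
    using bG[OF m] bM[OF m] ql_integral_levy_diff[OF levy_G[OF A] levy_M[OF A] m norm_cumulant_kernel_le]
    by simp_all
  have int: "set_integrable L A (\<lambda>s. ?a s - ?s s + ?j s)"
    by (intro set_integral_add(1) set_integral_diff(1) ia iv ij)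
  show "set_integrable L A (K u)"
    using int K_eq unfolding set_integrable_def by (simp cong: Bochner_Integration.integrable_cong)
  have "(LINT s:A|L. K u s) = (LINT s:A|L. ?a s - ?s s + ?j s)"
    unfolding set_lebesgue_integral_def
    by (intro Bochner_Integration.integral_cong refl) (simp add: K_eq)
  also have "\<dots> = (LINT s:A|L. ?a s) - (LINT s:A|L. ?s s) + (LINT s:A|L. ?j s)"
    using ia(1) iv(1) ij(1) set_integral_diff(1)[OF ia(1) iv(1)]
    by (simp add: set_integral_add(2) set_integral_diff(2))
  finally have "(LINT s:A|L. K u s) = \<i> * of_real (u * \<nu>0 A) - of_real (u\<^sup>2 / 2 * \<nu>1 A)
      + ql_integral (levy_diff (G A) (M A)) (cumulant_kernel u)"
    by (simp only: ia(2) iv(2) ij(2))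
  moreover have "cumulant_kernel u = (\<lambda>x. iexp (u * x) - 1 - \<i> * of_real (u * trunc x))"
    by (simp add: cumulant_kernel_def fun_eq_iff)
  ultimately show "char (distr P borel (\<Lambda> A)) u = exp (LINT s:A|L. K u s)"
    using triplet[OF A] unfolding qid_triplet_def by simp
qed

lemma AE_\<Lambda>_empty: "AE \<omega> in P. \<Lambda> {} \<omega> = 0"
proof -
  have "AE \<omega> in P. (\<lambda>n::nat. \<Lambda> {} \<omega>) sums \<Lambda> (\<Union>n::nat. {}) \<omega>"
    using additive[of "\<lambda>_. {}"] by (simp add: disjoint_family_on_def)
  then show ?thesis
  proof eventually_elim
    fix \<omega> assume "(\<lambda>n::nat. \<Lambda> {} \<omega>) sums \<Lambda> (\<Union>n::nat. {}) \<omega>"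
    then have "(\<lambda>n::nat. \<Lambda> {} \<omega>) \<longlonglongrightarrow> 0" by (intro summable_LIMSEQ_zero) (auto simp: summable_def)
    then show "\<Lambda> {} \<omega> = 0" by (simp add: LIMSEQ_const_iff)
  qed
qed

lemma AE_\<Lambda>_Un:
  assumes "A \<in> \<S>" "B \<in> \<S>" "A \<inter> B = {}"
  shows "AE \<omega> in P. \<Lambda> (A \<union> B) \<omega> = \<Lambda> A \<omega> + \<Lambda> B \<omega>"
proof -
  have "AE \<omega> in P. (\<lambda>n. \<Lambda> (binaryset A B n) \<omega>) sums \<Lambda> (\<Union>n. binaryset A B n) \<omega>"
    using assms by (intro additive) (auto simp: range_binaryset_eq UN_binaryset_eq disjoint_family_on_def binaryset_def)
  then show ?thesis using AE_\<Lambda>_empty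
  proof eventually_elim
    fix \<omega> assume *: "(\<lambda>n. \<Lambda> (binaryset A B n) \<omega>) sums \<Lambda> (\<Union>n. binaryset A B n) \<omega>" "\<Lambda> {} \<omega> = 0"
    have "(\<lambda>n. \<Lambda> (binaryset A B n) \<omega>) sums (\<Lambda> A \<omega> + \<Lambda> B \<omega>)"
      using *(2) by (rule binaryset_sums[of "\<lambda>X. \<Lambda> X \<omega>"])
    then show "\<Lambda> (A \<union> B) \<omega> = \<Lambda> A \<omega> + \<Lambda> B \<omega>"
      using *(1) sums_unique2 by (fastforce simp: UN_binaryset_eq)
  qed
qed

lemma AE_\<Lambda>_split:
  assumes "X \<in> sets L" "C \<in> \<S>" "B \<in> \<S>"
  shows "AE \<omega> in P. \<Lambda> (X \<inter> C) \<omega> = \<Lambda> (X \<inter> (C - B)) \<omega> + \<Lambda> (X \<inter> (C \<inter> B)) \<omega>"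
proof -
  have "X \<inter> (C - B) \<in> \<S>" "X \<inter> (C \<inter> B) \<in> \<S>"
    using assms by (meson sets_L_Int_base Diff Int)+
  then have "AE \<omega> in P. \<Lambda> ((X \<inter> (C - B)) \<union> (X \<inter> (C \<inter> B))) \<omega> = \<Lambda> (X \<inter> (C - B)) \<omega> + \<Lambda> (X \<inter> (C \<inter> B)) \<omega>"
    by (rule AE_\<Lambda>_Un) auto
  moreover have "(X \<inter> (C - B)) \<union> (X \<inter> (C \<inter> B)) = X \<inter> C" by blast
  ultimately show ?thesis by simp
qed

lemma refine_insert_integral:
  assumes X: "X \<in> sets L"
  shows "B \<in> \<S> \<Longrightarrow> \<forall>(y, C)\<in>set k. C \<in> \<S> \<Longrightarrow>
    AE \<omega> in P. simple_integral \<Lambda> X (refine_insert (x, B) k) \<omega> = x * \<Lambda> (X \<inter> B) \<omega> + simple_integral \<Lambda> X k \<omega>"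
proof (induction k arbitrary: B)
  case (Cons p k)
  obtain z C where p: "p = (z, C)" by (cases p)
  have C: "C \<in> \<S>" using Cons.prems by (simp add: p)
  have "AE \<omega> in P. simple_integral \<Lambda> X (refine_insert (x, B - C) k) \<omega> = x * \<Lambda> (X \<inter> (B - C)) \<omega> + simple_integral \<Lambda> X k \<omega>"
    using Cons C by auto
  then show ?case using AE_\<Lambda>_split[OF X C Cons.prems(1)] AE_\<Lambda>_split[OF X Cons.prems(1) C]
    by eventually_elim (simp add: p algebra_simps Int_commute[of B C])
qed simp

text \<open>
  The equality of integrals holds only almost surely, as \<open>\<Lambda>\<close> is additive only almost surely; the list is finite, so
  finitely many null sets are involved.
\<close>

lemma refine_to_simple_rep:
  assumes "\<forall>(y, C)\<in>set l. C \<in> \<S>"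
  shows "\<exists>k. simple_rep \<S> k \<and> (\<forall>s. simple_fun k s = simple_fun l s) \<and>
    (\<forall>X\<in>sets L. AE \<omega> in P. simple_integral \<Lambda> X k \<omega> = simple_integral \<Lambda> X l \<omega>)"
  using assms
proof (induction l)
  case Nil
  show ?case by (intro exI[of _ "[]"]) (simp add: simple_rep_def)
next
  case (Cons p l)
  obtain x B where p: "p = (x, B)" by (cases p)
  have B: "B \<in> \<S>" using Cons.prems by (simp add: p)
  obtain k where k: "simple_rep \<S> k" "\<And>s. simple_fun k s = simple_fun l s"
    "\<And>X. X \<in> sets L \<Longrightarrow> AE \<omega> in P. simple_integral \<Lambda> X k \<omega> = simple_integral \<Lambda> X l \<omega>"
    using Cons by auto
  have ks: "\<forall>(y, C)\<in>set k. C \<in> \<S>" using k(1) by (simp add: simple_rep_def)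
  have "simple_rep \<S> (refine_insert (x, B) k)"
    using k(1) refine_insert_sets[OF ring_of_sets_axioms B ks] refine_insert_disjoint by (auto simp: simple_rep_def)
  moreover have "AE \<omega> in P. simple_integral \<Lambda> X (refine_insert (x, B) k) \<omega> = simple_integral \<Lambda> X (p # l) \<omega>"
    if X: "X \<in> sets L" for X
    using refine_insert_integral[OF X B ks, of x] k(3)[OF X] by eventually_elim (simp add: p)
  ultimately show ?case
    using k(2) by (intro exI[of _ "refine_insert (x, B) k"]) (simp add: p refine_insert_simple_fun)
qed

lemma simple_integral_measurable [measurable]:
  assumes "\<forall>(y, C)\<in>set h. C \<in> \<S>" "X \<in> sets L"
  shows "simple_integral \<Lambda> X h \<in> borel_measurable P"
  using assms(1)
proof (induction h)
  case (Cons p h)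
  obtain x B where p: "p = (x, B)" by (cases p)
  have [measurable]: "\<Lambda> (X \<inter> B) \<in> borel_measurable P" "simple_integral \<Lambda> X h \<in> borel_measurable P"
    using Cons sets_L_Int_base[OF assms(2)] rv by (auto simp: p)
  have "simple_integral \<Lambda> X (p # h) = (\<lambda>\<omega>. x * \<Lambda> (X \<inter> B) \<omega> + simple_integral \<Lambda> X h \<omega>)"
    by (simp add: p fun_eq_iff)
  then show ?case by simp
next
  case Nil
  have "simple_integral \<Lambda> X [] = (\<lambda>_. 0)" by (simp add: fun_eq_iff)
  then show ?case by simp
qed

lemma simple_integral_char:
  assumes h: "simple_rep \<S> h" and X: "X \<in> sets L"
  shows "set_integrable L X (\<lambda>s. K (\<theta> * simple_fun h s) s)"
    "char (distr P borel (simple_integral \<Lambda> X h)) \<theta> = exp (LINT s:X|L. K (\<theta> * simple_fun h s) s)"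
proof -
  let ?n = "length h"
  define B where "B i = (if i < ?n then X \<inter> snd (h ! i) else {})" for i
  define x where "x i = fst (h ! i)" for i
  have inS: "snd (h ! i) \<in> \<S>" if "i < ?n" for i
    using h nth_mem[OF that] by (auto simp: simple_rep_def split_beta)
  have BS: "B i \<in> \<S>" for i using sets_L_Int_base[OF X inS] by (auto simp: B_def)
  have sorted: "sorted_wrt (\<lambda>(x, B) (y, C). B \<inter> C = {}) h" using h by (simp add: simple_rep_def)
  have disj: "snd (h ! i) \<inter> snd (h ! j) = {}" if "i < j" "j < ?n" for i j
    using sorted_wrt_nth_less[OF sorted that] by (simp add: split_beta)
  have dB: "disjoint_family B"
    unfolding disjoint_family_on_def
  proof (intro ballI impI)
    fix i j :: nat assume "i \<noteq> j"
    then consider "i < j" | "j < i" by linarith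
    then show "B i \<inter> B j = {}"
      by cases (use disj in \<open>auto simp: B_def\<close>)
  qed
  have pw: "indicator X s *\<^sub>R K (\<theta> * simple_fun h s) s = (\<Sum>i<?n. indicator (B i) s *\<^sub>R K (\<theta> * x i) s)" for s
  proof -
    have "K (\<theta> * simple_fun h s) s = (\<Sum>i<?n. indicator (snd (h ! i)) s *\<^sub>R K (\<theta> * x i) s)"
      using simple_rep_apply[of "\<lambda>y. K (\<theta> * y) s" h s] sorted by (simp add: x_def)
    then have "indicator X s *\<^sub>R K (\<theta> * simple_fun h s) s
        = (\<Sum>i<?n. (indicator X s * indicator (snd (h ! i)) s) *\<^sub>R K (\<theta> * x i) s)"
      by (simp only: scaleR_sum_right scaleR_scaleR)
    also have "\<dots> = (\<Sum>i<?n. indicator (B i) s *\<^sub>R K (\<theta> * x i) s)"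
      by (intro sum.cong refl) (simp add: B_def indicator_inter_arith)
    finally show ?thesis .
  qed
  have int: "set_integrable L (B i) (K (\<theta> * x i))" for i using char_\<Lambda>(1)[OF BS] .
  show "set_integrable L X (\<lambda>s. K (\<theta> * simple_fun h s) s)"
    unfolding set_integrable_def pw
    by (rule Bochner_Integration.integrable_sum) (rule int[unfolded set_integrable_def])
  have lint: "(LINT s:X|L. K (\<theta> * simple_fun h s) s) = (\<Sum>i<?n. LINT s:B i|L. K (\<theta> * x i) s)"
    unfolding set_lebesgue_integral_def pw
    by (rule Bochner_Integration.integral_sum) (rule int[unfolded set_integrable_def])
  have "indep_vars (\<lambda>_. borel) (\<lambda>i. \<Lambda> (B i)) UNIV"
    using BS dB by (intro independent) auto
  then have "indep_vars (\<lambda>_. borel) (\<lambda>i \<omega>. x i * \<Lambda> (B i) \<omega>) UNIV"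
    by (rule indep_vars_compose2[where Y="\<lambda>i y. x i * y"]) measurable
  then have ind: "indep_vars (\<lambda>_. borel) (\<lambda>i \<omega>. x i * \<Lambda> (B i) \<omega>) {..<?n}"
    by (rule indep_vars_subset) auto
  have "simple_integral \<Lambda> X h = (\<lambda>\<omega>. \<Sum>i<?n. x i * \<Lambda> (B i) \<omega>)"
    by (simp add: simple_integral_nth fun_eq_iff x_def B_def)
  then have "char (distr P borel (simple_integral \<Lambda> X h)) \<theta>
      = (\<Prod>i<?n. char (distr P borel (\<lambda>\<omega>. x i * \<Lambda> (B i) \<omega>)) \<theta>)"
    using char_distr_sum[OF ind] by simp
  also have "\<dots> = (\<Prod>i<?n. exp (LINT s:B i|L. K (\<theta> * x i) s))"
  proof (rule prod.cong[OF refl])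
    fix i
    have [measurable]: "\<Lambda> (B i) \<in> borel_measurable P" using rv[OF BS] .
    have "char (distr P borel (\<lambda>\<omega>. x i * \<Lambda> (B i) \<omega>)) \<theta> = char (distr P borel (\<Lambda> (B i))) (\<theta> * x i)"
      by (simp add: char_distr_eq mult_ac)
    then show "char (distr P borel (\<lambda>\<omega>. x i * \<Lambda> (B i) \<omega>)) \<theta> = exp (LINT s:B i|L. K (\<theta> * x i) s)"
      using char_\<Lambda>(2)[OF BS] by simp
  qed
  also have "\<dots> = exp (LINT s:X|L. K (\<theta> * simple_fun h s) s)"
    unfolding lint by (simp add: exp_sum)
  finally show "char (distr P borel (simple_integral \<Lambda> X h)) \<theta> = exp (LINT s:X|L. K (\<theta> * simple_fun h s) s)" .
qed

lemma simple_integral_diff_char: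
  assumes h: "simple_rep \<S> h" and h': "simple_rep \<S> h'" and X: "X \<in> sets L"
  shows "char (distr P borel (\<lambda>\<omega>. simple_integral \<Lambda> X h \<omega> - simple_integral \<Lambda> X h' \<omega>)) \<theta>
    = exp (LINT s:X|L. K (\<theta> * (simple_fun h s - simple_fun h' s)) s)"
proof -
  let ?l = "h @ map (\<lambda>(y, C). (- y, C)) h'"
  have sets: "\<forall>(y, C)\<in>set h. C \<in> \<S>" "\<forall>(y, C)\<in>set h'. C \<in> \<S>" using h h' by (auto simp: simple_rep_def)
  then have "\<forall>(y, C)\<in>set ?l. C \<in> \<S>" by auto
  from refine_to_simple_rep[OF this] obtain k where k: "simple_rep \<S> k" "\<And>s. simple_fun k s = simple_fun ?l s"
    "AE \<omega> in P. simple_integral \<Lambda> X k \<omega> = simple_integral \<Lambda> X ?l \<omega>"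
    using X by blast
  have ks: "\<forall>(y, C)\<in>set k. C \<in> \<S>" using k(1) by (simp add: simple_rep_def)
  have neg: "simple_integral \<Lambda> X (map (\<lambda>(y, C). (- y, C)) h') \<omega> = - simple_integral \<Lambda> X h' \<omega>"
    "simple_fun (map (\<lambda>(y, C). (- y, C)) h') s = - simple_fun h' s" for \<omega> s
    by (induction h') auto
  have l: "simple_integral \<Lambda> X ?l \<omega> = simple_integral \<Lambda> X h \<omega> - simple_integral \<Lambda> X h' \<omega>"
    "simple_fun ?l s = simple_fun h s - simple_fun h' s" for \<omega> s
    using neg by (simp_all add: simple_integral_def simple_fun_def)
  note [measurable] = simple_integral_measurable[OF sets(1) X] simple_integral_measurable[OF sets(2) X]
    simple_integral_measurable[OF ks X]
  have "distr P borel (\<lambda>\<omega>. simple_integral \<Lambda> X h \<omega> - simple_integral \<Lambda> X h' \<omega>) = distr P borel (simple_integral \<Lambda> X k)"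
    using k(3) by (intro distr_cong_AE) (auto simp: l)
  then show ?thesis
    using simple_integral_char(2)[OF k(1) X] by (simp add: k(2) l(2))
qed

text \<open>
  Condition (ii) is stated with \<open>ennreal\<close>, which would hide negative values of \<open>\<sigma>2\<close>.  They are excluded
  because \<open>\<nu>1\<close> is non-negative on the part of each exhausting set where \<open>\<sigma>2\<close> is negative.
\<close>

lemma \<sigma>2_nonneg: "AE s in L. 0 \<le> \<sigma>2 s"
proof -
  obtain E :: "nat \<Rightarrow> 's set" where E: "range E \<subseteq> \<S>" "(\<Union>n. E n) = S" using exhausting by blast
  have "AE s in L. s \<in> E n \<longrightarrow> 0 \<le> \<sigma>2 s" for n
  proof -
    define N where "N = {s \<in> space L. \<sigma>2 s < 0} \<inter> E n"
    have NS: "N \<in> \<S>" unfolding N_def using E by (intro sets_L_Int_base) (measurable, auto)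
    then have [measurable]: "N \<in> sets L" by (rule base_in_sets_L)
    have int: "integrable L (\<lambda>s. indicator N s * \<sigma>2 s)" and eq: "\<nu>1 N = (\<integral>s. indicator N s * \<sigma>2 s \<partial>L)"
      using density_\<sigma>2 NS by (auto simp: density_on_def set_integrable_def set_lebesgue_integral_def)
    have le: "0 \<le> - (indicator N s * \<sigma>2 s)" for s by (auto simp: N_def split: split_indicator)
    have "(\<integral>s. - (indicator N s * \<sigma>2 s) \<partial>L) = 0"
    proof (rule antisym)
      show "(\<integral>s. - (indicator N s * \<sigma>2 s) \<partial>L) \<le> 0" using eq \<nu>1(2)[OF NS] by simp
      show "0 \<le> (\<integral>s. - (indicator N s * \<sigma>2 s) \<partial>L)" using le by (intro integral_nonneg_AE) auto
    qed
    then have "AE s in L. - (indicator N s * \<sigma>2 s) = 0"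
      using int le by (subst (asm) integral_nonneg_eq_0_iff_AE) auto
    then show ?thesis using AE_space
      by eventually_elim (auto simp: N_def split: split_indicator_asm)
  qed
  then have "AE s in L. \<forall>n. s \<in> E n \<longrightarrow> 0 \<le> \<sigma>2 s" by (subst AE_all_countable) blast
  then show ?thesis using AE_space
    by eventually_elim (use E(2) space_L in blast)
qed

lemma simple_fun_measurable [measurable]:
  assumes "simple_rep \<S> h" shows "simple_fun h \<in> borel_measurable L"
proof -
  have "\<forall>(y, C)\<in>set h. C \<in> sets L" using assms base_in_sets_L by (auto simp: simple_rep_def)
  then show ?thesis
  proof (induction h)
    case (Cons p h)
    obtain x B where p: "p = (x, B)" by (cases p)
    have [measurable]: "B \<in> sets L" "simple_fun h \<in> borel_measurable L" using Cons by (auto simp: p)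
    have "simple_fun (p # h) = (\<lambda>s. x * indicator B s + simple_fun h s)" by (simp add: p fun_eq_iff)
    then show ?case by simp
  next
    case Nil
    have "simple_fun [] = (\<lambda>_. 0)" by (simp add: fun_eq_iff)
    then show ?case by simp
  qed
qed

lemma K_mult_le:
  assumes "s \<in> space L" "\<bar>v\<bar> \<le> C * \<bar>u\<bar>" "0 \<le> C"
  shows "norm (K v s) \<le> cumulant_bound C * cumulant_majorant a \<sigma>2 \<rho> u s"
proof -
  obtain c where c: "v = c * u" "\<bar>c\<bar> \<le> C"
  proof (cases "u = 0")
    case True
    then show ?thesis using assms that[of 0] by simp
  next
    case False
    then show ?thesis using assms that[of "v / u"] by (simp add: field_simps)
  qed
  show ?thesis unfolding c(1)
    by (rule norm_cumulant_mult_le[of \<rho> s, OF refl levy_at[OF assms(1)] c(2)])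
qed

lemma K_tendsto: "s \<in> space L \<Longrightarrow> u \<longlonglongrightarrow> v \<Longrightarrow> (\<lambda>n. K (u n) s) \<longlonglongrightarrow> K v s"
  by (rule cumulant_tendsto[of \<rho> s, OF refl levy_at])

end

section \<open>The integral of a function\<close>

context controlled_qid_random_measure
begin

context
  fixes f :: "'s \<Rightarrow> real"
  assumes f [measurable]: "f \<in> borel_measurable L"
    and i: "(\<integral>\<^sup>+s. ennreal \<bar>U_fun a \<rho> (f s) s\<bar> \<partial>L) < \<infinity>"
    and ii: "(\<integral>\<^sup>+s. ennreal ((f s)\<^sup>2 * \<sigma>2 s) \<partial>L) < \<infinity>"
    and iii: "(\<integral>\<^sup>+s. V0_fun \<rho> (f s) s \<partial>L) < \<infinity>"
begin

lemma U_integrable: "integrable L (\<lambda>s. U_fun a \<rho> (f s) s)"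
proof -
  have [measurable]: "(\<lambda>s. U_fun a \<rho> (f s) s) \<in> borel_measurable L"
    by (rule U_fun_measurable[OF refl levy_kernels]) measurable
  show ?thesis using i by (intro integrableI_bounded) auto
qed

lemma variance_integrable: "integrable L (\<lambda>s. (f s)\<^sup>2 * \<sigma>2 s)"
proof (rule integrableI_bounded)
  have "(\<integral>\<^sup>+s. ennreal (norm ((f s)\<^sup>2 * \<sigma>2 s)) \<partial>L) = (\<integral>\<^sup>+s. ennreal ((f s)\<^sup>2 * \<sigma>2 s) \<partial>L)"
    using \<sigma>2_nonneg by (intro nn_integral_cong_AE) (auto elim!: eventually_mono)
  then show "(\<integral>\<^sup>+s. ennreal (norm ((f s)\<^sup>2 * \<sigma>2 s)) \<partial>L) < \<infinity>" using ii by simp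
qed measurable

lemma V0_integrable: "integrable L (\<lambda>s. enn2real (V0_fun \<rho> (f s) s))"
proof (rule integrableI_bounded)
  have [measurable]: "(\<lambda>s. V0_fun \<rho> (f s) s) \<in> borel_measurable L"
    by (rule V0_fun_measurable[OF refl levy_kernels]) measurable
  show "(\<lambda>s. enn2real (V0_fun \<rho> (f s) s)) \<in> borel_measurable L" by measurable
  have "(\<integral>\<^sup>+s. ennreal (norm (enn2real (V0_fun \<rho> (f s) s))) \<partial>L) \<le> (\<integral>\<^sup>+s. V0_fun \<rho> (f s) s \<partial>L)"
    by (intro nn_integral_mono) (auto simp: ennreal_enn2real_if)
  then show "(\<integral>\<^sup>+s. ennreal (norm (enn2real (V0_fun \<rho> (f s) s))) \<partial>L) < \<infinity>" using iii by simp
qed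

abbreviation W :: "'s \<Rightarrow> real" where "W s \<equiv> cumulant_majorant a \<sigma>2 \<rho> (f s) s"

lemma W_integrable: "integrable L W"
proof -
  have "integrable L (\<lambda>s. (f s)\<^sup>2 * \<bar>\<sigma>2 s\<bar>)"
    using integrable_abs[OF variance_integrable] by (simp add: abs_mult)
  then show ?thesis
    unfolding cumulant_majorant_def using U_integrable V0_integrable by simp
qed

lemma K_integrable:
  assumes [measurable]: "v \<in> borel_measurable L" and le: "\<And>s. s \<in> space L \<Longrightarrow> \<bar>v s\<bar> \<le> C * \<bar>f s\<bar>" and C: "0 \<le> C"
  shows "integrable L (\<lambda>s. K (v s) s)"
proof (rule Bochner_Integration.integrable_bound)
  show "integrable L (\<lambda>s. cumulant_bound C * W s)" using W_integrable by simp
  show "AE s in L. norm (K (v s) s) \<le> norm (cumulant_bound C * W s)"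
  proof (rule AE_I2)
    fix s assume s: "s \<in> space L"
    have "norm (K (v s) s) \<le> cumulant_bound C * W s" by (rule K_mult_le[OF s le[OF s] C])
    also have "\<dots> \<le> norm (cumulant_bound C * W s)" by simp
    finally show "norm (K (v s) s) \<le> norm (cumulant_bound C * W s)" .
  qed
qed measurable

lemma LINT_K_tendsto:
  assumes v: "\<And>n. v n \<in> borel_measurable L" and le: "\<And>n s. s \<in> space L \<Longrightarrow> \<bar>v n s\<bar> \<le> C * \<bar>f s\<bar>" and C: "0 \<le> C"
    and lim: "\<And>s. s \<in> space L \<Longrightarrow> (\<lambda>n. v n s) \<longlonglongrightarrow> 0" and X: "X \<in> sets L"
  shows "(\<lambda>n. LINT s:X|L. K (v n s) s) \<longlonglongrightarrow> 0"
proof -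
  note [measurable] = v X
  have "(\<lambda>n. \<integral>s. indicator X s *\<^sub>R K (v n s) s \<partial>L) \<longlonglongrightarrow> (\<integral>s. 0 \<partial>L)"
  proof (rule integral_dominated_convergence)
    show "integrable L (\<lambda>s. cumulant_bound C * W s)" using W_integrable by simp
    show "AE s in L. (\<lambda>n. indicator X s *\<^sub>R K (v n s) s) \<longlonglongrightarrow> 0"
    proof (rule AE_I2)
      fix s assume s: "s \<in> space L"
      have "(\<lambda>n. K (v n s) s) \<longlonglongrightarrow> K 0 s" by (rule K_tendsto[OF s lim[OF s]])
      then have "(\<lambda>n. K (v n s) s) \<longlonglongrightarrow> 0" by simp
      then show "(\<lambda>n. indicator X s *\<^sub>R K (v n s) s) \<longlonglongrightarrow> 0"
        by (auto split: split_indicator)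
    qed
    show "AE s in L. norm (indicator X s *\<^sub>R K (v n s) s) \<le> cumulant_bound C * W s" for n
    proof (rule AE_I2)
      fix s assume s: "s \<in> space L"
      have "norm (indicator X s *\<^sub>R K (v n s) s) \<le> norm (K (v n s) s)"
        by (simp split: split_indicator)
      also have "\<dots> \<le> cumulant_bound C * W s" by (rule K_mult_le[OF s le[OF s] C])
      finally show "norm (indicator X s *\<^sub>R K (v n s) s) \<le> cumulant_bound C * W s" .
    qed
  qed measurable
  then show ?thesis by (simp add: set_lebesgue_integral_def)
qed

text \<open>
  The approximating functions are cut off to the exhausting sets, which makes them combinations of sets in \<open>\<S>\<close>.
  Differences of two of them are at most \<open>4 \<bar>f\<bar>\<close>.
\<close>

lemma approximation_exists: "\<exists>h. integral_approximation P \<S> \<Lambda> L h f"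
proof -
  obtain F where F': "\<forall>n. simple_function L (F n)" "\<forall>s\<in>space L. (\<lambda>n. F n s) \<longlonglongrightarrow> f s"
    "\<forall>n. \<forall>s\<in>space L. dist (F n s) 0 \<le> 2 * dist (f s) 0"
    using borel_measurable_implies_sequence_metric[OF f, of 0] by blast
  have F: "simple_function L (F n)" "s \<in> space L \<Longrightarrow> (\<lambda>n. F n s) \<longlonglongrightarrow> f s"
    "s \<in> space L \<Longrightarrow> \<bar>F n s\<bar> \<le> 2 * \<bar>f s\<bar>" for n s
    using F' by (auto simp: dist_norm)
  obtain E :: "nat \<Rightarrow> 's set" where E: "range E \<subseteq> \<S>" "incseq E" "(\<Union>n. E n) = S" using exhausting by blast
  have ES: "E n \<in> \<S>" for n using E by auto
  have "\<exists>h. simple_rep \<S> h \<and> (\<forall>s\<in>space L. simple_fun h s = F n s * indicator (E n) s)" for n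
    using simple_function_rep[OF ring_of_sets_axioms ES[of n] _ sets_L_Int_base[OF _ ES[of n]] F(1)[of n]]
      sets_into_space[OF ES[of n]] by (metis space_L)
  then obtain h where h: "\<And>n. simple_rep \<S> (h n)"
    "\<And>n s. s \<in> space L \<Longrightarrow> simple_fun (h n) s = F n s * indicator (E n) s" by metis
  have hm [measurable]: "simple_fun (h n) \<in> borel_measurable L" for n by (rule simple_fun_measurable[OF h(1)])
  have h_le: "\<bar>simple_fun (h n) s\<bar> \<le> 2 * \<bar>f s\<bar>" if "s \<in> space L" for n s
    using F(3)[OF that, of n] by (simp add: h(2)[OF that] split: split_indicator)
  have h_lim: "(\<lambda>n. simple_fun (h n) s) \<longlonglongrightarrow> f s" if s: "s \<in> space L" for s
  proof -
    obtain m where m: "s \<in> E m" using s E(3) space_L by auto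
    have "simple_fun (h n) s = F n s" if "m \<le> n" for n
    proof -
      have "s \<in> E n" using incseqD[OF E(2) that] m by blast
      then show ?thesis by (simp add: h(2)[OF s])
    qed
    then have "eventually (\<lambda>n. simple_fun (h n) s = F n s) sequentially"
      unfolding eventually_sequentially by blast
    then show ?thesis using F(2)[OF s] by (simp add: tendsto_cong)
  qed
  have "\<exists>Y. tendsto_in_prob P (\<lambda>n. simple_integral \<Lambda> A (h n)) Y" if A: "A \<in> sets L" for A
  proof (rule char_cauchy_imp_tendsto_in_prob[OF prob_space_axioms])
    show "simple_integral \<Lambda> A (h n) \<in> borel_measurable P" for n
      using h(1)[of n] A by (intro simple_integral_measurable) (auto simp: simple_rep_def)
    fix p q :: "nat \<Rightarrow> nat" and \<theta> :: real assume p: "\<And>j. j \<le> p j" and q: "\<And>j. j \<le> q j"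
    have pt: "filterlim p sequentially sequentially" "filterlim q sequentially sequentially"
      using p q by (auto intro: filterlim_at_top_mono[OF filterlim_ident])
    have "(\<lambda>j. LINT s:A|L. K (\<theta> * (simple_fun (h (p j)) s - simple_fun (h (q j)) s)) s) \<longlonglongrightarrow> 0"
    proof (rule LINT_K_tendsto[where C="4 * \<bar>\<theta>\<bar>"])
      fix s assume s: "s \<in> space L"
      show "\<bar>\<theta> * (simple_fun (h (p j)) s - simple_fun (h (q j)) s)\<bar> \<le> 4 * \<bar>\<theta>\<bar> * \<bar>f s\<bar>" for j
      proof -
        have "\<bar>simple_fun (h (p j)) s - simple_fun (h (q j)) s\<bar> \<le> 4 * \<bar>f s\<bar>"
          using h_le[OF s, of "p j"] h_le[OF s, of "q j"] by linarith
        then have "\<bar>\<theta>\<bar> * \<bar>simple_fun (h (p j)) s - simple_fun (h (q j)) s\<bar> \<le> \<bar>\<theta>\<bar> * (4 * \<bar>f s\<bar>)"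
          by (rule mult_left_mono) simp
        then show ?thesis by (simp add: abs_mult)
      qed
      have "(\<lambda>j. simple_fun (h (p j)) s) \<longlonglongrightarrow> f s" "(\<lambda>j. simple_fun (h (q j)) s) \<longlonglongrightarrow> f s"
        using filterlim_compose[OF h_lim[OF s]] pt by auto
      then have "(\<lambda>j. \<theta> * (simple_fun (h (p j)) s - simple_fun (h (q j)) s)) \<longlonglongrightarrow> \<theta> * (f s - f s)"
        by (intro tendsto_intros)
      then show "(\<lambda>j. \<theta> * (simple_fun (h (p j)) s - simple_fun (h (q j)) s)) \<longlonglongrightarrow> 0" by simp
    qed (use A in auto)
    then have "(\<lambda>j. exp (LINT s:A|L. K (\<theta> * (simple_fun (h (p j)) s - simple_fun (h (q j)) s)) s)) \<longlonglongrightarrow> exp 0"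
      by (rule tendsto_exp)
    then show "(\<lambda>j. char (distr P borel (\<lambda>\<omega>. simple_integral \<Lambda> A (h (p j)) \<omega> - simple_integral \<Lambda> A (h (q j)) \<omega>)) \<theta>) \<longlonglongrightarrow> 1"
      by (simp add: simple_integral_diff_char[OF h(1) h(1) A])
  qed
  then show ?thesis
    unfolding integral_approximation_def using h(1) h_lim by (intro exI[of _ h]) auto
qed

lemma rm_integrable_f: "rm_integrable P \<S> \<Lambda> L f"
  using f approximation_exists by (simp add: rm_integrable_def)

text \<open>
  For an arbitrary approximating sequence \<open>h\<close> the differences of the cumulants of \<open>\<theta> h\<^sub>n\<close> and \<open>\<theta> f\<close> tend to \<open>0\<close> almost
  everywhere by continuity, and the exponentials of their integrals over each \<open>A\<close> converge,
  being convergent characteristic functions divided by a fixed non-zero number.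
\<close>

lemma has_rm_integral_char:
  assumes "has_rm_integral P \<S> \<Lambda> L f S Y"
  shows "char (distr P borel Y) \<theta> = exp (\<integral>s. K (\<theta> * f s) s \<partial>L)"
proof -
  let ?Kf = "\<lambda>s. K (\<theta> * f s) s"
  obtain h where h: "integral_approximation P \<S> \<Lambda> L h f"
    and Y: "tendsto_in_prob P (\<lambda>n. simple_integral \<Lambda> S (h n)) Y"
    using assms by (auto simp: has_rm_integral_def)
  let ?Kh = "\<lambda>n s. K (\<theta> * simple_fun (h n) s) s"
  have rep: "simple_rep \<S> (h n)" for n using h by (simp add: integral_approximation_def)
  have ae: "AE s in L. (\<lambda>n. simple_fun (h n) s) \<longlonglongrightarrow> f s" using h by (simp add: integral_approximation_def)
  have meas: "simple_integral \<Lambda> A (h n) \<in> borel_measurable P" if "A \<in> sets L" for A n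
    using rep[of n] that by (intro simple_integral_measurable) (auto simp: simple_rep_def)
  have SL: "S \<in> sets L" using sets.top[of L] by (simp add: space_L)
  define g where "g n s = ?Kh n s - ?Kf s" for n s
  have Kf: "integrable L (\<lambda>s. ?Kf s)"
    by (rule K_integrable[where C="\<bar>\<theta>\<bar>"]) (auto simp: abs_mult)
  have Kh: "integrable L (\<lambda>s. ?Kh n s)" for n
  proof -
    have "set_integrable L (space L) (\<lambda>s. ?Kh n s)"
      using simple_integral_char(1)[OF rep SL] by (simp add: space_L)
    then show ?thesis by (simp add: set_integrable_def cong: Bochner_Integration.integrable_cong)
  qed
  have si: "set_integrable L A (\<lambda>s. ?Kf s)" if "A \<in> sets L" for A
    using integrable_mult_indicator[OF that Kf] by (simp add: set_integrable_def)
  have "(\<lambda>n. exp (\<integral>s. g n s \<partial>L)) \<longlonglongrightarrow> 1"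
  proof (rule exp_integral_gliding_hump[OF sigma_finite_L])
    show "integrable L (g n)" for n unfolding g_def using Kf Kh by simp
    show "AE s in L. (\<lambda>n. g n s) \<longlonglongrightarrow> 0"
      using ae AE_space
    proof eventually_elim
      fix s assume s: "(\<lambda>n. simple_fun (h n) s) \<longlonglongrightarrow> f s" "s \<in> space L"
      have "(\<lambda>n. ?Kh n s) \<longlonglongrightarrow> ?Kf s"
        by (rule K_tendsto[OF s(2)]) (intro tendsto_intros s(1))
      then show "(\<lambda>n. g n s) \<longlonglongrightarrow> 0" unfolding g_def by (simp add: LIM_zero_iff)
    qed
    fix A assume A: "A \<in> sets L"
    obtain Z where Z: "tendsto_in_prob P (\<lambda>n. simple_integral \<Lambda> A (h n)) Z"
      using h A by (auto simp: integral_approximation_def)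
    have "(\<lambda>n. exp (LINT s:A|L. ?Kh n s)) \<longlonglongrightarrow> char (distr P borel Z) \<theta>"
      using tendsto_in_prob_char[OF prob_space_axioms meas[OF A] Z] simple_integral_char(2)[OF rep A] by simp
    then have "(\<lambda>n. exp (LINT s:A|L. ?Kh n s) / exp (LINT s:A|L. ?Kf s))
        \<longlonglongrightarrow> char (distr P borel Z) \<theta> / exp (LINT s:A|L. ?Kf s)"
      by (intro tendsto_divide tendsto_const) auto
    moreover have "exp (LINT s:A|L. ?Kh n s) / exp (LINT s:A|L. ?Kf s)
        = exp (LINT s:A|L. g n s)" for n
      using set_integral_diff(2)[OF simple_integral_char(1)[OF rep A] si[OF A]] by (simp add: g_def exp_diff)
    ultimately show "convergent (\<lambda>n. exp (LINT s:A|L. g n s))" by (auto simp: convergent_def)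
  qed
  then have "(\<lambda>n. exp (\<integral>s. g n s \<partial>L) * exp (\<integral>s. ?Kf s \<partial>L)) \<longlonglongrightarrow> 1 * exp (\<integral>s. ?Kf s \<partial>L)"
    by (intro tendsto_mult tendsto_const)
  moreover have "exp (\<integral>s. g n s \<partial>L) * exp (\<integral>s. ?Kf s \<partial>L) = char (distr P borel (simple_integral \<Lambda> S (h n))) \<theta>" for n
  proof -
    have "(LINT s:S|L. ?Kh n s) = (\<integral>s. ?Kh n s \<partial>L)"
      using set_integral_space[OF Kh] by (simp add: space_L)
    then show ?thesis
      using Kf Kh by (simp add: g_def exp_diff simple_integral_char(2)[OF rep SL])
  qed
  ultimately have "(\<lambda>n. char (distr P borel (simple_integral \<Lambda> S (h n))) \<theta>) \<longlonglongrightarrow> exp (\<integral>s. ?Kf s \<partial>L)"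
    by simp
  then show ?thesis
    using tendsto_in_prob_char[OF prob_space_axioms meas[OF SL] Y] LIMSEQ_unique by blast
qed

abbreviation "Fp \<equiv> image_levy L (\<lambda>s. ql_pos (\<rho> s)) f"
abbreviation "Fm \<equiv> image_levy L (\<lambda>s. ql_neg (\<rho> s)) f"

lemma image_weight_finite:
  "(\<integral>\<^sup>+s. (\<integral>\<^sup>+x. ennreal (wt (f s * x)) \<partial>ql_pos (\<rho> s)) \<partial>L) < \<infinity>"
  "(\<integral>\<^sup>+s. (\<integral>\<^sup>+x. ennreal (wt (f s * x)) \<partial>ql_neg (\<rho> s)) \<partial>L) < \<infinity>"
proof -
  have V: "V0_fun \<rho> (f s) s = (\<integral>\<^sup>+x. ennreal (wt (f s * x)) \<partial>ql_pos (\<rho> s)) + (\<integral>\<^sup>+x. ennreal (wt (f s * x)) \<partial>ql_neg (\<rho> s))"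
    if "s \<in> space L" for s
    by (rule V0_fun_eq[where \<rho>=\<rho> and s=s, OF refl levy_at[OF that]])
  have "(\<integral>\<^sup>+s. (\<integral>\<^sup>+x. ennreal (wt (f s * x)) \<partial>ql_pos (\<rho> s)) \<partial>L) \<le> (\<integral>\<^sup>+s. V0_fun \<rho> (f s) s \<partial>L)"
    "(\<integral>\<^sup>+s. (\<integral>\<^sup>+x. ennreal (wt (f s * x)) \<partial>ql_neg (\<rho> s)) \<partial>L) \<le> (\<integral>\<^sup>+s. V0_fun \<rho> (f s) s \<partial>L)"
    by (intro nn_integral_mono; simp add: V)+
  then show "(\<integral>\<^sup>+s. (\<integral>\<^sup>+x. ennreal (wt (f s * x)) \<partial>ql_pos (\<rho> s)) \<partial>L) < \<infinity>"
    "(\<integral>\<^sup>+s. (\<integral>\<^sup>+x. ennreal (wt (f s * x)) \<partial>ql_neg (\<rho> s)) \<partial>L) < \<infinity>"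
    using iii by (auto intro: order_le_less_trans)
qed

lemmas image_pos = image_levy_mixture[OF levy_kernel_ql_pos[OF levy_kernels] f image_weight_finite(1)]
lemmas image_neg = image_levy_mixture[OF levy_kernel_ql_neg[OF levy_kernels] f image_weight_finite(2)]

lemma integral_K_eq:
  "(\<integral>s. K (\<theta> * f s) s \<partial>L) = \<i> * of_real (\<theta> * (LINT s|L. U_fun a \<rho> (f s) s))
     - of_real (1 / 2 * \<theta>\<^sup>2 * (LINT s|L. (f s)\<^sup>2 * \<sigma>2 s)) + ql_integral (levy_diff Fp Fm) (cumulant_kernel \<theta>)"
proof -
  have m: "cumulant_kernel \<theta> \<in> borel_measurable borel" by measurable
  note p = image_pos(3)[OF m norm_cumulant_kernel_le]
  note n = image_neg(3)[OF m norm_cumulant_kernel_le]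
  let ?u = "\<lambda>s. \<i> * complex_of_real (\<theta> * U_fun a \<rho> (f s) s)"
  let ?v = "\<lambda>s. complex_of_real (\<theta>\<^sup>2 / 2 * ((f s)\<^sup>2 * \<sigma>2 s))"
  let ?p = "\<lambda>s. \<integral>x. cumulant_kernel \<theta> (f s * x) \<partial>ql_pos (\<rho> s)"
  let ?n = "\<lambda>s. \<integral>x. cumulant_kernel \<theta> (f s * x) \<partial>ql_neg (\<rho> s)"
  have iu: "integrable L ?u" using U_integrable by (intro integrable_mult_right integrable_of_real)
  have iv: "integrable L ?v" using variance_integrable by (intro integrable_of_real integrable_mult_right)
  have "(\<integral>s. K (\<theta> * f s) s \<partial>L) = (\<integral>s. ?u s - ?v s + (?p s - ?n s) \<partial>L)"
  proof (rule Bochner_Integration.integral_cong[OF refl])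
    fix s assume "s \<in> space L"
    from cumulant_mult[where \<rho>=\<rho> and s=s and c=\<theta> and u="f s", OF refl levy_at[OF this]]
    show "K (\<theta> * f s) s = ?u s - ?v s + (?p s - ?n s)" by (simp only: ql_integral_def)
  qed
  also have "\<dots> = (\<integral>s. ?u s \<partial>L) - (\<integral>s. ?v s \<partial>L) + ((\<integral>s. ?p s \<partial>L) - (\<integral>s. ?n s \<partial>L))"
    using iu iv p n by simp
  also have "(\<integral>s. ?p s \<partial>L) - (\<integral>s. ?n s \<partial>L) = ql_integral (levy_diff Fp Fm) (cumulant_kernel \<theta>)"
    using p n ql_integral_levy_diff[OF image_pos(2) image_neg(2) m norm_cumulant_kernel_le] by simp
  also have "(\<integral>s. ?u s \<partial>L) = \<i> * of_real (\<theta> * (LINT s|L. U_fun a \<rho> (f s) s))"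
    by (simp only: integral_mult_right_zero integral_complex_of_real)
  also have "(\<integral>s. ?v s \<partial>L) = of_real (1 / 2 * \<theta>\<^sup>2 * (LINT s|L. (f s)\<^sup>2 * \<sigma>2 s))"
    by (simp only: integral_mult_right_zero integral_complex_of_real) simp
  finally show ?thesis .
qed

lemma char_formula:
  assumes "has_rm_integral P \<S> \<Lambda> L f S Y"
  shows "char (distr P borel Y) \<theta> = exp (\<i> * of_real (\<theta> * (LINT s|L. U_fun a \<rho> (f s) s))
     - of_real (1 / 2 * \<theta>\<^sup>2 * (LINT s|L. (f s)\<^sup>2 * \<sigma>2 s))
     + ql_integral (levy_diff Fp Fm) (\<lambda>x. iexp (\<theta> * x) - 1 - \<i> * of_real (\<theta> * trunc x)))"
proof -
  have "cumulant_kernel \<theta> = (\<lambda>x. iexp (\<theta> * x) - 1 - \<i> * of_real (\<theta> * trunc x))"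
    by (simp add: cumulant_kernel_def fun_eq_iff)
  then show ?thesis using has_rm_integral_char[OF assms] integral_K_eq by simp
qed

text \<open>
  The law of the integral over \<open>S\<close> is the witness: it has the image measures in its triplet.
\<close>

lemma quasi_levy_measure_image: "quasi_levy_measure (levy_diff Fp Fm)"
proof -
  obtain h where h: "integral_approximation P \<S> \<Lambda> L h f" using approximation_exists by blast
  have SL: "S \<in> sets L" using sets.top[of L] by (simp add: space_L)
  then obtain Y where Y: "tendsto_in_prob P (\<lambda>n. simple_integral \<Lambda> S (h n)) Y"
    using h by (auto simp: integral_approximation_def)
  then have hY: "has_rm_integral P \<S> \<Lambda> L f S Y" using f h SL by (auto simp: has_rm_integral_def)
  have "Y \<in> borel_measurable P" using Y by (simp add: tendsto_in_prob_def)
  then have "real_distribution (distr P borel Y)" by (rule real_distribution_distr)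
  then have "qid_triplet (distr P borel Y) (LINT s|L. U_fun a \<rho> (f s) s) (LINT s|L. (f s)\<^sup>2 * \<sigma>2 s) (levy_diff Fp Fm)"
    using char_formula[OF hY] quasi_levy_type_levy_diff[OF image_pos(2) image_neg(2)]
    by (simp add: qid_triplet_def)
  then show ?thesis by (auto simp: quasi_levy_measure_def)
qed

end

end

theorem theorem5p10:
  fixes P :: "'w measure" and S :: "'s set" and \<S> :: "'s set set"
    and \<Lambda> :: "'s set \<Rightarrow> 'w \<Rightarrow> real"
    and \<nu>0 \<nu>1 :: "'s set \<Rightarrow> real" and G M :: "'s set \<Rightarrow> real measure"
    and L :: "'s measure" and a \<sigma>2 :: "'s \<Rightarrow> real"
    and \<rho>G \<rho>M :: "'s \<Rightarrow> real measure" and \<rho> :: "'s \<Rightarrow> real set \<Rightarrow> real"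
    and f :: "'s \<Rightarrow> real" and Fp Fm :: "real measure" and Ff :: "real set \<Rightarrow> real"
  assumes "controlled_qid_random_measure P S \<S> \<Lambda> \<nu>0 \<nu>1 G M L a \<sigma>2 \<rho>G \<rho>M"
    and "\<rho> = (\<lambda>s. levy_diff (\<rho>G s) (\<rho>M s))"
    and "f \<in> borel_measurable (sigma S \<S>)"
    and "Fp = image_levy L (\<lambda>s. ql_pos (\<rho> s)) f"
    and "Fm = image_levy L (\<lambda>s. ql_neg (\<rho> s)) f"
    and "Ff = levy_diff Fp Fm"
    and i: "(\<integral>\<^sup>+s. ennreal \<bar>U_fun a \<rho> (f s) s\<bar> \<partial>L) < \<infinity>"
    and ii: "(\<integral>\<^sup>+s. ennreal (\<bar>f s\<bar>\<^sup>2 * \<sigma>2 s) \<partial>L) < \<infinity>"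
    and iii: "(\<integral>\<^sup>+s. V0_fun \<rho> (f s) s \<partial>L) < \<infinity>"
  shows "rm_integrable P \<S> \<Lambda> L f
    \<and> (\<forall>B\<in>sets borel. emeasure Fp B = image_set_fun L (\<lambda>s. ql_pos (\<rho> s)) f B)
    \<and> (\<forall>B\<in>sets borel. emeasure Fm B = image_set_fun L (\<lambda>s. ql_neg (\<rho> s)) f B)
    \<and> levy_measure Fp \<and> levy_measure Fm
    \<and> quasi_levy_measure Ff
    \<and> (\<exists>!F. F \<in> extensional borel_off_zero \<and> quasi_levy_measure F
           \<and> (\<forall>B\<in>borel_off_zero. F B = measure Fp B - measure Fm B))
    \<and> (\<forall>Y. has_rm_integral P \<S> \<Lambda> L f S Y \<longrightarrow>
         (\<forall>\<theta>. char (distr P borel Y) \<theta> =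
            exp (\<i> * of_real (\<theta> * (LINT s|L. U_fun a \<rho> (f s) s))
                 - of_real (1 / 2 * \<theta>\<^sup>2 * (LINT s|L. \<bar>f s\<bar>\<^sup>2 * \<sigma>2 s))
                 + ql_integral Ff (\<lambda>x. iexp (\<theta> * x) - 1 - \<i> * of_real (\<theta> * trunc x)))))"
proof -
  interpret controlled_qid_random_measure P S \<S> \<Lambda> \<nu>0 \<nu>1 G M L a \<sigma>2 \<rho>G \<rho>M by fact
  have f: "f \<in> borel_measurable L"
    using assms(3) by (simp add: measurable_cong_sets[OF sets_L refl])
  note cond = f i[unfolded assms(2)] ii[unfolded power2_abs] iii[unfolded assms(2)]
  note eqs = assms(4-6)[unfolded assms(2)]
  have quasi: "quasi_levy_measure Ff"
    using quasi_levy_measure_image[OF cond] by (simp add: eqs)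
  have "\<exists>!F. F \<in> extensional borel_off_zero \<and> quasi_levy_measure F
      \<and> (\<forall>B\<in>borel_off_zero. F B = measure Fp B - measure Fm B)"
  proof (rule ex1I[of _ Ff])
    show "Ff \<in> extensional borel_off_zero \<and> quasi_levy_measure Ff
      \<and> (\<forall>B\<in>borel_off_zero. Ff B = measure Fp B - measure Fm B)"
      using quasi by (simp add: assms(6) levy_diff_def)
    fix F assume "F \<in> extensional borel_off_zero \<and> quasi_levy_measure F
      \<and> (\<forall>B\<in>borel_off_zero. F B = measure Fp B - measure Fm B)"
    then show "F = Ff"
      by (intro extensionalityI[of F borel_off_zero Ff]) (auto simp: assms(6) levy_diff_def)
  qed
  then show ?thesis
    using rm_integrable_f[OF cond] image_pos(1,2)[OF cond] image_neg(1,2)[OF cond] quasi char_formula[OF cond]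
    unfolding assms(2) eqs power2_abs by blast
qed

end
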